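(* Let $V$ be a commutative Frobenius algebra over a commutative unital ring $R$, $M$ a compact connected orientable $3$-manifold and $\alpha\subset\partial M$ a closed $1$-manifold. Then the Bar-Natan module $\mathcal{W}(M,\alpha;V)$ is naturally a $V^{\otimes\underline{\alpha}}$-module, with module structure defined by multiplying Frobenius algebra elements into boundary components: the factor $v_a$ of $\otimes_{a\in\underline{\alpha}}v_a$ multiplies the color of the surface component whose boundary contains the circle $a$.
   Context: Everything is smooth. $\underline{X}$ is the set of components of $X$; $V^{\otimes\underline{\alpha}}$ is the (unordered) tensor product over $R$ of copies of $V$ indexed by $\underline{\alpha}$, an algebra with factorwise multiplication, $V^{\otimes\emptyset}=R$. A surface in $M$ bounding $\alpha$ is a properly embedded compact orientable $2$-manifold, not necessarily connected, with boundary $\alpha$. Frobenius algebra: $V$ is a commutative associative unital $R$-algebra (multiplication $m$) with a coassociative cocommutative comultiplication $\Delta:V\to V\otimes V$, a $V$-bimodule map, and counit $\varepsilon:V\to R$, $(\varepsilon\otimes\mathrm{Id})\Delta=\mathrm{Id}$; the handle operator $\mathfrak{k}:V\to V$ is multiplication by $m(\Delta(1))$. $\mathcal{W}(M,\alpha;V)$ is the free $R$-module on isotopy classes rel boundary of surfaces in $M$ bounding $\alpha$ with each component colored by an element of $V$, modulo the Bar-Natan relations: (1) $R$-multilinearity in the colors of components; (2) a $2$-sphere component colored $x$ bounding a $3$-ball in $M$ with interior disjoint from the surface may be removed with the factor $\varepsilon(x)$; (3) neck-cutting: replace an annular neighborhood of a circle on the surface that bounds a disk in $M$ with interior disjoint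 from the surface by two parallel disks; if this separates a component colored $x$ into two components, these are colored $x',x''$ with $\Delta(x)=x'\otimes x''$ (sum over Sweedler terms), and if it does not separate, the color $x$ is replaced by $\mathfrak{k}(x)$. *)

theory Defs
  imports "HOL-Analysis.Analysis" "HOL-Algebra.Module" "HOL-Algebra.QuotRing"
begin

section \<open>Smooth manifolds with boundary and properly embedded surfaces\<close>

primrec Ck_on :: "nat \<Rightarrow> ('e::real_normed_vector \<Rightarrow> 'f::real_normed_vector) \<Rightarrow> 'e set \<Rightarrow> bool" where
  "Ck_on 0 g U \<longleftrightarrow> continuous_on U g"
| "Ck_on (Suc k) g U \<longleftrightarrow>
     g differentiable_on U \<and> (\<forall>v. Ck_on k (\<lambda>x. frechet_derivative g (at x) v) U)"

text \<open>Only used for open sets \<open>U\<close>.\<close>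

definition smooth_on :: "('e::real_normed_vector \<Rightarrow> 'f::real_normed_vector) \<Rightarrow> 'e set \<Rightarrow> bool" where
  "smooth_on g U \<longleftrightarrow> (\<forall>k. Ck_on k g U)"

text \<open>A coordinate system is a pair of its domain and its coordinate map (whose values outside
  the domain are irrelevant); an atlas is a set of coordinate systems.\<close>

type_synonym ('a, 'e) coord = "'a set \<times> ('a \<Rightarrow> 'e)"

definition euclid :: "('e, 'e) coord set" where
  "euclid = {(UNIV, \<lambda>x. x)}"

definition prod_atlas ::
    "('a, 'e) coord set \<Rightarrow> ('b, 'f) coord set \<Rightarrow> ('a \<times> 'b, 'e \<times> 'f) coord set" where
  "prod_atlas A B = {(U \<times> W, map_prod \<phi> \<psi>) | U \<phi> W \<psi>. (U, \<phi>) \<in> A \<and> (W, \<psi>) \<in> B}"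

text \<open>Smoothness on an arbitrary subset \<open>S\<close>: in suitable coordinates around each point, the map
  extends to a smooth map on an open subset of the coordinate space. On manifolds with
  boundary or corners this is the usual notion.\<close>

definition smooth_map_on ::
    "('a, 'e::euclidean_space) coord set \<Rightarrow> ('b, 'f::euclidean_space) coord set \<Rightarrow> 'a set \<Rightarrow> ('a \<Rightarrow> 'b) \<Rightarrow> bool"
  where "smooth_map_on A B S f \<longleftrightarrow>
    (\<forall>p\<in>S. \<exists>(U, \<phi>)\<in>A. \<exists>(W, \<psi>)\<in>B. p \<in> U \<and> f p \<in> W \<and>
       (\<exists>O' g. open O' \<and> \<phi> p \<in> O' \<and> smooth_on g O' \<and>
          (\<forall>q\<in>S \<inter> U. \<phi> q \<in> O' \<longrightarrow> f q \<in> W \<and> g (\<phi> q) = \<psi> (f q))))"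

definition smooth_embedding ::
    "('a, 'e::euclidean_space) coord set \<Rightarrow> ('b, 'f::euclidean_space) coord set \<Rightarrow> 'a set \<Rightarrow> ('a \<Rightarrow> 'b) \<Rightarrow> bool"
  where "smooth_embedding A B S f \<longleftrightarrow>
    inj_on f S \<and> smooth_map_on A B S f \<and> smooth_map_on B A (f ` S) (inv_into S f)"

text \<open>Charts take values in the half space where the first coordinate is nonnegative.\<close>

definition half_space :: "(real^'n::{finite,one}) set" where
  "half_space = {x. 0 \<le> x $ 1}"

definition chart :: "'m topology \<Rightarrow> ('m, real^'n::{finite,one}) coord \<Rightarrow> bool" where
  "chart M = (\<lambda>(U, \<phi>). openin M U \<and> openin (top_of_set half_space) (\<phi> ` U) \<and>
     homeomorphic_map (subtopology M U) (top_of_set (\<phi> ` U)) \<phi>)"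

definition compatible :: "('m, real^'n::{finite,one}) coord \<Rightarrow> ('m, real^'n::{finite,one}) coord \<Rightarrow> bool" where
  "compatible c d \<longleftrightarrow> smooth_map_on {c} {d} (fst c \<inter> fst d) (\<lambda>p. p)
                    \<and> smooth_map_on {d} {c} (fst c \<inter> fst d) (\<lambda>p. p)"

definition smooth_manifold :: "'m topology \<Rightarrow> ('m, real^'n::{finite,one}) coord set \<Rightarrow> bool" where
  "smooth_manifold M A \<longleftrightarrow> Hausdorff_space M \<and> second_countable M \<and>
     (\<forall>c\<in>A. chart M c) \<and> \<Union>(fst ` A) = topspace M \<and> (\<forall>c\<in>A. \<forall>d\<in>A. compatible c d)"

definition max_atlas ::
    "'m topology \<Rightarrow> ('m, real^'n::{finite,one}) coord set \<Rightarrow> ('m, real^'n::{finite,one}) coord set" where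
  "max_atlas M A = {c. chart M c \<and> (\<forall>d\<in>A. compatible c d)}"

definition manifold_boundary :: "('m, real^'n::{finite,one}) coord set \<Rightarrow> 'm set" where
  "manifold_boundary A = {p. \<exists>(U, \<phi>)\<in>A. p \<in> U \<and> \<phi> p $ 1 = 0}"

text \<open>The differential within the (relatively open) subset \<open>\<phi> ` (U \<inter> W)\<close> of the half space
  is unique also at boundary points.\<close>

definition orientable :: "'m topology \<Rightarrow> ('m, real^'n::{finite,one}) coord set \<Rightarrow> bool" where
  "orientable M A \<longleftrightarrow> (\<exists>B \<subseteq> max_atlas M A. \<Union>(fst ` B) = topspace M \<and>
     (\<forall>(U, \<phi>)\<in>B. \<forall>(W, \<psi>)\<in>B. \<forall>p\<in>U \<inter> W. \<exists>D.
        ((\<lambda>x. \<psi> (inv_into U \<phi> x)) has_derivative D) (at (\<phi> p) within \<phi> ` (U \<inter> W)) \<and>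
        0 < det (matrix D)))"

definition components_of :: "'m topology \<Rightarrow> 'm set \<Rightarrow> 'm set set" where
  "components_of M S = connected_components_of (subtopology M S)"

definition closed_curve_in_boundary ::
    "'m topology \<Rightarrow> ('m, real^3) coord set \<Rightarrow> 'm set \<Rightarrow> bool" where
  "closed_curve_in_boundary M A \<alpha> \<longleftrightarrow> \<alpha> \<subseteq> manifold_boundary A \<and> compactin M \<alpha> \<and>
     (\<forall>p\<in>\<alpha>. \<exists>(U, \<phi>)\<in>max_atlas M A. p \<in> U \<and> \<alpha> \<inter> U = {q \<in> U. \<phi> q $ 1 = 0 \<and> \<phi> q $ 3 = 0})"

text \<open>A chart of \<open>M\<close> in which \<open>S\<close> is the coordinate plane where the third coordinate vanishes.
  Since charts at boundary points are half-space charts, a set covered by such charts is a smooth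
  surface transverse to the boundary of \<open>M\<close>, and its own boundary is its
  intersection with the boundary of \<open>M\<close>.\<close>

definition slice_charts ::
    "'m topology \<Rightarrow> ('m, real^3) coord set \<Rightarrow> 'm set \<Rightarrow> ('m, real^3) coord set" where
  "slice_charts M A S = {(U, \<phi>) \<in> max_atlas M A. S \<inter> U = {q \<in> U. \<phi> q $ 3 = 0}}"

definition surface_atlas ::
    "'m topology \<Rightarrow> ('m, real^3) coord set \<Rightarrow> 'm set \<Rightarrow> ('m, real^2) coord set" where
  "surface_atlas M A S =
     (\<lambda>(U, \<phi>). (S \<inter> U, \<lambda>q. vector [\<phi> q $ 1, \<phi> q $ 2])) ` slice_charts M A S"

definition surface_bounding ::
    "'m topology \<Rightarrow> ('m, real^3) coord set \<Rightarrow> 'm set \<Rightarrow> 'm set \<Rightarrow> bool" where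
  "surface_bounding M A \<alpha> S \<longleftrightarrow> compactin M S \<and> S \<subseteq> \<Union>(fst ` slice_charts M A S) \<and>
     S \<inter> manifold_boundary A = \<alpha> \<and> orientable (subtopology M S) (surface_atlas M A S)"


section \<open>Modules given by generators and relations\<close>

text \<open>The ring operations of a record that is only used as a module are irrelevant.\<close>

definition free_module :: "('r, 'k) ring_scheme \<Rightarrow> 'b set \<Rightarrow> ('r, 'b \<Rightarrow> 'r) module" where
  "free_module R B =
    \<lparr>carrier = {p. (\<forall>b\<in>B. p b \<in> carrier R) \<and> (\<forall>b. b \<notin> B \<longrightarrow> p b = \<zero>\<^bsub>R\<^esub>) \<and> finite {b. p b \<noteq> \<zero>\<^bsub>R\<^esub>}},
     mult = undefined, one = undefined,
     zero = (\<lambda>b. \<zero>\<^bsub>R\<^esub>), add = (\<lambda>p q b. p b \<oplus>\<^bsub>R\<^esub> q b), smult = (\<lambda>r p b. r \<otimes>\<^bsub>R\<^esub> p b)\<rparr>"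

definition single :: "('r, 'k) ring_scheme \<Rightarrow> 'b \<Rightarrow> 'b \<Rightarrow> 'r" where
  "single R b = (\<lambda>x. if x = b then \<one>\<^bsub>R\<^esub> else \<zero>\<^bsub>R\<^esub>)"

definition lin_comb ::
    "('r, 'k) ring_scheme \<Rightarrow> ('r, 'n, 'l) module_scheme \<Rightarrow> ('b \<Rightarrow> 'n) \<Rightarrow> ('b \<Rightarrow> 'r) \<Rightarrow> 'n" where
  "lin_comb R N h p = (\<Oplus>\<^bsub>N\<^esub>b\<in>{b. p b \<noteq> \<zero>\<^bsub>R\<^esub>}. p b \<odot>\<^bsub>N\<^esub> h b)"

definition submodule_span ::
    "('r, 'k) ring_scheme \<Rightarrow> ('r, 'n, 'l) module_scheme \<Rightarrow> 'n set \<Rightarrow> 'n set" where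
  "submodule_span R F G = \<Inter>{N. submodule N R F \<and> G \<subseteq> N}"

text \<open>The factor ring by \<open>N\<close> together with the induced scalar multiplication.\<close>

definition quotient_module ::
    "('r, 'n, 'l) module_scheme \<Rightarrow> 'n set \<Rightarrow> ('r, 'n set) module" where
  "quotient_module F N = ring.extend (F Quot N)
     \<lparr>smult = (\<lambda>r K. \<Union>k\<in>K. N +>\<^bsub>F\<^esub> (r \<odot>\<^bsub>F\<^esub> k))\<rparr>"

definition presented_module ::
    "('r, 'k) ring_scheme \<Rightarrow> 'b set \<Rightarrow> ('b \<Rightarrow> 'r) set \<Rightarrow> ('r, ('b \<Rightarrow> 'r) set) module" where
  "presented_module R B rels =
     quotient_module (free_module R B) (submodule_span R (free_module R B) rels)"

definition generator ::
    "('r, 'k) ring_scheme \<Rightarrow> 'b set \<Rightarrow> ('b \<Rightarrow> 'r) set \<Rightarrow> 'b \<Rightarrow> ('b \<Rightarrow> 'r) set" where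
  "generator R B rels b =
     submodule_span R (free_module R B) rels +>\<^bsub>free_module R B\<^esub> single R b"

text \<open>Extension of \<open>h\<close> from the generators of a presented module to a linear map; independent
  of the chosen representative whenever \<open>h\<close> respects the relations.\<close>

definition lin_ext ::
    "('r, 'k) ring_scheme \<Rightarrow> ('r, 'n, 'l) module_scheme \<Rightarrow> ('b \<Rightarrow> 'n) \<Rightarrow> ('b \<Rightarrow> 'r) set \<Rightarrow> 'n" where
  "lin_ext R N h K = lin_comb R N h (SOME p. p \<in> K)"


section \<open>Tensor products\<close>

definition tensor_rels ::
    "('r, 'k) ring_scheme \<Rightarrow> ('r, 'a, 'l) module_scheme \<Rightarrow> ('r, 'b, 'l') module_scheme
      \<Rightarrow> ('a \<times> 'b \<Rightarrow> 'r) set" where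
  "tensor_rels R A B = (let F = free_module R (carrier A \<times> carrier B); s = single R in
     {s (x \<oplus>\<^bsub>A\<^esub> x', y) \<ominus>\<^bsub>F\<^esub> (s (x, y) \<oplus>\<^bsub>F\<^esub> s (x', y)) | x x' y.
        x \<in> carrier A \<and> x' \<in> carrier A \<and> y \<in> carrier B} \<union>
     {s (x, y \<oplus>\<^bsub>B\<^esub> y') \<ominus>\<^bsub>F\<^esub> (s (x, y) \<oplus>\<^bsub>F\<^esub> s (x, y')) | x y y'.
        x \<in> carrier A \<and> y \<in> carrier B \<and> y' \<in> carrier B} \<union>
     {s (r \<odot>\<^bsub>A\<^esub> x, y) \<ominus>\<^bsub>F\<^esub> r \<odot>\<^bsub>F\<^esub> s (x, y) | r x y.
        r \<in> carrier R \<and> x \<in> carrier A \<and> y \<in> carrier B} \<union>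
     {s (x, r \<odot>\<^bsub>B\<^esub> y) \<ominus>\<^bsub>F\<^esub> r \<odot>\<^bsub>F\<^esub> s (x, y) | r x y.
        r \<in> carrier R \<and> x \<in> carrier A \<and> y \<in> carrier B})"

definition tensor ::
    "('r, 'k) ring_scheme \<Rightarrow> ('r, 'a, 'l) module_scheme \<Rightarrow> ('r, 'b, 'l') module_scheme
      \<Rightarrow> ('r, ('a \<times> 'b \<Rightarrow> 'r) set) module" where
  "tensor R A B = presented_module R (carrier A \<times> carrier B) (tensor_rels R A B)"

definition tens ::
    "('r, 'k) ring_scheme \<Rightarrow> ('r, 'a, 'l) module_scheme \<Rightarrow> ('r, 'b, 'l') module_scheme
      \<Rightarrow> 'a \<Rightarrow> 'b \<Rightarrow> ('a \<times> 'b \<Rightarrow> 'r) set" where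
  "tens R A B x y = generator R (carrier A \<times> carrier B) (tensor_rels R A B) (x, y)"

definition tensor_map ::
    "('r, 'k) ring_scheme \<Rightarrow> ('r, 'c, 'l) module_scheme \<Rightarrow> ('r, 'd, 'l') module_scheme
      \<Rightarrow> ('a \<Rightarrow> 'c) \<Rightarrow> ('b \<Rightarrow> 'd) \<Rightarrow> ('a \<times> 'b \<Rightarrow> 'r) set \<Rightarrow> ('c \<times> 'd \<Rightarrow> 'r) set" where
  "tensor_map R C D f g = lin_ext R (tensor R C D) (\<lambda>(x, y). tens R C D (f x) (g y))"

definition tensor_swap ::
    "('r, 'k) ring_scheme \<Rightarrow> ('r, 'a, 'l) module_scheme \<Rightarrow> ('a \<times> 'a \<Rightarrow> 'r) set \<Rightarrow> ('a \<times> 'a \<Rightarrow> 'r) set" where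
  "tensor_swap R V = lin_ext R (tensor R V V) (\<lambda>(x, y). tens R V V y x)"

text \<open>The isomorphism from \<open>(V \<otimes> V) \<otimes> V\<close> to \<open>V \<otimes> (V \<otimes> V)\<close>.\<close>

definition tensor_assoc ::
    "('r, 'k) ring_scheme \<Rightarrow> ('r, 'a, 'l) module_scheme
      \<Rightarrow> (('a \<times> 'a \<Rightarrow> 'r) set \<times> 'a \<Rightarrow> 'r) set \<Rightarrow> ('a \<times> ('a \<times> 'a \<Rightarrow> 'r) set \<Rightarrow> 'r) set" where
  "tensor_assoc R V = lin_ext R (tensor R V (tensor R V V))
     (\<lambda>(t, z). lin_ext R (tensor R V (tensor R V V))
        (\<lambda>(x, y). tens R V (tensor R V V) x (tens R V V y z)) t)"

text \<open>The unordered tensor power of an algebra over an index set: the quotient of the monoid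
  algebra of the multiplicative monoid of families by the multilinearity relations.\<close>

definition families :: "('r, 'v, 'l) module_scheme \<Rightarrow> 'i set \<Rightarrow> ('i \<Rightarrow> 'v) set" where
  "families V I = (I \<rightarrow>\<^sub>E carrier V)"

definition family_algebra ::
    "('r, 'k) ring_scheme \<Rightarrow> ('r, 'v, 'l) module_scheme \<Rightarrow> 'i set \<Rightarrow> ('r, ('i \<Rightarrow> 'v) \<Rightarrow> 'r) module" where
  "family_algebra R V I = (free_module R (families V I))
     \<lparr>mult := (\<lambda>p q h. \<Oplus>\<^bsub>R\<^esub>u\<in>{(f, g). p f \<noteq> \<zero>\<^bsub>R\<^esub> \<and> q g \<noteq> \<zero>\<^bsub>R\<^esub> \<and> (\<lambda>i\<in>I. f i \<otimes>\<^bsub>V\<^esub> g i) = h}.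
                p (fst u) \<otimes>\<^bsub>R\<^esub> q (snd u)),
      one := single R (\<lambda>i\<in>I. \<one>\<^bsub>V\<^esub>)\<rparr>"

definition multilinear_rels ::
    "('r, 'k) ring_scheme \<Rightarrow> ('r, 'v, 'l) module_scheme \<Rightarrow> 'i set \<Rightarrow> (('i \<Rightarrow> 'v) \<Rightarrow> 'r) set" where
  "multilinear_rels R V I = (let F = free_module R (families V I); s = single R in
     {s (f(i := x \<oplus>\<^bsub>V\<^esub> y)) \<ominus>\<^bsub>F\<^esub> (s (f(i := x)) \<oplus>\<^bsub>F\<^esub> s (f(i := y))) | f i x y.
        f \<in> families V I \<and> i \<in> I \<and> x \<in> carrier V \<and> y \<in> carrier V} \<union>
     {s (f(i := r \<odot>\<^bsub>V\<^esub> x)) \<ominus>\<^bsub>F\<^esub> r \<odot>\<^bsub>F\<^esub> s (f(i := x)) | f i r x.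
        f \<in> families V I \<and> i \<in> I \<and> r \<in> carrier R \<and> x \<in> carrier V})"

definition tensor_power ::
    "('r, 'k) ring_scheme \<Rightarrow> ('r, 'v, 'l) module_scheme \<Rightarrow> 'i set \<Rightarrow> ('r, (('i \<Rightarrow> 'v) \<Rightarrow> 'r) set) module" where
  "tensor_power R V I = quotient_module (family_algebra R V I)
     (submodule_span R (family_algebra R V I) (multilinear_rels R V I))"

definition pure_tensor ::
    "('r, 'k) ring_scheme \<Rightarrow> ('r, 'v, 'l) module_scheme \<Rightarrow> 'i set \<Rightarrow> ('i \<Rightarrow> 'v) \<Rightarrow> (('i \<Rightarrow> 'v) \<Rightarrow> 'r) set" where
  "pure_tensor R V I v = generator R (families V I) (multilinear_rels R V I) v"


section \<open>Frobenius algebras\<close>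

locale frobenius_algebra = algebra R V
  for R :: "('r, 'k) ring_scheme" (structure) and V :: "('r, 'v, 'l) module_scheme" (structure) +
  fixes \<Delta> :: "'v \<Rightarrow> ('v \<times> 'v \<Rightarrow> 'r) set" and \<epsilon> :: "'v \<Rightarrow> 'r"
  assumes comult_closed: "x \<in> carrier V \<Longrightarrow> \<Delta> x \<in> carrier (tensor R V V)"
    and comult_add: "\<lbrakk>x \<in> carrier V; y \<in> carrier V\<rbrakk> \<Longrightarrow> \<Delta> (x \<oplus>\<^bsub>V\<^esub> y) = \<Delta> x \<oplus>\<^bsub>tensor R V V\<^esub> \<Delta> y"
    and comult_smult: "\<lbrakk>r \<in> carrier R; x \<in> carrier V\<rbrakk> \<Longrightarrow> \<Delta> (r \<odot>\<^bsub>V\<^esub> x) = r \<odot>\<^bsub>tensor R V V\<^esub> \<Delta> x"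
    and coassociative: "x \<in> carrier V \<Longrightarrow>
      tensor_assoc R V (tensor_map R (tensor R V V) V \<Delta> (\<lambda>y. y) (\<Delta> x))
        = tensor_map R V (tensor R V V) (\<lambda>y. y) \<Delta> (\<Delta> x)"
    and cocommutative: "x \<in> carrier V \<Longrightarrow> tensor_swap R V (\<Delta> x) = \<Delta> x"
    and comult_left: "\<lbrakk>x \<in> carrier V; y \<in> carrier V\<rbrakk> \<Longrightarrow>
      \<Delta> (x \<otimes>\<^bsub>V\<^esub> y) = tensor_map R V V (\<lambda>a. x \<otimes>\<^bsub>V\<^esub> a) (\<lambda>b. b) (\<Delta> y)"
    and comult_right: "\<lbrakk>x \<in> carrier V; y \<in> carrier V\<rbrakk> \<Longrightarrow>
      \<Delta> (x \<otimes>\<^bsub>V\<^esub> y) = tensor_map R V V (\<lambda>a. a) (\<lambda>b. b \<otimes>\<^bsub>V\<^esub> y) (\<Delta> x)"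
    and counit_closed: "x \<in> carrier V \<Longrightarrow> \<epsilon> x \<in> carrier R"
    and counit_add: "\<lbrakk>x \<in> carrier V; y \<in> carrier V\<rbrakk> \<Longrightarrow> \<epsilon> (x \<oplus>\<^bsub>V\<^esub> y) = \<epsilon> x \<oplus>\<^bsub>R\<^esub> \<epsilon> y"
    and counit_smult: "\<lbrakk>r \<in> carrier R; x \<in> carrier V\<rbrakk> \<Longrightarrow> \<epsilon> (r \<odot>\<^bsub>V\<^esub> x) = r \<otimes>\<^bsub>R\<^esub> \<epsilon> x"
    and counit: "x \<in> carrier V \<Longrightarrow> lin_ext R V (\<lambda>(a, b). \<epsilon> a \<odot>\<^bsub>V\<^esub> b) (\<Delta> x) = x"

definition handle ::
    "('r, 'k) ring_scheme \<Rightarrow> ('r, 'v, 'l) module_scheme \<Rightarrow> ('v \<Rightarrow> ('v \<times> 'v \<Rightarrow> 'r) set) \<Rightarrow> 'v \<Rightarrow> 'v" where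
  "handle R V \<Delta> x = lin_ext R V (\<lambda>(a, b). a \<otimes>\<^bsub>V\<^esub> b) (\<Delta> \<one>\<^bsub>V\<^esub>) \<otimes>\<^bsub>V\<^esub> x"


section \<open>The Bar-Natan module\<close>

type_synonym ('m, 'v) csurface = "'m set \<times> ('m set \<Rightarrow> 'v)"

definition colored_surfaces ::
    "'m topology \<Rightarrow> ('m, real^3) coord set \<Rightarrow> 'm set \<Rightarrow> ('r, 'v, 'l) module_scheme
      \<Rightarrow> ('m, 'v) csurface set" where
  "colored_surfaces M A \<alpha> V =
     {(S, c). surface_bounding M A \<alpha> S \<and> c \<in> (components_of M S \<rightarrow>\<^sub>E carrier V)}"

text \<open>\<open>H (t, _)\<close> is the embedding at time \<open>t\<close> of a smooth isotopy, fixing \<open>\<alpha>\<close> pointwise, from the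
  inclusion of \<open>S\<close> to an embedding with image \<open>S'\<close>.\<close>

definition isotopy_rel ::
    "'m topology \<Rightarrow> ('m, real^3) coord set \<Rightarrow> 'm set \<Rightarrow> 'm set \<Rightarrow> 'm set \<Rightarrow> (real \<times> 'm \<Rightarrow> 'm) \<Rightarrow> bool" where
  "isotopy_rel M A \<alpha> S S' H \<longleftrightarrow>
     smooth_map_on (prod_atlas euclid A) A ({0..1} \<times> S) H \<and>
     (\<forall>p\<in>S. H (0, p) = p) \<and> (\<lambda>p. H (1, p)) ` S = S' \<and>
     (\<forall>t\<in>{0..1}. (\<forall>p\<in>\<alpha>. H (t, p) = p) \<and> smooth_embedding A A S (\<lambda>p. H (t, p)) \<and>
        surface_bounding M A \<alpha> ((\<lambda>p. H (t, p)) ` S))"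

definition isotopic ::
    "'m topology \<Rightarrow> ('m, real^3) coord set \<Rightarrow> 'm set \<Rightarrow> ('r, 'v, 'l) module_scheme
      \<Rightarrow> (('m, 'v) csurface \<times> ('m, 'v) csurface) set" where
  "isotopic M A \<alpha> V = {((S, c), (S', c')).
     (S, c) \<in> colored_surfaces M A \<alpha> V \<and> (S', c') \<in> colored_surfaces M A \<alpha> V \<and>
     (\<exists>H. isotopy_rel M A \<alpha> S S' H \<and>
          (\<forall>C\<in>components_of M S. c' ((\<lambda>p. H (1, p)) ` C) = c C))}"

definition isotopy_classes ::
    "'m topology \<Rightarrow> ('m, real^3) coord set \<Rightarrow> 'm set \<Rightarrow> ('r, 'v, 'l) module_scheme
      \<Rightarrow> ('m, 'v) csurface set set" where
  "isotopy_classes M A \<alpha> V = colored_surfaces M A \<alpha> V // isotopic M A \<alpha> V"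

text \<open>The component \<open>C\<close> of \<open>S\<close> is a sphere bounding a ball whose interior misses \<open>S\<close>. Being a
  boundaryless component of a properly embedded surface, the sphere, and hence the ball,
  avoids the boundary of \<open>M\<close>; this is recorded explicitly.\<close>

definition bounds_ball ::
    "('m, real^3) coord set \<Rightarrow> 'm set \<Rightarrow> 'm set \<Rightarrow> bool" where
  "bounds_ball A S C \<longleftrightarrow> (\<exists>\<beta> :: real^3 \<Rightarrow> 'm.
     smooth_embedding euclid A (cball 0 1) \<beta> \<and> \<beta> ` cball 0 1 \<inter> manifold_boundary A = {} \<and>
     \<beta> ` sphere 0 1 = C \<and> \<beta> ` ball 0 1 \<inter> S = {})"

text \<open>Profile of a pair of smooth caps: inside the cylinder \<open>D\<^sup>2 \<times> [-1, 1]\<close>, the equation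
  \<open>\<bar>x\<bar>\<^sup>2 = \<rho> t\<close> cuts out two disjoint disks, coinciding with the lateral surface near
  the two ends and meeting the axis transversely at the heights \<open>\<plusminus>1/2\<close>. This is the pair of parallel
  disks with their corners smoothed.\<close>

definition cap_profile :: "(real \<Rightarrow> real) \<Rightarrow> bool" where
  "cap_profile \<rho> \<longleftrightarrow> smooth_on \<rho> UNIV \<and> (\<forall>t. \<rho> (- t) = \<rho> t) \<and>
     (\<forall>t. \<bar>t\<bar> < 1/2 \<longrightarrow> \<rho> t < 0) \<and> \<rho> (1/2) = 0 \<and> 0 < deriv \<rho> (1/2) \<and>
     (\<forall>t. 1/2 < \<bar>t\<bar> \<longrightarrow> 0 < \<rho> t \<and> \<rho> t \<le> 1) \<and> (\<forall>t. 3/4 \<le> \<bar>t\<bar> \<longrightarrow> \<rho> t = 1)"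

definition cylinder :: "((real^2) \<times> real) set" where
  "cylinder = cball 0 1 \<times> {-1..1}"

definition lateral :: "((real^2) \<times> real) set" where
  "lateral = sphere 0 1 \<times> {-1..1}"

definition caps :: "(real \<Rightarrow> real) \<Rightarrow> ((real^2) \<times> real) set" where
  "caps \<rho> = {(x, t) \<in> cylinder. (norm x)\<^sup>2 = \<rho> t}"

text \<open>\<open>S'\<close> arises from \<open>S\<close> by cutting the neck \<open>\<phi> ` lateral\<close> along the disk
  \<open>\<phi> ` (D\<^sup>2 \<times> {0})\<close>, of which \<open>\<phi>\<close> parametrizes a tubular neighbourhood; \<open>C\<close> is the component of \<open>S\<close>
  containing the neck.\<close>

definition neck_cut ::
    "'m topology \<Rightarrow> ('m, real^3) coord set \<Rightarrow> 'm set \<Rightarrow> 'm set \<Rightarrow> 'm set \<Rightarrow> bool" where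
  "neck_cut M A S C S' \<longleftrightarrow> (\<exists>(\<phi> :: (real^2) \<times> real \<Rightarrow> 'm) \<rho>.
     smooth_embedding euclid A cylinder \<phi> \<and> \<phi> ` cylinder \<inter> manifold_boundary A = {} \<and>
     S \<inter> \<phi> ` cylinder = \<phi> ` lateral \<and> cap_profile \<rho> \<and>
     C \<in> components_of M S \<and> \<phi> ` lateral \<subseteq> C \<and>
     S' = (S - \<phi> ` cylinder) \<union> \<phi> ` caps \<rho>)"

text \<open>Relators of the Bar-Natan module: multilinearity, sphere relation, separating and
  nonseparating neck-cutting. A representative \<open>p\<close> of \<open>\<Delta> x\<close> is a presentation of \<open>\<Delta> x\<close> as a sum
  of pure tensors with coefficients, that is, a choice of Sweedler terms. The conditions that
  \<open>S - C\<close> and \<open>S'\<close> are again surfaces bounding \<open>\<alpha>\<close> exclude nothing; they only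
  make explicit that the relators lie in the free module. Likewise, in the neck-cutting
  relators, the components of \<open>S'\<close> that are not components of \<open>S\<close> are exactly those of what becomes
  of \<open>C\<close>, and one of the two cases always occurs.\<close>

definition bar_natan_rels ::
    "'m topology \<Rightarrow> ('m, real^3) coord set \<Rightarrow> 'm set \<Rightarrow> ('r, 'k) ring_scheme \<Rightarrow> ('r, 'v, 'l) module_scheme
      \<Rightarrow> ('v \<Rightarrow> ('v \<times> 'v \<Rightarrow> 'r) set) \<Rightarrow> ('v \<Rightarrow> 'r) \<Rightarrow> (('m, 'v) csurface set \<Rightarrow> 'r) set" where
  "bar_natan_rels M A \<alpha> R V \<Delta> \<epsilon> = (
     let F = free_module R (isotopy_classes M A \<alpha> V);
         s = (\<lambda>x. single R (isotopic M A \<alpha> V `` {x}));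
         K = colored_surfaces M A \<alpha> V;
         comps = components_of M
     in
     {s (S, c(C := x \<oplus>\<^bsub>V\<^esub> y)) \<ominus>\<^bsub>F\<^esub> (s (S, c(C := x)) \<oplus>\<^bsub>F\<^esub> s (S, c(C := y))) | S c C x y.
        (S, c) \<in> K \<and> C \<in> comps S \<and> x \<in> carrier V \<and> y \<in> carrier V} \<union>
     {s (S, c(C := r \<odot>\<^bsub>V\<^esub> x)) \<ominus>\<^bsub>F\<^esub> r \<odot>\<^bsub>F\<^esub> s (S, c(C := x)) | S c C r x.
        (S, c) \<in> K \<and> C \<in> comps S \<and> r \<in> carrier R \<and> x \<in> carrier V} \<union>
     {s (S, c) \<ominus>\<^bsub>F\<^esub> \<epsilon> (c C) \<odot>\<^bsub>F\<^esub> s (S - C, restrict c (comps S - {C})) | S c C.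
        (S, c) \<in> K \<and> C \<in> comps S \<and> bounds_ball A S C \<and> surface_bounding M A \<alpha> (S - C)} \<union>
     {s (S, c) \<ominus>\<^bsub>F\<^esub> lin_comb R F
          (\<lambda>(a, b). s (S', restrict (c(C1 := a, C2 := b)) (comps S'))) p | S c C S' C1 C2 p.
        (S, c) \<in> K \<and> neck_cut M A S C S' \<and> surface_bounding M A \<alpha> S' \<and>
        C1 \<noteq> C2 \<and> C1 \<notin> comps S \<and> C2 \<notin> comps S \<and>
        comps S' = (comps S - {C}) \<union> {C1, C2} \<and> p \<in> \<Delta> (c C)} \<union>
     {s (S, c) \<ominus>\<^bsub>F\<^esub> s (S', restrict (c(C' := handle R V \<Delta> (c C))) (comps S')) | S c C S' C'.
        (S, c) \<in> K \<and> neck_cut M A S C S' \<and> surface_bounding M A \<alpha> S' \<and>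
        C' \<notin> comps S \<and> comps S' = (comps S - {C}) \<union> {C'}})"

definition bar_natan_module ::
    "'m topology \<Rightarrow> ('m, real^3) coord set \<Rightarrow> 'm set \<Rightarrow> ('r, 'k) ring_scheme \<Rightarrow> ('r, 'v, 'l) module_scheme
      \<Rightarrow> ('v \<Rightarrow> ('v \<times> 'v \<Rightarrow> 'r) set) \<Rightarrow> ('v \<Rightarrow> 'r) \<Rightarrow> ('r, (('m, 'v) csurface set \<Rightarrow> 'r) set) module" where
  "bar_natan_module M A \<alpha> R V \<Delta> \<epsilon> =
     presented_module R (isotopy_classes M A \<alpha> V) (bar_natan_rels M A \<alpha> R V \<Delta> \<epsilon>)"

definition bar_natan_class ::
    "'m topology \<Rightarrow> ('m, real^3) coord set \<Rightarrow> 'm set \<Rightarrow> ('r, 'k) ring_scheme \<Rightarrow> ('r, 'v, 'l) module_scheme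
      \<Rightarrow> ('v \<Rightarrow> ('v \<times> 'v \<Rightarrow> 'r) set) \<Rightarrow> ('v \<Rightarrow> 'r) \<Rightarrow> ('m, 'v) csurface \<Rightarrow> (('m, 'v) csurface set \<Rightarrow> 'r) set" where
  "bar_natan_class M A \<alpha> R V \<Delta> \<epsilon> x =
     generator R (isotopy_classes M A \<alpha> V) (bar_natan_rels M A \<alpha> R V \<Delta> \<epsilon>) (isotopic M A \<alpha> V `` {x})"

text \<open>The circles contained in a component of a surface bounding \<open>\<alpha>\<close> are its boundary circles.\<close>

definition multiply_colors ::
    "'m topology \<Rightarrow> 'm set \<Rightarrow> ('r, 'v, 'l) module_scheme \<Rightarrow> ('m set \<Rightarrow> 'v) \<Rightarrow> 'm set \<Rightarrow> ('m set \<Rightarrow> 'v)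
      \<Rightarrow> ('m set \<Rightarrow> 'v)" where
  "multiply_colors M \<alpha> V v S c = (\<lambda>C\<in>components_of M S.
     (\<Otimes>\<^bsub>V\<^esub>a\<in>{a \<in> components_of M \<alpha>. a \<subseteq> C}. v a) \<otimes>\<^bsub>V\<^esub> c C)"

definition with_action :: "('a, 'l) ring_scheme \<Rightarrow> ('s \<Rightarrow> 'a \<Rightarrow> 'a) \<Rightarrow> ('s, 'a) module" where
  "with_action W act = ring.extend (ring.truncate W) \<lparr>smult = act\<rparr>"

end

theory Submission
  imports Defs
begin

text \<open>
  A family \<open>v\<close> of algebra elements indexed by the boundary circles acts on colored surfaces by
  multiplying the color of each component \<open>C\<close> with the product \<open>v\<^sub>C\<close> of the \<open>v a\<close> over the circles
  \<open>a \<subseteq> C\<close>. An isotopy rel boundary preserves the circles of a component, so this descends to isotopy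
  classes, and it maps relators to relators: multilinearity is clear, a sphere bounding a ball has
  \<open>v\<^sub>C = 1\<close>, and when \<open>C\<close> is cut along a neck, its circles are distributed over the new components.
  In the separating case \<open>v\<^sub>C = v\<^bsub>C1\<^esub> v\<^bsub>C2\<^esub>\<close>, and \<open>\<Delta>\<close> being a bimodule map yields
  \<open>\<Delta> (v\<^sub>C x) = (v\<^bsub>C1\<^esub> \<otimes> v\<^bsub>C2\<^esub>) \<Delta> x\<close>; in the nonseparating case the handle operator is linear over the algebra.
  Since every circle lies on exactly one component, the operators obtained are multilinear in \<open>v\<close>
  (the products being finite, as \<open>\<alpha>\<close> has finitely many components) and multiplicative, and hence define
  an action of the tensor power. Uniqueness holds because pure tensors and surfaces generate.
\<close>

section \<open>Linear maps and free modules\<close>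

text \<open>The action is built by extending linearly twice: first over surfaces with the family
  \<open>v\<close> fixed, which needs relators to go to zero, then over families with the module
  element fixed, which needs multilinearity in \<open>v\<close>. Every law of the action is an
  identity between maps that are linear in one argument, so it is tested on generators one argument
  at a time. This algebra is carried out for an abstract operation of families on the generators of
  a presented module; the geometry enters through its hypotheses. The neck-cutting relators record
  how the set of components changes, so what is left to do there is to follow the circles.
  Finiteness of the set of circles is a genuine obligation, because \<open>finprod\<close> over an
  infinite index set is the unit by convention and would not be multilinear. For uniqueness, a
  competing action is only given as a module structure over the tensor power; compatibility with the
  elements \<open>r \<odot> \<one>\<close> is what makes it linear over \<open>R\<close>, so that
  agreement on generators spreads to everything.\<close>

definition linear_maps ::
    "('r, 'k) ring_scheme \<Rightarrow> ('r, 'm, 'l) module_scheme \<Rightarrow> ('r, 'n, 'l') module_scheme \<Rightarrow> ('m \<Rightarrow> 'n) set" where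
  "linear_maps R M N = {f \<in> carrier M \<rightarrow> carrier N.
     (\<forall>x\<in>carrier M. \<forall>y\<in>carrier M. f (x \<oplus>\<^bsub>M\<^esub> y) = f x \<oplus>\<^bsub>N\<^esub> f y) \<and>
     (\<forall>r\<in>carrier R. \<forall>x\<in>carrier M. f (r \<odot>\<^bsub>M\<^esub> x) = r \<odot>\<^bsub>N\<^esub> f x)}"

lemma linear_mapsI:
  assumes "\<And>x. x \<in> carrier M \<Longrightarrow> f x \<in> carrier N"
    and "\<And>x y. \<lbrakk>x \<in> carrier M; y \<in> carrier M\<rbrakk> \<Longrightarrow> f (x \<oplus>\<^bsub>M\<^esub> y) = f x \<oplus>\<^bsub>N\<^esub> f y"
    and "\<And>r x. \<lbrakk>r \<in> carrier R; x \<in> carrier M\<rbrakk> \<Longrightarrow> f (r \<odot>\<^bsub>M\<^esub> x) = r \<odot>\<^bsub>N\<^esub> f x"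
  shows "f \<in> linear_maps R M N"
  using assms by (auto simp: linear_maps_def)

lemma linear_mapsD:
  assumes "f \<in> linear_maps R M N"
  shows "x \<in> carrier M \<Longrightarrow> f x \<in> carrier N"
    and "\<lbrakk>x \<in> carrier M; y \<in> carrier M\<rbrakk> \<Longrightarrow> f (x \<oplus>\<^bsub>M\<^esub> y) = f x \<oplus>\<^bsub>N\<^esub> f y"
    and "\<lbrakk>r \<in> carrier R; x \<in> carrier M\<rbrakk> \<Longrightarrow> f (r \<odot>\<^bsub>M\<^esub> x) = r \<odot>\<^bsub>N\<^esub> f x"
  using assms by (auto simp: linear_maps_def)

lemma linear_maps_comp:
  assumes "f \<in> linear_maps R M N" and "g \<in> linear_maps R N P"
  shows "(\<lambda>x. g (f x)) \<in> linear_maps R M P"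
  using assms by (auto simp: linear_maps_def Pi_iff)

lemma (in abelian_group) minus_eq_zero_iff:
  assumes "x \<in> carrier G" and "y \<in> carrier G"
  shows "x \<ominus> y = \<zero> \<longleftrightarrow> x = y"
  using add.inv_solve_right[of \<zero> x y] assms by (auto simp: a_minus_def)

lemma (in abelian_group) minus_zero_right: "x \<in> carrier G \<Longrightarrow> x \<ominus> \<zero> = x"
  by (simp add: a_minus_def add.inv_one)

text \<open>Homogeneity is enough: zero is the multiple of itself by the scalar zero.\<close>

lemma linear_maps_zero:
  assumes "module R M" and "module R N" and f: "f \<in> linear_maps R M N"
  shows "f \<zero>\<^bsub>M\<^esub> = \<zero>\<^bsub>N\<^esub>"
proof -
  interpret M: module R M by fact
  interpret N: module R N by fact
  have "f (\<zero>\<^bsub>R\<^esub> \<odot>\<^bsub>M\<^esub> \<zero>\<^bsub>M\<^esub>) = \<zero>\<^bsub>R\<^esub> \<odot>\<^bsub>N\<^esub> f \<zero>\<^bsub>M\<^esub>"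
    using linear_mapsD(3)[OF f] by blast
  then show ?thesis
    using linear_mapsD(1)[OF f] by simp
qed

lemma linear_maps_minus:
  assumes "module R M" and "module R N" and f: "f \<in> linear_maps R M N"
    and x: "x \<in> carrier M" and y: "y \<in> carrier M"
  shows "f (x \<ominus>\<^bsub>M\<^esub> y) = f x \<ominus>\<^bsub>N\<^esub> f y"
proof -
  interpret M: module R M by fact
  interpret N: module R N by fact
  \<comment> \<open>Negation is scaling by minus one, so it is respected by any map that respects
    scalars.\<close>
  have "\<ominus>\<^bsub>M\<^esub> y = (\<ominus>\<^bsub>R\<^esub> \<one>\<^bsub>R\<^esub>) \<odot>\<^bsub>M\<^esub> y"
    using y by (simp add: M.smult_l_minus)
  then have "f (\<ominus>\<^bsub>M\<^esub> y) = \<ominus>\<^bsub>N\<^esub> f y"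
    using y linear_mapsD(1,3)[OF f] by (simp add: N.smult_l_minus)
  then show ?thesis
    using linear_mapsD(2)[OF f] x y by (simp add: a_minus_def)
qed

text \<open>A span is an intersection of submodules, so a linear map that vanishes on relators
  vanishes on their span as soon as its kernel is one of the submodules intersected.\<close>

lemma submodule_kernel:
  assumes "module R M" and "module R N" and f: "f \<in> linear_maps R M N"
  shows "submodule {x \<in> carrier M. f x = \<zero>\<^bsub>N\<^esub>} R M"
proof -
  interpret M: module R M by fact
  interpret N: module R N by fact
  have neg: "f (\<ominus>\<^bsub>M\<^esub> x) = \<ominus>\<^bsub>N\<^esub> f x" if "x \<in> carrier M" for x
    using linear_maps_minus[OF assms, of "\<zero>\<^bsub>M\<^esub>" x] that linear_maps_zero[OF assms]
      linear_mapsD(1)[OF f that]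
    by (simp add: a_minus_def)
  show ?thesis
    by (rule M.submoduleI)
      (auto simp: linear_maps_zero[OF assms] neg linear_mapsD[OF f])
qed

section \<open>Free modules: induction and linear extension\<close>

lemma free_module_simps:
  "carrier (free_module R B) =
    {p. (\<forall>b\<in>B. p b \<in> carrier R) \<and> (\<forall>b. b \<notin> B \<longrightarrow> p b = \<zero>\<^bsub>R\<^esub>) \<and> finite {b. p b \<noteq> \<zero>\<^bsub>R\<^esub>}}"
  "\<zero>\<^bsub>free_module R B\<^esub> = (\<lambda>b. \<zero>\<^bsub>R\<^esub>)"
  "p \<oplus>\<^bsub>free_module R B\<^esub> q = (\<lambda>b. p b \<oplus>\<^bsub>R\<^esub> q b)"
  "r \<odot>\<^bsub>free_module R B\<^esub> p = (\<lambda>b. r \<otimes>\<^bsub>R\<^esub> p b)"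
  by (simp_all add: free_module_def)

context cring
begin

lemma free_module_value:
  assumes "p \<in> carrier (free_module R B)"
  shows "p b \<in> carrier R"
  using assms by (cases "b \<in> B") (auto simp: free_module_simps)

lemma free_module_support:
  assumes "p \<in> carrier (free_module R B)"
  shows "finite {b. p b \<noteq> \<zero>}" and "{b. p b \<noteq> \<zero>} \<subseteq> B"
  using assms by (auto simp: free_module_simps)

lemma free_module_add_closed:
  assumes "p \<in> carrier (free_module R B)" and "q \<in> carrier (free_module R B)"
  shows "p \<oplus>\<^bsub>free_module R B\<^esub> q \<in> carrier (free_module R B)"
proof -
  have "finite {b. p b \<oplus> q b \<noteq> \<zero>}"
    by (rule finite_subset[of _ "{b. p b \<noteq> \<zero>} \<union> {b. q b \<noteq> \<zero>}"])
      (use assms in \<open>auto simp: free_module_simps\<close>)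
  then show ?thesis
    using assms by (auto simp: free_module_simps)
qed

lemma free_module_smult_closed:
  assumes "r \<in> carrier R" and "p \<in> carrier (free_module R B)"
  shows "r \<odot>\<^bsub>free_module R B\<^esub> p \<in> carrier (free_module R B)"
proof -
  have "finite {b. r \<otimes> p b \<noteq> \<zero>}"
    by (rule finite_subset[of _ "{b. p b \<noteq> \<zero>}"])
      (use assms in \<open>auto simp: free_module_simps\<close>)
  then show ?thesis
    using assms by (auto simp: free_module_simps)
qed

lemma module_free_module: "module R (free_module R B)"
proof (rule moduleI)
  let ?F = "free_module R B"
  show "abelian_group ?F"
  proof (rule abelian_groupI)
    fix p assume p: "p \<in> carrier ?F"
    show "\<exists>q\<in>carrier ?F. q \<oplus>\<^bsub>?F\<^esub> p = \<zero>\<^bsub>?F\<^esub>"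
    proof
      show "(\<ominus> \<one>) \<odot>\<^bsub>?F\<^esub> p \<in> carrier ?F"
        using p by (intro free_module_smult_closed) auto
      show "(\<ominus> \<one>) \<odot>\<^bsub>?F\<^esub> p \<oplus>\<^bsub>?F\<^esub> p = \<zero>\<^bsub>?F\<^esub>"
        using free_module_value[OF p] by (auto simp: free_module_simps l_minus l_neg)
    qed
  next
    show "\<zero>\<^bsub>?F\<^esub> \<in> carrier ?F"
      by (simp add: free_module_simps)
    show "p \<oplus>\<^bsub>?F\<^esub> q \<in> carrier ?F" if "p \<in> carrier ?F" "q \<in> carrier ?F" for p q
      using that by (rule free_module_add_closed)
  qed (auto simp: free_module_simps(2-) a_ac free_module_value)
qed (auto simp: free_module_smult_closed is_cring,
     auto simp: free_module_simps(2-) fun_eq_iff l_distr r_distr m_assoc free_module_value)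

lemma single_closed: "b \<in> B \<Longrightarrow> single R b \<in> carrier (free_module R B)"
  by (auto simp: single_def free_module_simps)

text \<open>One basis element at a time is split off a finite support. Sums and multiples are
  separate cases because these are the two operations that linear maps and submodules are known to
  respect.\<close>

lemma free_module_induct [consumes 1, case_names zero single add smult]:
  assumes p: "p \<in> carrier (free_module R B)"
    and zero: "P \<zero>\<^bsub>free_module R B\<^esub>"
    and single: "\<And>b. b \<in> B \<Longrightarrow> P (single R b)"
    and add: "\<And>p q. \<lbrakk>p \<in> carrier (free_module R B); q \<in> carrier (free_module R B); P p; P q\<rbrakk>
      \<Longrightarrow> P (p \<oplus>\<^bsub>free_module R B\<^esub> q)"
    and smult: "\<And>r p. \<lbrakk>r \<in> carrier R; p \<in> carrier (free_module R B); P p\<rbrakk>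
      \<Longrightarrow> P (r \<odot>\<^bsub>free_module R B\<^esub> p)"
  shows "P p"
proof -
  let ?F = "free_module R B"
  \<comment> \<open>The induction runs over a finite set that bounds the support, for all
    \<open>p\<close> at once, since removing a coefficient replaces \<open>p\<close> by another
    vector.\<close>
  have "\<forall>p\<in>carrier ?F. {b. p b \<noteq> \<zero>} \<subseteq> A \<longrightarrow> P p" if "finite A" for A
    using that
  proof (induction A)
    case empty
    have "p = \<zero>\<^bsub>?F\<^esub>" if "{b. p b \<noteq> \<zero>} \<subseteq> {}" for p
      using that by (auto simp: free_module_simps)
    then show ?case
      using zero by blast
  next
    case (insert b A)
    show ?case
    proof (intro ballI impI)
      fix p assume p: "p \<in> carrier ?F" and supp: "{b. p b \<noteq> \<zero>} \<subseteq> insert b A"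
      show "P p"
      proof (cases "p b = \<zero>")
        case True
        then show ?thesis
          using insert.IH p supp by (metis (mono_tags, lifting) mem_Collect_eq subset_insert)
      next
        case False
        then have b: "b \<in> B"
          using free_module_support(2)[OF p] by blast
        define q where "q = p(b := \<zero>)"
        have "finite {x. q x \<noteq> \<zero>}"
          by (rule finite_subset[OF _ free_module_support(1)[OF p]]) (auto simp: q_def)
        then have q: "q \<in> carrier ?F"
          using p by (auto simp: free_module_simps q_def)
        have pb: "p b \<in> carrier R"
          using p by (rule free_module_value)
        have "p = p b \<odot>\<^bsub>?F\<^esub> single R b \<oplus>\<^bsub>?F\<^esub> q"
          using pb free_module_value[OF p] by (auto simp: free_module_simps single_def q_def)
        moreover have "P (p b \<odot>\<^bsub>?F\<^esub> single R b)"
          by (intro smult single single_closed b pb)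
        moreover have "P q"
        proof -
          have "{x. q x \<noteq> \<zero>} \<subseteq> A"
            using supp by (auto simp: q_def)
          then show ?thesis
            using insert.IH q by blast
        qed
        ultimately show ?thesis
          using add free_module_smult_closed[OF pb single_closed[OF b]] q by metis
      qed
    qed
  qed
  then show ?thesis
    using free_module_support(1)[OF p] p by blast
qed

text \<open>Linear maps are constrained on the carrier alone, so they are compared pointwise there
  and not as functions.\<close>

lemma linear_maps_free_module_eqI:
  assumes N: "module R N"
    and f: "f \<in> linear_maps R (free_module R B) N" and g: "g \<in> linear_maps R (free_module R B) N"
    and eq: "\<And>b. b \<in> B \<Longrightarrow> f (single R b) = g (single R b)"
    and p: "p \<in> carrier (free_module R B)"
  shows "f p = g p"
  using p
  by (induction rule: free_module_induct)
    (simp_all add: eq linear_maps_zero[OF module_free_module N] linear_mapsD[OF f] linear_mapsD[OF g] f g)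

text \<open>\<open>lin_comb\<close> sums over the exact support, which changes under addition and
  scaling. A larger index set can be shared by several vectors, so that their combinations are added
  term by term.\<close>

lemma lin_comb_eq_finsum:
  assumes N: "module R N" and h: "h \<in> B \<rightarrow> carrier N" and p: "p \<in> carrier (free_module R B)"
    and A: "finite A" "{b. p b \<noteq> \<zero>} \<subseteq> A" "A \<subseteq> B"
  shows "lin_comb R N h p = (\<Oplus>\<^bsub>N\<^esub>b\<in>A. p b \<odot>\<^bsub>N\<^esub> h b)"
proof -
  interpret N: module R N by fact
  have hc: "h b \<in> carrier N" if "b \<in> A" for b
    using that h A(3) by auto
  show ?thesis
    unfolding lin_comb_def
    by (rule N.add.finprod_mono_neutral_cong_left) (use A hc free_module_value[OF p] in auto)
qed

lemma lin_comb_linear: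
  assumes N: "module R N" and h: "h \<in> B \<rightarrow> carrier N"
  shows "lin_comb R N h \<in> linear_maps R (free_module R B) N"
proof (rule linear_mapsI)
  interpret N: module R N by fact
  let ?F = "free_module R B"
  fix p assume p: "p \<in> carrier ?F"
  have hc: "h b \<in> carrier N" if "p b \<noteq> \<zero>" "p \<in> carrier ?F" for p b
    using that h free_module_support(2) by fastforce
  show "lin_comb R N h p \<in> carrier N"
    unfolding lin_comb_def using hc p free_module_value[OF p] by (intro N.finsum_closed) auto
  show "lin_comb R N h (p \<oplus>\<^bsub>?F\<^esub> q) = lin_comb R N h p \<oplus>\<^bsub>N\<^esub> lin_comb R N h q"
    if q: "q \<in> carrier ?F" for q
  proof -
    define A where "A = {b. p b \<noteq> \<zero>} \<union> {b. q b \<noteq> \<zero>}"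
    have A: "finite A" "A \<subseteq> B"
      using free_module_support[OF p] free_module_support[OF q] by (auto simp: A_def)
    have hA: "h b \<in> carrier N" if "b \<in> A" for b
      using that A(2) h by auto
    have "lin_comb R N h (p \<oplus>\<^bsub>?F\<^esub> q) = (\<Oplus>\<^bsub>N\<^esub>b\<in>A. (p b \<oplus> q b) \<odot>\<^bsub>N\<^esub> h b)"
      by (subst lin_comb_eq_finsum[OF N h free_module_add_closed[OF p q] A(1) _ A(2)])
        (auto simp: A_def free_module_simps)
    also have "\<dots> = (\<Oplus>\<^bsub>N\<^esub>b\<in>A. p b \<odot>\<^bsub>N\<^esub> h b \<oplus>\<^bsub>N\<^esub> q b \<odot>\<^bsub>N\<^esub> h b)"
      by (rule N.finsum_cong')
        (auto simp: N.smult_l_distr hA free_module_value[OF p] free_module_value[OF q])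
    also have "\<dots> = (\<Oplus>\<^bsub>N\<^esub>b\<in>A. p b \<odot>\<^bsub>N\<^esub> h b) \<oplus>\<^bsub>N\<^esub> (\<Oplus>\<^bsub>N\<^esub>b\<in>A. q b \<odot>\<^bsub>N\<^esub> h b)"
      by (rule N.finsum_addf) (auto simp: hA free_module_value[OF p] free_module_value[OF q])
    also have "\<dots> = lin_comb R N h p \<oplus>\<^bsub>N\<^esub> lin_comb R N h q"
      using A by (subst (1 2) lin_comb_eq_finsum[OF N h _ A(1) _ A(2)]) (auto simp: A_def p q)
    finally show ?thesis .
  qed
  show "lin_comb R N h (r \<odot>\<^bsub>?F\<^esub> p) = r \<odot>\<^bsub>N\<^esub> lin_comb R N h p" if r: "r \<in> carrier R" for r
  proof -
    let ?A = "{b. p b \<noteq> \<zero>}"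
    have "lin_comb R N h (r \<odot>\<^bsub>?F\<^esub> p) = (\<Oplus>\<^bsub>N\<^esub>b\<in>?A. (r \<otimes> p b) \<odot>\<^bsub>N\<^esub> h b)"
      using free_module_support[OF p] r
      by (subst lin_comb_eq_finsum[OF N h free_module_smult_closed[OF r p], of ?A])
        (auto simp: free_module_simps)
    also have "\<dots> = (\<Oplus>\<^bsub>N\<^esub>b\<in>?A. r \<odot>\<^bsub>N\<^esub> (p b \<odot>\<^bsub>N\<^esub> h b))"
      by (rule N.finsum_cong') (auto simp: r N.smult_assoc1 hc[OF _ p] free_module_value[OF p])
    also have "\<dots> = r \<odot>\<^bsub>N\<^esub> lin_comb R N h p"
      unfolding lin_comb_def
      by (rule N.finsum_smult_ldistr[symmetric])
        (use r hc[OF _ p] free_module_support(1)[OF p] in \<open>auto simp: free_module_value[OF p]\<close>)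
    finally show ?thesis .
  qed
qed

lemma lin_comb_single:
  assumes N: "module R N" and h: "h \<in> B \<rightarrow> carrier N" and b: "b \<in> B"
  shows "lin_comb R N h (single R b) = h b"
proof -
  interpret N: module R N by fact
  have hb: "h b \<in> carrier N"
    using h b by auto
  have "lin_comb R N h (single R b) = (\<Oplus>\<^bsub>N\<^esub>x\<in>{b}. single R b x \<odot>\<^bsub>N\<^esub> h x)"
    using b by (intro lin_comb_eq_finsum[OF N h single_closed[OF b]]) (auto simp: single_def)
  also have "\<dots> = h b"
    using hb by (simp add: single_def)
  finally show ?thesis .
qed

lemma linear_maps_lin_comb:
  assumes N: "module R N" and P: "module R P" and f: "f \<in> linear_maps R N P"
    and h: "h \<in> B \<rightarrow> carrier N" and p: "p \<in> carrier (free_module R B)"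
  shows "f (lin_comb R N h p) = lin_comb R P (\<lambda>b. f (h b)) p"
proof (rule linear_maps_free_module_eqI[OF P _ _ _ p])
  have fh: "(\<lambda>b. f (h b)) \<in> B \<rightarrow> carrier P"
    using h linear_mapsD(1)[OF f] by auto
  show "(\<lambda>p. f (lin_comb R N h p)) \<in> linear_maps R (free_module R B) P"
    by (rule linear_maps_comp[OF lin_comb_linear[OF N h] f])
  show "lin_comb R P (\<lambda>b. f (h b)) \<in> linear_maps R (free_module R B) P"
    by (rule lin_comb_linear[OF P fh])
  show "f (lin_comb R N h (single R b)) = lin_comb R P (\<lambda>b. f (h b)) (single R b)" if "b \<in> B" for b
    using that by (simp add: lin_comb_single[OF N h] lin_comb_single[OF P fh])
qed

lemma lin_comb_cong:
  assumes "module R N" and "\<And>b. b \<in> B \<Longrightarrow> h b = h' b" and "h \<in> B \<rightarrow> carrier N"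
    and p: "p \<in> carrier (free_module R B)"
  shows "lin_comb R N h p = lin_comb R N h' p"
proof -
  interpret N: module R N by fact
  show ?thesis
    unfolding lin_comb_def
    by (rule N.finsum_cong') (use assms free_module_support(2)[OF p] free_module_value[OF p] in \<open>auto simp: Pi_iff\<close>)
qed

end

section \<open>Quotients and presented modules\<close>

text \<open>The projection from the free module to the presented module, defined on every
  representative; \<open>generator\<close> is its value on a basis vector.\<close>

definition residue ::
    "('r, 'k) ring_scheme \<Rightarrow> 'b set \<Rightarrow> ('b \<Rightarrow> 'r) set \<Rightarrow> ('b \<Rightarrow> 'r) \<Rightarrow> ('b \<Rightarrow> 'r) set" where
  "residue R B rels p = submodule_span R (free_module R B) rels +>\<^bsub>free_module R B\<^esub> p"

lemma generator_eq_residue: "generator R B rels b = residue R B rels (single R b)"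
  by (simp add: generator_def residue_def)

lemma submodule_span_least:
  assumes "submodule N R F" and "G \<subseteq> N"
  shows "submodule_span R F G \<subseteq> N"
  using assms by (auto simp: submodule_span_def)

lemma submodule_span_superset: "G \<subseteq> submodule_span R F G"
  by (auto simp: submodule_span_def)

lemma quotient_module_simps:
  "carrier (quotient_module F N) = a_rcosets\<^bsub>F\<^esub> N"
  "mult (quotient_module F N) = rcoset_mult F N"
  "\<one>\<^bsub>quotient_module F N\<^esub> = N +>\<^bsub>F\<^esub> \<one>\<^bsub>F\<^esub>"
  "\<zero>\<^bsub>quotient_module F N\<^esub> = N"
  "K \<oplus>\<^bsub>quotient_module F N\<^esub> L = K <+>\<^bsub>F\<^esub> L"
  "r \<odot>\<^bsub>quotient_module F N\<^esub> K = (\<Union>k\<in>K. N +>\<^bsub>F\<^esub> (r \<odot>\<^bsub>F\<^esub> k))"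
  by (simp_all add: quotient_module_def FactRing_def ring.defs)

context module
begin

text \<open>Since \<open>G\<close> lies in the carrier, the carrier is one of the submodules being
  intersected, which keeps the span inside the module.\<close>

lemma submodule_submodule_span:
  assumes "G \<subseteq> carrier M"
  shows "submodule (submodule_span R M G) R M"
proof (rule submoduleI)
  let ?S = "submodule_span R M G"
  show "?S \<subseteq> carrier M"
    by (rule submodule_span_least[OF carrier_is_submodule assms])
  show "\<zero>\<^bsub>M\<^esub> \<in> ?S"
    by (auto simp: submodule_span_def submodule_def dest!: subgroup.one_closed)
  show "\<ominus>\<^bsub>M\<^esub> a \<in> ?S" if "a \<in> ?S" for a
    using that submoduleE(3) by (auto simp: submodule_span_def)
  show "a \<oplus>\<^bsub>M\<^esub> b \<in> ?S" if "a \<in> ?S" "b \<in> ?S" for a b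
    using that submoduleE(5) by (auto simp: submodule_span_def)
  show "r \<odot>\<^bsub>M\<^esub> b \<in> ?S" if "r \<in> carrier R" "b \<in> ?S" for r b
    using that submoduleE(4) by (auto simp: submodule_span_def)
qed

lemma abelian_subgroup_if_submodule:
  assumes "submodule N R M"
  shows "abelian_subgroup N M"
  using assms by (intro abelian_subgroupI3 additive_subgroupI M.abelian_group_axioms) (simp add: submodule_def)

lemma coset_eq_iff:
  assumes N: "submodule N R M" and x: "x \<in> carrier M" and y: "y \<in> carrier M"
  shows "N +>\<^bsub>M\<^esub> x = N +>\<^bsub>M\<^esub> y \<longleftrightarrow> x \<ominus>\<^bsub>M\<^esub> y \<in> N"
proof -
  interpret N: abelian_subgroup N M
    by (rule abelian_subgroup_if_submodule[OF N])
  have "x \<ominus>\<^bsub>M\<^esub> y \<in> N \<longleftrightarrow> x \<in> N +>\<^bsub>M\<^esub> y"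
    using N.a_rcos_module[OF y x] by (simp add: a_minus_def)
  also have "\<dots> \<longleftrightarrow> N +>\<^bsub>M\<^esub> x = N +>\<^bsub>M\<^esub> y"
    using N.a_rcos_self[OF x] a_repr_independence[OF _ y] N.a_subgroup by metis
  finally show ?thesis ..
qed

lemma coset_minus_mem:
  assumes N: "submodule N R M" and x: "x \<in> carrier M" and k: "k \<in> N +>\<^bsub>M\<^esub> x"
  shows "k \<in> carrier M" and "k \<ominus>\<^bsub>M\<^esub> x \<in> N"
proof -
  interpret N: abelian_subgroup N M
    by (rule abelian_subgroup_if_submodule[OF N])
  show kc: "k \<in> carrier M"
    by (rule N.a_elemrcos_carrier[OF x k])
  show "k \<ominus>\<^bsub>M\<^esub> x \<in> N"
    using N.a_rcos_module[OF x kc] k by (simp add: a_minus_def)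
qed

lemma quotient_module_carrier:
  "carrier (quotient_module M N) = (\<lambda>x. N +>\<^bsub>M\<^esub> x) ` carrier M"
  by (auto simp: quotient_module_simps A_RCOSETS_def' a_r_coset_def r_coset_def)

lemma quotient_module_add:
  assumes "submodule N R M" and "x \<in> carrier M" and "y \<in> carrier M"
  shows "(N +>\<^bsub>M\<^esub> x) \<oplus>\<^bsub>quotient_module M N\<^esub> (N +>\<^bsub>M\<^esub> y) = N +>\<^bsub>M\<^esub> (x \<oplus>\<^bsub>M\<^esub> y)"
  using abelian_subgroup.a_rcos_sum[OF abelian_subgroup_if_submodule[OF assms(1)]] assms
  by (simp add: quotient_module_simps)

text \<open>The scalar multiple of a coset is defined as a union of cosets over all representatives.
  Two representatives differ by an element of \<open>N\<close>, and so do their multiples, hence all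
  cosets in the union coincide.\<close>

lemma quotient_module_smult:
  assumes N: "submodule N R M" and r: "r \<in> carrier R" and x: "x \<in> carrier M"
  shows "r \<odot>\<^bsub>quotient_module M N\<^esub> (N +>\<^bsub>M\<^esub> x) = N +>\<^bsub>M\<^esub> (r \<odot>\<^bsub>M\<^esub> x)"
proof -
  interpret N: abelian_subgroup N M
    by (rule abelian_subgroup_if_submodule[OF N])
  have "N +>\<^bsub>M\<^esub> (r \<odot>\<^bsub>M\<^esub> k) = N +>\<^bsub>M\<^esub> (r \<odot>\<^bsub>M\<^esub> x)" if "k \<in> N +>\<^bsub>M\<^esub> x" for k
  proof -
    note k = coset_minus_mem[OF N x that]
    have "r \<odot>\<^bsub>M\<^esub> k \<ominus>\<^bsub>M\<^esub> r \<odot>\<^bsub>M\<^esub> x = r \<odot>\<^bsub>M\<^esub> (k \<ominus>\<^bsub>M\<^esub> x)"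
      using k(1) x r by (simp add: a_minus_def smult_r_distr smult_r_minus)
    also have "\<dots> \<in> N"
      by (rule submoduleE(4)[OF N r k(2)])
    finally show ?thesis
      using coset_eq_iff[OF N] r k(1) x by simp
  qed
  then show ?thesis
    using N.a_rcos_self[OF x] unfolding quotient_module_simps by blast
qed

lemma quotient_module_zero:
  assumes "submodule N R M"
  shows "\<zero>\<^bsub>quotient_module M N\<^esub> = N +>\<^bsub>M\<^esub> \<zero>\<^bsub>M\<^esub>"
  using submoduleE(1)[OF assms] by (simp add: quotient_module_simps a_coset_add_zero)

lemma module_quotient_module:
  assumes N: "submodule N R M"
  shows "module R (quotient_module M N)"
proof (rule moduleI)
  let ?Q = "quotient_module M N"
  note simps = quotient_module_carrier quotient_module_add[OF N] quotient_module_smult[OF N]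
    quotient_module_zero[OF N]
  show "cring R"
    by (rule R.is_cring)
  show "abelian_group ?Q"
  proof (rule abelian_groupI)
    fix K assume "K \<in> carrier ?Q"
    then obtain x where x: "x \<in> carrier M" "K = N +>\<^bsub>M\<^esub> x"
      by (auto simp: quotient_module_carrier)
    show "\<exists>L\<in>carrier ?Q. L \<oplus>\<^bsub>?Q\<^esub> K = \<zero>\<^bsub>?Q\<^esub>"
      using x by (intro bexI[of _ "N +>\<^bsub>M\<^esub> (\<ominus>\<^bsub>M\<^esub> x)"]) (auto simp: simps M.l_neg)
  qed (auto simp: simps M.a_ac)
qed (use N in \<open>auto simp: quotient_module_carrier quotient_module_add quotient_module_smult
    smult_l_distr smult_r_distr smult_assoc1\<close>)

lemma coset_linear:
  assumes "submodule N R M"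
  shows "(\<lambda>x. N +>\<^bsub>M\<^esub> x) \<in> linear_maps R M (quotient_module M N)"
  using assms
  by (intro linear_mapsI) (auto simp: quotient_module_carrier quotient_module_add quotient_module_smult)

end

section \<open>Presented modules and their universal property\<close>

context cring
begin

context
  fixes B :: "'g set" and rels :: "('g \<Rightarrow> 'a) set"
  assumes rels: "rels \<subseteq> carrier (free_module R B)"
begin

interpretation F: module R "free_module R B"
  by (rule module_free_module)

lemma submodule_span_rels: "submodule (submodule_span R (free_module R B) rels) R (free_module R B)"
  by (rule F.submodule_submodule_span[OF rels])

lemma module_presented_module: "module R (presented_module R B rels)"
  unfolding presented_module_def by (rule F.module_quotient_module[OF submodule_span_rels])

lemma residue_linear: "residue R B rels \<in> linear_maps R (free_module R B) (presented_module R B rels)"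
  unfolding presented_module_def residue_def[abs_def] by (rule F.coset_linear[OF submodule_span_rels])

lemma presented_module_carrier:
  "carrier (presented_module R B rels) = residue R B rels ` carrier (free_module R B)"
  unfolding presented_module_def residue_def[abs_def] by (rule F.quotient_module_carrier)

lemma residue_closed:
  "p \<in> carrier (free_module R B) \<Longrightarrow> residue R B rels p \<in> carrier (presented_module R B rels)"
  by (simp add: presented_module_carrier)

lemma generator_closed: "b \<in> B \<Longrightarrow> generator R B rels b \<in> carrier (presented_module R B rels)"
  by (simp add: generator_eq_residue residue_closed single_closed)

lemma residue_self: "p \<in> carrier (free_module R B) \<Longrightarrow> p \<in> residue R B rels p"
  unfolding residue_def
  by (rule abelian_subgroup.a_rcos_self[OF F.abelian_subgroup_if_submodule[OF submodule_span_rels]])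

lemma residue_eqI:
  assumes "p \<in> carrier (free_module R B)" and "q \<in> residue R B rels p"
  shows "q \<in> carrier (free_module R B)" and "residue R B rels q = residue R B rels p"
proof -
  show q: "q \<in> carrier (free_module R B)"
    using F.coset_minus_mem(1)[OF submodule_span_rels] assms by (simp add: residue_def)
  show "residue R B rels q = residue R B rels p"
    using F.coset_minus_mem(2)[OF submodule_span_rels assms(1)] assms q
      F.coset_eq_iff[OF submodule_span_rels q assms(1)] by (simp add: residue_def)
qed

lemma presented_module_element:
  assumes "K \<in> carrier (presented_module R B rels)" and "q \<in> K"
  shows "q \<in> carrier (free_module R B)" and "K = residue R B rels q"
proof -
  obtain p where p: "p \<in> carrier (free_module R B)" "K = residue R B rels p"
    using assms(1) by (auto simp: presented_module_carrier)
  show "q \<in> carrier (free_module R B)" and "K = residue R B rels q"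
    using residue_eqI[OF p(1)] assms(2) p(2) by simp_all
qed

lemma residue_rels:
  assumes "p \<in> rels"
  shows "residue R B rels p = \<zero>\<^bsub>presented_module R B rels\<^esub>"
proof -
  have p: "p \<in> carrier (free_module R B)"
    using assms rels by blast
  have "p \<ominus>\<^bsub>free_module R B\<^esub> \<zero>\<^bsub>free_module R B\<^esub> \<in> submodule_span R (free_module R B) rels"
    using assms p submodule_span_superset[of rels R "free_module R B"] by (auto simp: F.minus_zero_right)
  then show ?thesis
    using F.coset_eq_iff[OF submodule_span_rels p F.zero_closed] F.quotient_module_zero[OF submodule_span_rels]
    by (simp add: presented_module_def residue_def)
qed

lemma presented_module_induct [consumes 1, case_names generator add smult]:
  assumes w: "w \<in> carrier (presented_module R B rels)"
    and generator: "\<And>b. b \<in> B \<Longrightarrow> P (generator R B rels b)"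
    and add: "\<And>u v. \<lbrakk>u \<in> carrier (presented_module R B rels); v \<in> carrier (presented_module R B rels); P u; P v\<rbrakk>
      \<Longrightarrow> P (u \<oplus>\<^bsub>presented_module R B rels\<^esub> v)"
    and smult: "\<And>r u. \<lbrakk>r \<in> carrier R; u \<in> carrier (presented_module R B rels); P u\<rbrakk>
      \<Longrightarrow> P (r \<odot>\<^bsub>presented_module R B rels\<^esub> u)"
    and zero: "P \<zero>\<^bsub>presented_module R B rels\<^esub>"
  shows "P w"
proof -
  have "P (residue R B rels p)" if "p \<in> carrier (free_module R B)" for p
    using that
  proof (induction rule: free_module_induct)
    case zero
    then show ?case
      using linear_maps_zero[OF module_free_module module_presented_module residue_linear] assms(5) by simp
  qed (use assms in \<open>auto simp: generator_eq_residue[symmetric] linear_mapsD[OF residue_linear] residue_closed\<close>)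
  then show ?thesis
    using w by (auto simp: presented_module_carrier)
qed

lemma linear_maps_presented_module_eqI:
  assumes N: "module R N"
    and f: "f \<in> linear_maps R (presented_module R B rels) N"
    and g: "g \<in> linear_maps R (presented_module R B rels) N"
    and eq: "\<And>b. b \<in> B \<Longrightarrow> f (generator R B rels b) = g (generator R B rels b)"
    and w: "w \<in> carrier (presented_module R B rels)"
  shows "f w = g w"
  using w
  by (induction rule: presented_module_induct)
    (simp_all add: eq linear_maps_zero[OF module_presented_module N] linear_mapsD[OF f] linear_mapsD[OF g] f g)

context
  fixes N :: "('a, 'n, 'q) module_scheme" and h :: "'g \<Rightarrow> 'n"
  assumes N: "module R N" and h: "h \<in> B \<rightarrow> carrier N"
    and kills: "\<And>p. p \<in> rels \<Longrightarrow> lin_comb R N h p = \<zero>\<^bsub>N\<^esub>"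
begin

interpretation N: module R N by (rule N)

text \<open>The representative that \<open>lin_ext\<close> selects differs from \<open>p\<close> by
  an element of the span of the relators. The kernel of the combination is a submodule containing
  the relators, so this difference contributes nothing.\<close>

lemma lin_ext_residue:
  assumes p: "p \<in> carrier (free_module R B)"
  shows "lin_ext R N h (residue R B rels p) = lin_comb R N h p"
proof -
  let ?F = "free_module R B"
  note lin = lin_comb_linear[OF N h]
  define q where "q = (SOME q. q \<in> residue R B rels p)"
  have q: "q \<in> residue R B rels p"
    unfolding q_def by (rule someI[of "\<lambda>q. q \<in> residue R B rels p", OF residue_self[OF p]])
  have qc: "q \<in> carrier ?F"
    by (rule residue_eqI(1)[OF p q])
  have "q \<ominus>\<^bsub>?F\<^esub> p \<in> submodule_span R ?F rels"
    using F.coset_minus_mem(2)[OF submodule_span_rels p] q by (simp add: residue_def)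
  also have "submodule_span R ?F rels \<subseteq> {p \<in> carrier ?F. lin_comb R N h p = \<zero>\<^bsub>N\<^esub>}"
    using rels kills by (intro submodule_span_least submodule_kernel module_free_module N lin) auto
  finally have "lin_comb R N h q \<ominus>\<^bsub>N\<^esub> lin_comb R N h p = \<zero>\<^bsub>N\<^esub>"
    using linear_maps_minus[OF module_free_module N lin qc p] by simp
  then show ?thesis
    using linear_mapsD(1)[OF lin] qc p N.minus_eq_zero_iff by (simp add: lin_ext_def q_def[symmetric])
qed

lemma lin_ext_linear: "lin_ext R N h \<in> linear_maps R (presented_module R B rels) N"
proof (rule linear_mapsI)
  note lin = lin_comb_linear[OF N h]
  note res = linear_mapsD(2,3)[OF residue_linear, symmetric]
  fix K assume "K \<in> carrier (presented_module R B rels)"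
  then obtain p where p: "p \<in> carrier (free_module R B)" "K = residue R B rels p"
    by (auto simp: presented_module_carrier)
  show "lin_ext R N h K \<in> carrier N"
    using p linear_mapsD(1)[OF lin] by (simp add: lin_ext_residue)
  show "lin_ext R N h (r \<odot>\<^bsub>presented_module R B rels\<^esub> K) = r \<odot>\<^bsub>N\<^esub> lin_ext R N h K"
    if "r \<in> carrier R" for r
    using p that linear_mapsD(3)[OF lin] by (simp add: lin_ext_residue res free_module_add_closed free_module_smult_closed)
  fix L assume "L \<in> carrier (presented_module R B rels)"
  then obtain q where q: "q \<in> carrier (free_module R B)" "L = residue R B rels q"
    by (auto simp: presented_module_carrier)
  show "lin_ext R N h (K \<oplus>\<^bsub>presented_module R B rels\<^esub> L) = lin_ext R N h K \<oplus>\<^bsub>N\<^esub> lin_ext R N h L"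
    using p q linear_mapsD(2)[OF lin] by (simp add: lin_ext_residue res free_module_add_closed free_module_smult_closed)
qed

lemma lin_ext_generator: "b \<in> B \<Longrightarrow> lin_ext R N h (generator R B rels b) = h b"
  by (simp add: generator_eq_residue lin_ext_residue single_closed lin_comb_single[OF N h])

end

end

end

section \<open>The tensor power of an algebra\<close>

lemma family_algebra_simps:
  "carrier (family_algebra R V I) = carrier (free_module R (families V I))"
  "\<zero>\<^bsub>family_algebra R V I\<^esub> = \<zero>\<^bsub>free_module R (families V I)\<^esub>"
  "p \<oplus>\<^bsub>family_algebra R V I\<^esub> q = p \<oplus>\<^bsub>free_module R (families V I)\<^esub> q"
  "r \<odot>\<^bsub>family_algebra R V I\<^esub> p = r \<odot>\<^bsub>free_module R (families V I)\<^esub> p"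
  "\<one>\<^bsub>family_algebra R V I\<^esub> = single R (\<lambda>i\<in>I. \<one>\<^bsub>V\<^esub>)"
  by (simp_all add: family_algebra_def)

lemma family_algebra_mult:
  "(p \<otimes>\<^bsub>family_algebra R V I\<^esub> q) h =
    (\<Oplus>\<^bsub>R\<^esub>u\<in>{(f, g). p f \<noteq> \<zero>\<^bsub>R\<^esub> \<and> q g \<noteq> \<zero>\<^bsub>R\<^esub> \<and> (\<lambda>i\<in>I. f i \<otimes>\<^bsub>V\<^esub> g i) = h}.
      p (fst u) \<otimes>\<^bsub>R\<^esub> q (snd u))"
  by (simp add: family_algebra_def)

text \<open>The family algebra replaces only the product and the unit of a free module. This and the
  next lemmas carry submodules, spans and cosets from one record to the other.\<close>

lemma add_monoid_family_algebra:
  "add_monoid (family_algebra R V I) = add_monoid (free_module R (families V I))"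
  by (simp add: family_algebra_def)

lemma submodule_family_algebra_iff:
  "submodule N R (family_algebra R V I) \<longleftrightarrow> submodule N R (free_module R (families V I))"
  unfolding submodule_def submodule_axioms_def add_monoid_family_algebra family_algebra_simps by (rule refl)

lemma submodule_span_family_algebra:
  "submodule_span R (family_algebra R V I) G = submodule_span R (free_module R (families V I)) G"
  by (simp add: submodule_span_def submodule_family_algebra_iff)

lemma coset_family_algebra:
  "N +>\<^bsub>family_algebra R V I\<^esub> p = N +>\<^bsub>free_module R (families V I)\<^esub> p"
  by (simp add: a_r_coset_def add_monoid_family_algebra)

lemma families_upd:
  "\<lbrakk>f \<in> families V I; i \<in> I; x \<in> carrier V\<rbrakk> \<Longrightarrow> f(i := x) \<in> families V I"
  by (auto simp: families_def PiE_iff extensional_def)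

context algebra
begin

lemma mult_smult:
  "\<lbrakk>r \<in> carrier R; x \<in> carrier M; y \<in> carrier M\<rbrakk> \<Longrightarrow> x \<otimes>\<^bsub>M\<^esub> (r \<odot>\<^bsub>M\<^esub> y) = r \<odot>\<^bsub>M\<^esub> (x \<otimes>\<^bsub>M\<^esub> y)"
  using smult_assoc2[of r y x] by (simp add: m_comm)

lemma one_family: "(\<lambda>i\<in>I. \<one>\<^bsub>M\<^esub>) \<in> families M I"
  by (auto simp: families_def)

lemma mult_families:
  "\<lbrakk>f \<in> families M I; g \<in> families M I\<rbrakk> \<Longrightarrow> (\<lambda>i\<in>I. f i \<otimes>\<^bsub>M\<^esub> g i) \<in> families M I"
  by (auto simp: families_def)

lemma mult_families_comm:
  "\<lbrakk>f \<in> families M I; g \<in> families M I\<rbrakk>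
    \<Longrightarrow> (\<lambda>i\<in>I. f i \<otimes>\<^bsub>M\<^esub> g i) = (\<lambda>i\<in>I. g i \<otimes>\<^bsub>M\<^esub> f i)"
  by (auto simp: families_def fun_eq_iff Pi_iff PiE_iff m_comm)

lemma mult_families_one:
  "f \<in> families M I \<Longrightarrow> (\<lambda>i\<in>I. (\<lambda>i\<in>I. \<one>\<^bsub>M\<^esub>) i \<otimes>\<^bsub>M\<^esub> f i) = f"
  by (auto simp: families_def fun_eq_iff PiE_iff extensional_def)

lemma mult_families_assoc:
  "\<lbrakk>f \<in> families M I; g \<in> families M I; h \<in> families M I\<rbrakk>
    \<Longrightarrow> (\<lambda>i\<in>I. (\<lambda>i\<in>I. f i \<otimes>\<^bsub>M\<^esub> g i) i \<otimes>\<^bsub>M\<^esub> h i)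
      = (\<lambda>i\<in>I. f i \<otimes>\<^bsub>M\<^esub> (\<lambda>i\<in>I. g i \<otimes>\<^bsub>M\<^esub> h i) i)"
  by (auto simp: families_def fun_eq_iff PiE_iff m_assoc)

lemma mult_families_upd:
  assumes "g \<in> families M I" and "i \<in> I"
  shows "(\<lambda>j\<in>I. g j \<otimes>\<^bsub>M\<^esub> (f(i := x)) j) = (\<lambda>j\<in>I. g j \<otimes>\<^bsub>M\<^esub> f j)(i := g i \<otimes>\<^bsub>M\<^esub> x)"
  using assms by (auto simp: fun_eq_iff)

section \<open>The convolution product on families\<close>

context
  fixes I :: "'i set"
begin

abbreviation (input) "FF \<equiv> free_module R (families M I)"
abbreviation (input) "FA \<equiv> family_algebra R M I"

text \<open>In the definition the index set depends on \<open>h\<close> and on both supports. Moving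
  the condition into the summand gives a sum over a fixed rectangle, which can be compared for
  different factors.\<close>

lemma family_algebra_mult_eq_finsum:
  assumes p: "p \<in> carrier FF" and q: "q \<in> carrier FF"
    and A: "finite A" "{f. p f \<noteq> \<zero>} \<subseteq> A" and B: "finite B" "{g. q g \<noteq> \<zero>} \<subseteq> B"
  shows "(p \<otimes>\<^bsub>FA\<^esub> q) h = (\<Oplus>u\<in>A \<times> B.
    if (\<lambda>i\<in>I. fst u i \<otimes>\<^bsub>M\<^esub> snd u i) = h then p (fst u) \<otimes> q (snd u) else \<zero>)"
  unfolding family_algebra_mult using A B
  by (intro R.add.finprod_mono_neutral_cong_left)
    (auto simp: R.free_module_value[OF p] R.free_module_value[OF q])

lemma family_algebra_mult_support:
  assumes p: "p \<in> carrier FF" and q: "q \<in> carrier FF" and h: "(p \<otimes>\<^bsub>FA\<^esub> q) h \<noteq> \<zero>"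
  shows "h \<in> (\<lambda>(f, g). \<lambda>i\<in>I. f i \<otimes>\<^bsub>M\<^esub> g i) ` ({f. p f \<noteq> \<zero>} \<times> {g. q g \<noteq> \<zero>})"
proof (rule ccontr)
  assume "\<not> ?thesis"
  then have "{(f, g). p f \<noteq> \<zero> \<and> q g \<noteq> \<zero> \<and> (\<lambda>i\<in>I. f i \<otimes>\<^bsub>M\<^esub> g i) = h} = {}"
    by (auto simp: image_iff)
  then have "(p \<otimes>\<^bsub>FA\<^esub> q) h = \<zero>"
    unfolding family_algebra_mult by (simp only: R.finsum_empty)
  then show False
    using h by contradiction
qed

lemma family_algebra_mult_closed:
  assumes p: "p \<in> carrier FF" and q: "q \<in> carrier FF"
  shows "p \<otimes>\<^bsub>FA\<^esub> q \<in> carrier FF"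
proof -
  note supp = R.free_module_support[OF p] R.free_module_support[OF q]
  have sub: "{h. (p \<otimes>\<^bsub>FA\<^esub> q) h \<noteq> \<zero>} \<subseteq>
      (\<lambda>(f, g). \<lambda>i\<in>I. f i \<otimes>\<^bsub>M\<^esub> g i) ` ({f. p f \<noteq> \<zero>} \<times> {g. q g \<noteq> \<zero>})"
    using family_algebra_mult_support[OF p q] by blast
  have "(p \<otimes>\<^bsub>FA\<^esub> q) h \<in> carrier R" for h
    unfolding family_algebra_mult_eq_finsum[OF p q supp(1) order.refl supp(3) order.refl]
    by (rule R.finsum_closed) (simp add: Pi_iff R.free_module_value[OF p] R.free_module_value[OF q])
  moreover have "finite {h. (p \<otimes>\<^bsub>FA\<^esub> q) h \<noteq> \<zero>}"
    by (rule finite_subset[OF sub]) (use supp in auto)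
  moreover have "(p \<otimes>\<^bsub>FA\<^esub> q) h = \<zero>" if "h \<notin> families M I" for h
  proof (rule ccontr)
    assume "(p \<otimes>\<^bsub>FA\<^esub> q) h \<noteq> \<zero>"
    from family_algebra_mult_support[OF p q this] obtain f g
      where "p f \<noteq> \<zero>" "q g \<noteq> \<zero>" and h: "h = (\<lambda>i\<in>I. f i \<otimes>\<^bsub>M\<^esub> g i)"
      by auto
    then have "f \<in> families M I" "g \<in> families M I"
      using supp(2,4) by auto
    then show False
      using mult_families[of f I g] h that by simp
  qed
  ultimately show ?thesis
    by (auto simp: free_module_simps)
qed

lemma family_algebra_mult_add:
  assumes p: "p \<in> carrier FF" and p': "p' \<in> carrier FF" and q: "q \<in> carrier FF"
  shows "(p \<oplus>\<^bsub>FF\<^esub> p') \<otimes>\<^bsub>FA\<^esub> q = (p \<otimes>\<^bsub>FA\<^esub> q) \<oplus>\<^bsub>FF\<^esub> (p' \<otimes>\<^bsub>FA\<^esub> q)"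
proof
  fix h
  define A where "A = {f. p f \<noteq> \<zero>} \<union> {f. p' f \<noteq> \<zero>}"
  let ?B = "{g. q g \<noteq> \<zero>}"
  have A: "finite A" "{f. p f \<noteq> \<zero>} \<subseteq> A" "{f. p' f \<noteq> \<zero>} \<subseteq> A"
    "{f. (p \<oplus>\<^bsub>FF\<^esub> p') f \<noteq> \<zero>} \<subseteq> A"
    using R.free_module_support[OF p] R.free_module_support[OF p']
    by (auto simp: A_def free_module_simps)
  note B = R.free_module_support(1)[OF q]
  note val = R.free_module_value[OF p] R.free_module_value[OF p'] R.free_module_value[OF q]
  let ?s = "\<lambda>p u. if (\<lambda>i\<in>I. fst u i \<otimes>\<^bsub>M\<^esub> snd u i) = h then p (fst u) \<otimes> q (snd u) else \<zero>"
  have "((p \<oplus>\<^bsub>FF\<^esub> p') \<otimes>\<^bsub>FA\<^esub> q) h = (\<Oplus>u\<in>A \<times> ?B. ?s (p \<oplus>\<^bsub>FF\<^esub> p') u)"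
    by (rule family_algebra_mult_eq_finsum[OF R.free_module_add_closed[OF p p'] q A(1,4) B order.refl])
  also have "\<dots> = (\<Oplus>u\<in>A \<times> ?B. ?s p u \<oplus> ?s p' u)"
    by (rule R.finsum_cong') (auto simp: free_module_simps val R.l_distr)
  also have "\<dots> = (\<Oplus>u\<in>A \<times> ?B. ?s p u) \<oplus> (\<Oplus>u\<in>A \<times> ?B. ?s p' u)"
    by (rule R.finsum_addf) (auto simp: val)
  also have "\<dots> = ((p \<otimes>\<^bsub>FA\<^esub> q) \<oplus>\<^bsub>FF\<^esub> (p' \<otimes>\<^bsub>FA\<^esub> q)) h"
    using family_algebra_mult_eq_finsum[OF p q A(1,2) B order.refl]
      family_algebra_mult_eq_finsum[OF p' q A(1,3) B order.refl]
    by (simp add: free_module_simps)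
  finally show "((p \<oplus>\<^bsub>FF\<^esub> p') \<otimes>\<^bsub>FA\<^esub> q) h = \<dots>" .
qed

lemma family_algebra_mult_smult:
  assumes r: "r \<in> carrier R" and p: "p \<in> carrier FF" and q: "q \<in> carrier FF"
  shows "(r \<odot>\<^bsub>FF\<^esub> p) \<otimes>\<^bsub>FA\<^esub> q = r \<odot>\<^bsub>FF\<^esub> (p \<otimes>\<^bsub>FA\<^esub> q)"
proof
  fix h
  let ?A = "{f. p f \<noteq> \<zero>}" and ?B = "{g. q g \<noteq> \<zero>}"
  note A = R.free_module_support(1)[OF p] and B = R.free_module_support(1)[OF q]
  note val = R.free_module_value[OF p] R.free_module_value[OF q]
  let ?s = "\<lambda>p u. if (\<lambda>i\<in>I. fst u i \<otimes>\<^bsub>M\<^esub> snd u i) = h then p (fst u) \<otimes> q (snd u) else \<zero>"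
  have "((r \<odot>\<^bsub>FF\<^esub> p) \<otimes>\<^bsub>FA\<^esub> q) h = (\<Oplus>u\<in>?A \<times> ?B. ?s (r \<odot>\<^bsub>FF\<^esub> p) u)"
    by (rule family_algebra_mult_eq_finsum[OF R.free_module_smult_closed[OF r p] q A _ B order.refl])
      (use r in \<open>auto simp: free_module_simps\<close>)
  also have "\<dots> = (\<Oplus>u\<in>?A \<times> ?B. r \<otimes> ?s p u)"
    by (rule R.finsum_cong') (auto simp: free_module_simps val r R.m_assoc)
  also have "\<dots> = r \<otimes> (\<Oplus>u\<in>?A \<times> ?B. ?s p u)"
    by (rule R.finsum_rdistr[symmetric]) (use A B in \<open>auto simp: r val\<close>)
  also have "\<dots> = (r \<odot>\<^bsub>FF\<^esub> (p \<otimes>\<^bsub>FA\<^esub> q)) h"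
    using family_algebra_mult_eq_finsum[OF p q A order.refl B order.refl]
    by (simp add: free_module_simps)
  finally show "((r \<odot>\<^bsub>FF\<^esub> p) \<otimes>\<^bsub>FA\<^esub> q) h = \<dots>" .
qed

lemma family_algebra_mult_single:
  assumes f: "f \<in> families M I" and g: "g \<in> families M I"
  shows "single R f \<otimes>\<^bsub>FA\<^esub> single R g = single R (\<lambda>i\<in>I. f i \<otimes>\<^bsub>M\<^esub> g i)"
proof
  fix h
  have "(single R f \<otimes>\<^bsub>FA\<^esub> single R g) h = (\<Oplus>u\<in>{f} \<times> {g}.
    if (\<lambda>i\<in>I. fst u i \<otimes>\<^bsub>M\<^esub> snd u i) = h then single R f (fst u) \<otimes> single R g (snd u) else \<zero>)"
    by (rule family_algebra_mult_eq_finsum[OF R.single_closed[OF f] R.single_closed[OF g]])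
      (auto simp: single_def)
  also have "\<dots> = single R (\<lambda>i\<in>I. f i \<otimes>\<^bsub>M\<^esub> g i) h"
    by (simp add: single_def)
  finally show "(single R f \<otimes>\<^bsub>FA\<^esub> single R g) h = \<dots>" .
qed

lemma family_algebra_mult_comm:
  assumes p: "p \<in> carrier FF" and q: "q \<in> carrier FF"
  shows "p \<otimes>\<^bsub>FA\<^esub> q = q \<otimes>\<^bsub>FA\<^esub> p"
proof
  fix h
  let ?A = "{f. p f \<noteq> \<zero>}" and ?B = "{g. q g \<noteq> \<zero>}"
  note A = R.free_module_support(1)[OF p] and B = R.free_module_support(1)[OF q]
  note val = R.free_module_value[OF p] R.free_module_value[OF q]
  let ?s = "\<lambda>p q u. if (\<lambda>i\<in>I. fst u i \<otimes>\<^bsub>M\<^esub> snd u i) = h then p (fst u) \<otimes> q (snd u) else \<zero>"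
  have "(p \<otimes>\<^bsub>FA\<^esub> q) h = (\<Oplus>u\<in>?A \<times> ?B. ?s p q u)"
    by (rule family_algebra_mult_eq_finsum[OF p q A order.refl B order.refl])
  also have "\<dots> = (\<Oplus>u\<in>?A \<times> ?B. ?s q p (prod.swap u))"
  proof (rule R.finsum_cong')
    fix u assume "u \<in> ?A \<times> ?B"
    then have "fst u \<in> families M I" "snd u \<in> families M I"
      using R.free_module_support(2)[OF p] R.free_module_support(2)[OF q] by auto
    then show "?s p q u = ?s q p (prod.swap u)"
      using mult_families_comm[of "fst u" I "snd u"] by (simp add: val R.m_comm)
  qed (auto simp: val)
  also have "\<dots> = (\<Oplus>u\<in>prod.swap ` (?A \<times> ?B). ?s q p u)"
    by (rule R.finsum_reindex[symmetric]) (auto simp: val)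
  also have "\<dots> = (q \<otimes>\<^bsub>FA\<^esub> p) h"
    by (simp only: product_swap)
      (rule family_algebra_mult_eq_finsum[OF q p B order.refl A order.refl, symmetric])
  finally show "(p \<otimes>\<^bsub>FA\<^esub> q) h = (q \<otimes>\<^bsub>FA\<^esub> p) h" .
qed

text \<open>Linearity in the right factor is obtained from the left one by commutativity.\<close>

lemma family_algebra_mult_linear:
  assumes q: "q \<in> carrier FF"
  shows "(\<lambda>p. p \<otimes>\<^bsub>FA\<^esub> q) \<in> linear_maps R FF FF" and "(\<lambda>p. q \<otimes>\<^bsub>FA\<^esub> p) \<in> linear_maps R FF FF"
proof -
  show *: "(\<lambda>p. p \<otimes>\<^bsub>FA\<^esub> q) \<in> linear_maps R FF FF"
    by (intro linear_mapsI family_algebra_mult_closed family_algebra_mult_add family_algebra_mult_smult q)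
  show "(\<lambda>p. q \<otimes>\<^bsub>FA\<^esub> p) \<in> linear_maps R FF FF"
    using linear_mapsD[OF *] q
    by (intro linear_mapsI)
      (simp_all add: family_algebra_mult_comm[OF q] R.free_module_add_closed R.free_module_smult_closed)
qed

text \<open>Both sides are linear in each of the three factors. The factors are replaced by basis
  families one after another, until the claim becomes associativity of the componentwise product of
  families.\<close>

lemma family_algebra_mult_assoc:
  assumes p: "p \<in> carrier FF" and q: "q \<in> carrier FF" and s: "s \<in> carrier FF"
  shows "(p \<otimes>\<^bsub>FA\<^esub> q) \<otimes>\<^bsub>FA\<^esub> s = p \<otimes>\<^bsub>FA\<^esub> (q \<otimes>\<^bsub>FA\<^esub> s)"
proof -
  note lin = family_algebra_mult_linear and closed = family_algebra_mult_closed
    and eqI = R.linear_maps_free_module_eqI[OF R.module_free_module]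
    and sc = R.single_closed
  have 1: "(single R f \<otimes>\<^bsub>FA\<^esub> single R g) \<otimes>\<^bsub>FA\<^esub> s = single R f \<otimes>\<^bsub>FA\<^esub> (single R g \<otimes>\<^bsub>FA\<^esub> s)"
    if f: "f \<in> families M I" and g: "g \<in> families M I" for f g
    by (rule eqI[OF lin(2) linear_maps_comp[OF lin(2) lin(2)] _ s])
      (use f g in \<open>simp_all add: sc closed family_algebra_mult_single mult_families mult_families_assoc del: restrict_apply\<close>)
  have 2: "(single R f \<otimes>\<^bsub>FA\<^esub> q) \<otimes>\<^bsub>FA\<^esub> s = single R f \<otimes>\<^bsub>FA\<^esub> (q \<otimes>\<^bsub>FA\<^esub> s)"
    if f: "f \<in> families M I" for f
    by (rule eqI[OF linear_maps_comp[OF lin(2) lin(1)] linear_maps_comp[OF lin(1) lin(2)] _ q])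
      (use f s in \<open>simp_all add: sc closed 1\<close>)
  show ?thesis
    by (rule eqI[OF linear_maps_comp[OF lin(1) lin(1)] lin(1) _ p]) (use q s in \<open>auto simp: closed 2\<close>)
qed

lemma family_algebra_one_mult:
  assumes p: "p \<in> carrier FF"
  shows "single R (\<lambda>i\<in>I. \<one>\<^bsub>M\<^esub>) \<otimes>\<^bsub>FA\<^esub> p = p"
proof (rule R.linear_maps_free_module_eqI[OF R.module_free_module _ _ _ p])
  show "(\<lambda>p. single R (\<lambda>i\<in>I. \<one>\<^bsub>M\<^esub>) \<otimes>\<^bsub>FA\<^esub> p) \<in> linear_maps R FF FF"
    by (rule family_algebra_mult_linear(2)[OF R.single_closed[OF one_family]])
  show "(\<lambda>p. p) \<in> linear_maps R FF FF"
    by (rule linear_mapsI) simp_all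
  show "single R (\<lambda>i\<in>I. \<one>\<^bsub>M\<^esub>) \<otimes>\<^bsub>FA\<^esub> single R f = single R f" if "f \<in> families M I" for f
    using family_algebra_mult_single[OF one_family that] mult_families_one[OF that] by simp
qed

lemma algebra_family_algebra: "algebra R FA"
proof -
  interpret F: module R FF
    by (rule R.module_free_module)
  note simps = family_algebra_simps
  show ?thesis
  proof (rule algebraI)
    have "abelian_group FA"
      using F.M.abelian_group_axioms
      by (simp add: abelian_group_def abelian_monoid_def abelian_group_axioms_def add_monoid_family_algebra)
    moreover have "comm_monoid FA"
      using family_algebra_mult_closed family_algebra_mult_assoc family_algebra_one_mult
        family_algebra_mult_comm R.single_closed[OF one_family]
      by (intro comm_monoidI) (simp_all add: simps)
    ultimately show "cring FA"
      by (rule cringI) (simp add: simps family_algebra_mult_add)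
  qed (simp_all add: simps R.is_cring F.smult_l_distr F.smult_r_distr F.smult_assoc1
      family_algebra_mult_smult)
qed

section \<open>The multilinear relations span an ideal\<close>

lemma multilinear_rels_subset: "multilinear_rels R M I \<subseteq> carrier FF"
proof -
  interpret F: module R FF
    by (rule R.module_free_module)
  show ?thesis
    unfolding multilinear_rels_def Let_def
    by (auto simp: R.single_closed families_upd)
qed

definition "multilinear_span = submodule_span R FF (multilinear_rels R M I)"

lemma multilinear_span_submodule: "submodule multilinear_span R FF"
  unfolding multilinear_span_def by (rule R.submodule_span_rels[OF multilinear_rels_subset])

text \<open>Multiplying a relator by a basis family \<open>g\<close> gives a relator of the same
  kind: \<open>f\<close> becomes the product family and the entries at \<open>i\<close> are
  multiplied by \<open>g i\<close>. General \<open>x\<close> follow by linearity, which is where the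
  span is needed.\<close>

lemma multilinear_rels_ideal:
  assumes a: "a \<in> multilinear_rels R M I" and x: "x \<in> carrier FF"
  shows "x \<otimes>\<^bsub>FA\<^esub> a \<in> multilinear_span"
proof -
  interpret F: module R FF
    by (rule R.module_free_module)
  have ac: "a \<in> carrier FF"
    using a multilinear_rels_subset by blast
  note lin = family_algebra_mult_linear
  show ?thesis
    using x
  proof (induction rule: R.free_module_induct)
    case zero
    then show ?case
      using linear_maps_zero[OF F.module_axioms F.module_axioms lin(1)[OF ac]]
        subgroup.one_closed[OF submodule.axioms(1)[OF multilinear_span_submodule]] by simp
  next
    case (single g)
    note lins = lin(2)[OF R.single_closed[OF single]]
    note minus = linear_maps_minus[OF F.module_axioms F.module_axioms lins]
    let ?fam = "families M I"
    have s: "single R g \<otimes>\<^bsub>FA\<^esub> single R (f(i := x)) = single R ((\<lambda>j\<in>I. g j \<otimes>\<^bsub>M\<^esub> f j)(i := g i \<otimes>\<^bsub>M\<^esub> x))"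
      if "f \<in> ?fam" "i \<in> I" "x \<in> carrier M" for f i x
      using that single by (simp add: family_algebra_mult_single families_upd mult_families_upd del: fun_upd_apply restrict_apply)
    have gc: "g i \<in> carrier M" if "i \<in> I" for i
      using single that by (auto simp: families_def)
    from a consider
      (add) f i x y where "f \<in> ?fam" "i \<in> I" "x \<in> carrier M" "y \<in> carrier M"
        "a = single R (f(i := x \<oplus>\<^bsub>M\<^esub> y)) \<ominus>\<^bsub>FF\<^esub> (single R (f(i := x)) \<oplus>\<^bsub>FF\<^esub> single R (f(i := y)))"
    | (smult) f i r x where "f \<in> ?fam" "i \<in> I" "r \<in> carrier R" "x \<in> carrier M"
        "a = single R (f(i := r \<odot>\<^bsub>M\<^esub> x)) \<ominus>\<^bsub>FF\<^esub> r \<odot>\<^bsub>FF\<^esub> single R (f(i := x))"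
      by (auto simp: multilinear_rels_def Let_def)
    then have "single R g \<otimes>\<^bsub>FA\<^esub> a \<in> multilinear_rels R M I"
    proof cases
      case add
      define f' where "f' = (\<lambda>j\<in>I. g j \<otimes>\<^bsub>M\<^esub> f j)"
      have "single R g \<otimes>\<^bsub>FA\<^esub> a = single R (f'(i := g i \<otimes>\<^bsub>M\<^esub> x \<oplus>\<^bsub>M\<^esub> g i \<otimes>\<^bsub>M\<^esub> y)) \<ominus>\<^bsub>FF\<^esub>
          (single R (f'(i := g i \<otimes>\<^bsub>M\<^esub> x)) \<oplus>\<^bsub>FF\<^esub> single R (f'(i := g i \<otimes>\<^bsub>M\<^esub> y)))"
        using add single gc
        by (simp add: minus linear_mapsD[OF lins] s R.single_closed families_upd r_distr f'_def)
      moreover have "f' \<in> ?fam"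
        using mult_families[OF single add(1)] by (simp add: f'_def)
      ultimately show ?thesis
        unfolding multilinear_rels_def Let_def using add gc
        by (intro UnI1 CollectI exI[of _ f'] exI[of _ i] exI[of _ "g i \<otimes>\<^bsub>M\<^esub> x"] exI[of _ "g i \<otimes>\<^bsub>M\<^esub> y"]) auto
    next
      case smult
      define f' where "f' = (\<lambda>j\<in>I. g j \<otimes>\<^bsub>M\<^esub> f j)"
      have "g i \<otimes>\<^bsub>M\<^esub> (r \<odot>\<^bsub>M\<^esub> x) = r \<odot>\<^bsub>M\<^esub> (g i \<otimes>\<^bsub>M\<^esub> x)"
        using smult gc by (simp add: mult_smult)
      then have "single R g \<otimes>\<^bsub>FA\<^esub> a = single R (f'(i := r \<odot>\<^bsub>M\<^esub> (g i \<otimes>\<^bsub>M\<^esub> x))) \<ominus>\<^bsub>FF\<^esub>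
          r \<odot>\<^bsub>FF\<^esub> single R (f'(i := g i \<otimes>\<^bsub>M\<^esub> x))"
        using smult single gc
        by (simp add: minus linear_mapsD[OF lins] s R.single_closed families_upd f'_def)
      moreover have "f' \<in> ?fam"
        using mult_families[OF single smult(1)] by (simp add: f'_def)
      ultimately show ?thesis
        unfolding multilinear_rels_def Let_def using smult gc
        by (intro UnI2 CollectI exI[of _ f'] exI[of _ i] exI[of _ r] exI[of _ "g i \<otimes>\<^bsub>M\<^esub> x"]) auto
    qed
    then show ?case
      unfolding multilinear_span_def by (rule subsetD[OF submodule_span_superset])
  next
    case (add p q)
    then show ?case
      using F.submoduleE(5)[OF multilinear_span_submodule] linear_mapsD(2)[OF lin(1)[OF ac]] by simp
  next
    case (smult r p)
    then show ?case
      using F.submoduleE(4)[OF multilinear_span_submodule] linear_mapsD(3)[OF lin(1)[OF ac]] by simp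
  qed
qed

lemma multilinear_span_ideal: "ideal multilinear_span FA"
proof -
  interpret F: module R FF
    by (rule R.module_free_module)
  interpret FA: algebra R FA
    by (rule algebra_family_algebra)
  note lin = family_algebra_mult_linear
  have left: "x \<otimes>\<^bsub>FA\<^esub> a \<in> multilinear_span" if x: "x \<in> carrier FF" and a: "a \<in> multilinear_span" for x a
  proof -
    \<comment> \<open>For fixed \<open>x\<close>, the elements that \<open>x\<close> multiplies into
      the span form a submodule; it contains the relators, hence the whole span.\<close>
    have "submodule {a \<in> carrier FF. x \<otimes>\<^bsub>FA\<^esub> a \<in> multilinear_span} R FF"
    proof (rule F.submoduleI)
      fix a assume a: "a \<in> {a \<in> carrier FF. x \<otimes>\<^bsub>FA\<^esub> a \<in> multilinear_span}"
      have "x \<otimes>\<^bsub>FA\<^esub> (\<zero>\<^bsub>FF\<^esub> \<ominus>\<^bsub>FF\<^esub> a) = \<zero>\<^bsub>FF\<^esub> \<ominus>\<^bsub>FF\<^esub> (x \<otimes>\<^bsub>FA\<^esub> a)"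
        using a linear_maps_minus[OF F.module_axioms F.module_axioms lin(2)[OF x] F.M.zero_closed]
          linear_maps_zero[OF F.module_axioms F.module_axioms lin(2)[OF x]] by simp
      then show "\<ominus>\<^bsub>FF\<^esub> a \<in> {a \<in> carrier FF. x \<otimes>\<^bsub>FA\<^esub> a \<in> multilinear_span}"
        using a F.submoduleE(3)[OF multilinear_span_submodule] x family_algebra_mult_closed
        by (simp add: a_minus_def)
    qed (use linear_mapsD[OF lin(2)[OF x]] F.submoduleE[OF multilinear_span_submodule]
          linear_maps_zero[OF F.module_axioms F.module_axioms lin(2)[OF x]]
          subgroup.one_closed[OF submodule.axioms(1)[OF multilinear_span_submodule]] in auto)
    then have "multilinear_span \<subseteq> {a \<in> carrier FF. x \<otimes>\<^bsub>FA\<^esub> a \<in> multilinear_span}"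
      using multilinear_rels_ideal[OF _ x] multilinear_rels_subset
      by (subst multilinear_span_def, intro submodule_span_least) auto
    then show ?thesis
      using a by blast
  qed
  show ?thesis
  proof (rule idealI)
    show "ring FA"
      by (rule FA.ring_axioms)
    show "subgroup multilinear_span (add_monoid FA)"
      using multilinear_span_submodule by (simp add: submodule_def add_monoid_family_algebra)
    fix a x assume a: "a \<in> multilinear_span" and x: "x \<in> carrier FA"
    show "x \<otimes>\<^bsub>FA\<^esub> a \<in> multilinear_span"
      using left a x by (simp add: family_algebra_simps)
    then show "a \<otimes>\<^bsub>FA\<^esub> x \<in> multilinear_span"
      using family_algebra_mult_comm a x F.submoduleE(1)[OF multilinear_span_submodule]
      by (auto simp: family_algebra_simps)
  qed
qed

section \<open>The tensor power as a quotient algebra\<close>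

lemma tensor_power_eq_quotient: "tensor_power R M I = quotient_module FA multilinear_span"
  by (simp add: tensor_power_def submodule_span_family_algebra multilinear_span_def)

text \<open>As a module the tensor power is the module presented by families and multilinearity, so
  induction and linear extension for presented modules apply to it.\<close>

lemma tensor_power_simps:
  "carrier (tensor_power R M I) = carrier (presented_module R (families M I) (multilinear_rels R M I))"
  "\<zero>\<^bsub>tensor_power R M I\<^esub> = \<zero>\<^bsub>presented_module R (families M I) (multilinear_rels R M I)\<^esub>"
  "K \<oplus>\<^bsub>tensor_power R M I\<^esub> L = K \<oplus>\<^bsub>presented_module R (families M I) (multilinear_rels R M I)\<^esub> L"
  "r \<odot>\<^bsub>tensor_power R M I\<^esub> K = r \<odot>\<^bsub>presented_module R (families M I) (multilinear_rels R M I)\<^esub> K"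
  by (simp_all add: tensor_power_def presented_module_def quotient_module_simps submodule_span_family_algebra
      coset_family_algebra family_algebra_simps A_RCOSETS_def RCOSETS_def r_coset_def set_add_def set_mult_def
      add_monoid_family_algebra)

lemma tensor_power_one: "\<one>\<^bsub>tensor_power R M I\<^esub> = pure_tensor R M I (\<lambda>i\<in>I. \<one>\<^bsub>M\<^esub>)"
  by (simp add: tensor_power_def quotient_module_simps family_algebra_simps pure_tensor_def
      generator_def coset_family_algebra submodule_span_family_algebra)

lemma tensor_power_mult_residue:
  assumes p: "p \<in> carrier FF" and q: "q \<in> carrier FF"
  shows "residue R (families M I) (multilinear_rels R M I) p \<otimes>\<^bsub>tensor_power R M I\<^esub>
      residue R (families M I) (multilinear_rels R M I) q
    = residue R (families M I) (multilinear_rels R M I) (p \<otimes>\<^bsub>FA\<^esub> q)"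
  using ideal.rcoset_mult_add[OF multilinear_span_ideal, of p q] p q
  by (simp add: tensor_power_eq_quotient quotient_module_simps residue_def family_algebra_simps
      coset_family_algebra multilinear_span_def)

lemma algebra_tensor_power: "algebra R (tensor_power R M I)"
proof -
  let ?T = "tensor_power R M I" and ?r = "residue R (families M I) (multilinear_rels R M I)"
  interpret FA: algebra R FA
    by (rule algebra_family_algebra)
  have "module R (quotient_module FA multilinear_span)"
    by (rule FA.module_quotient_module)
      (simp add: submodule_family_algebra_iff multilinear_span_submodule)
  then interpret T: module R ?T
    by (simp add: tensor_power_eq_quotient)
  have rep: "\<exists>p\<in>carrier FF. K = ?r p" if "K \<in> carrier ?T" for K
    using that by (auto simp: tensor_power_simps R.presented_module_carrier[OF multilinear_rels_subset])
  note mult = tensor_power_mult_residue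
  note closed = family_algebra_mult_closed R.residue_closed[OF multilinear_rels_subset]
  note res = linear_mapsD(2,3)[OF R.residue_linear[OF multilinear_rels_subset], symmetric]
  note one = R.single_closed[OF one_family]
  show ?thesis
  proof (rule algebraI)
    have "comm_monoid ?T"
    proof (rule comm_monoidI)
      fix K L assume K: "K \<in> carrier ?T" and L: "L \<in> carrier ?T"
      obtain p q where p: "p \<in> carrier FF" "K = ?r p" and q: "q \<in> carrier FF" "L = ?r q"
        using rep K L by blast
      show "K \<otimes>\<^bsub>?T\<^esub> L \<in> carrier ?T"
        by (simp add: p q mult tensor_power_simps closed)
      show "K \<otimes>\<^bsub>?T\<^esub> L = L \<otimes>\<^bsub>?T\<^esub> K"
        by (simp add: p q mult family_algebra_mult_comm)
      show "\<one>\<^bsub>?T\<^esub> \<otimes>\<^bsub>?T\<^esub> K = K"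
        by (simp add: p tensor_power_one pure_tensor_def generator_eq_residue mult one
            family_algebra_one_mult)
      fix H assume "H \<in> carrier ?T"
      then obtain s where s: "s \<in> carrier FF" "H = ?r s"
        using rep by blast
      show "K \<otimes>\<^bsub>?T\<^esub> L \<otimes>\<^bsub>?T\<^esub> H = K \<otimes>\<^bsub>?T\<^esub> (L \<otimes>\<^bsub>?T\<^esub> H)"
        by (simp add: p q s mult closed family_algebra_mult_assoc)
    qed (simp add: tensor_power_one pure_tensor_def tensor_power_simps
          R.generator_closed[OF multilinear_rels_subset] one_family)
    then show "cring ?T"
    proof (rule cringI[OF T.M.abelian_group_axioms])
      fix K L H assume "K \<in> carrier ?T" "L \<in> carrier ?T" "H \<in> carrier ?T"
      then obtain p q s where p: "p \<in> carrier FF" "K = ?r p" and q: "q \<in> carrier FF" "L = ?r q"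
          and s: "s \<in> carrier FF" "H = ?r s"
        using rep by metis
      show "(K \<oplus>\<^bsub>?T\<^esub> L) \<otimes>\<^bsub>?T\<^esub> H = K \<otimes>\<^bsub>?T\<^esub> H \<oplus>\<^bsub>?T\<^esub> L \<otimes>\<^bsub>?T\<^esub> H"
        by (simp add: p q s mult tensor_power_simps res(1) closed R.free_module_add_closed
            family_algebra_mult_add)
    qed
    fix r K L assume r: "r \<in> carrier R" and "K \<in> carrier ?T" "L \<in> carrier ?T"
    then obtain p q where p: "p \<in> carrier FF" "K = ?r p" and q: "q \<in> carrier FF" "L = ?r q"
      using rep by blast
    show "(r \<odot>\<^bsub>?T\<^esub> K) \<otimes>\<^bsub>?T\<^esub> L = r \<odot>\<^bsub>?T\<^esub> (K \<otimes>\<^bsub>?T\<^esub> L)"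
      by (simp add: r p q mult tensor_power_simps res(2) closed R.free_module_smult_closed
          family_algebra_mult_smult)
  qed (simp_all add: R.is_cring T.smult_l_distr T.smult_r_distr T.smult_assoc1)
qed

lemma pure_tensor_closed:
  "f \<in> families M I \<Longrightarrow> pure_tensor R M I f \<in> carrier (tensor_power R M I)"
  by (simp add: pure_tensor_def tensor_power_simps R.generator_closed[OF multilinear_rels_subset])

lemma pure_tensor_mult:
  assumes f: "f \<in> families M I" and g: "g \<in> families M I"
  shows "pure_tensor R M I f \<otimes>\<^bsub>tensor_power R M I\<^esub> pure_tensor R M I g
    = pure_tensor R M I (\<lambda>i\<in>I. f i \<otimes>\<^bsub>M\<^esub> g i)"
  using f g
  by (simp add: pure_tensor_def generator_eq_residue tensor_power_mult_residue R.single_closed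
      family_algebra_mult_single)

end

end

section \<open>Actions of a tensor power on a presented module\<close>

lemma linear_maps_sum:
  assumes N: "module R N" and f: "f \<in> linear_maps R M N" and g: "g \<in> linear_maps R M N"
  shows "(\<lambda>x. f x \<oplus>\<^bsub>N\<^esub> g x) \<in> linear_maps R M N"
proof -
  interpret N: module R N by fact
  show ?thesis
    by (rule linear_mapsI)
      (simp_all add: linear_mapsD[OF f] linear_mapsD[OF g] N.M.a_ac N.smult_r_distr)
qed

lemma linear_maps_scale:
  assumes N: "module R N" and f: "f \<in> linear_maps R M N" and r: "r \<in> carrier R"
  shows "(\<lambda>x. r \<odot>\<^bsub>N\<^esub> f x) \<in> linear_maps R M N"
proof -
  interpret N: module R N by fact
  show ?thesis
    by (rule linear_mapsI)
      (simp_all add: linear_mapsD[OF f] r N.smult_r_distr N.smult_assoc1[symmetric] N.R.m_comm)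
qed

lemma with_action_simps:
  "carrier (with_action W act) = carrier W"
  "\<zero>\<^bsub>with_action W act\<^esub> = \<zero>\<^bsub>W\<^esub>"
  "w \<oplus>\<^bsub>with_action W act\<^esub> w' = w \<oplus>\<^bsub>W\<^esub> w'"
  "t \<odot>\<^bsub>with_action W act\<^esub> w = act t w"
  by (simp_all add: with_action_def ring.defs)

lemma abelian_group_with_action:
  assumes "abelian_group W"
  shows "abelian_group (with_action W act)"
proof -
  interpret W: abelian_group W by fact
  show ?thesis
    by (rule abelian_groupI) (auto simp: with_action_simps W.a_ac intro: bexI[of _ "\<ominus>\<^bsub>W\<^esub> x" for x] W.l_neg)
qed

context algebra
begin

lemma tensor_power_linear_eqI:
  assumes N: "module R N"
    and f: "f \<in> linear_maps R (tensor_power R M I) N" and g: "g \<in> linear_maps R (tensor_power R M I) N"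
    and eq: "\<And>v. v \<in> families M I \<Longrightarrow> f (pure_tensor R M I v) = g (pure_tensor R M I v)"
    and t: "t \<in> carrier (tensor_power R M I)"
  shows "f t = g t"
proof (rule R.linear_maps_presented_module_eqI[OF multilinear_rels_subset N])
  show "f \<in> linear_maps R (presented_module R (families M I) (multilinear_rels R M I)) N"
    and "g \<in> linear_maps R (presented_module R (families M I) (multilinear_rels R M I)) N"
    using f g by (simp_all add: linear_maps_def tensor_power_simps)
qed (use t eq in \<open>simp_all add: tensor_power_simps pure_tensor_def\<close>)

section \<open>Linear extension of an operation of families on generators\<close>

context
  fixes I :: "'i set" and B :: "'g set" and rels :: "('g \<Rightarrow> 'a) set"
    and \<sigma> :: "('i \<Rightarrow> 'c) \<Rightarrow> 'g \<Rightarrow> 'g"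
  assumes rels: "rels \<subseteq> carrier (free_module R B)"
    and act_closed: "\<And>v b. \<lbrakk>v \<in> families M I; b \<in> B\<rbrakk> \<Longrightarrow> \<sigma> v b \<in> B"
    and act_one: "\<And>b. b \<in> B \<Longrightarrow> \<sigma> (\<lambda>i\<in>I. \<one>\<^bsub>M\<^esub>) b = b"
    and act_mult: "\<And>u v b. \<lbrakk>u \<in> families M I; v \<in> families M I; b \<in> B\<rbrakk>
      \<Longrightarrow> \<sigma> (\<lambda>i\<in>I. u i \<otimes>\<^bsub>M\<^esub> v i) b = \<sigma> u (\<sigma> v b)"
    and act_add: "\<And>v i x y b. \<lbrakk>v \<in> families M I; i \<in> I; x \<in> carrier M; y \<in> carrier M; b \<in> B\<rbrakk>
      \<Longrightarrow> generator R B rels (\<sigma> (v(i := x \<oplus>\<^bsub>M\<^esub> y)) b) =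
        generator R B rels (\<sigma> (v(i := x)) b) \<oplus>\<^bsub>presented_module R B rels\<^esub>
        generator R B rels (\<sigma> (v(i := y)) b)"
    and act_smult: "\<And>v i r x b. \<lbrakk>v \<in> families M I; i \<in> I; r \<in> carrier R; x \<in> carrier M; b \<in> B\<rbrakk>
      \<Longrightarrow> generator R B rels (\<sigma> (v(i := r \<odot>\<^bsub>M\<^esub> x)) b) =
        r \<odot>\<^bsub>presented_module R B rels\<^esub> generator R B rels (\<sigma> (v(i := x)) b)"
    and act_rels: "\<And>v p. \<lbrakk>v \<in> families M I; p \<in> rels\<rbrakk>
      \<Longrightarrow> lin_comb R (presented_module R B rels) (\<lambda>b. generator R B rels (\<sigma> v b)) p =
        \<zero>\<^bsub>presented_module R B rels\<^esub>"
begin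

abbreviation (input) "WW \<equiv> presented_module R B rels"
abbreviation (input) "TT \<equiv> tensor_power R M I"

interpretation W: module R WW
  by (rule R.module_presented_module[OF rels])

interpretation T: algebra R TT
  by (rule algebra_tensor_power)

text \<open>The first extension, over the generators with \<open>v\<close> fixed;
  \<open>act_rels\<close> makes it independent of the representative.\<close>

definition "family_act v = lin_ext R WW (\<lambda>b. generator R B rels (\<sigma> v b))"

lemma family_act_linear: "v \<in> families M I \<Longrightarrow> family_act v \<in> linear_maps R WW WW"
  unfolding family_act_def
  by (rule R.lin_ext_linear[OF rels W.module_axioms]) (auto simp: R.generator_closed[OF rels] act_closed act_rels)

lemma family_act_generator:
  "\<lbrakk>v \<in> families M I; b \<in> B\<rbrakk> \<Longrightarrow> family_act v (generator R B rels b) = generator R B rels (\<sigma> v b)"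
  unfolding family_act_def
  by (rule R.lin_ext_generator[OF rels W.module_axioms]) (auto simp: R.generator_closed[OF rels] act_closed act_rels)

text \<open>The hypothesis \<open>act_add\<close> speaks of generators; it extends to all
  \<open>w\<close> because both sides are linear in \<open>w\<close>.\<close>

lemma family_act_add:
  assumes "v \<in> families M I" "i \<in> I" "x \<in> carrier M" "y \<in> carrier M" and w: "w \<in> carrier WW"
  shows "family_act (v(i := x \<oplus>\<^bsub>M\<^esub> y)) w = family_act (v(i := x)) w \<oplus>\<^bsub>WW\<^esub> family_act (v(i := y)) w"
  by (rule R.linear_maps_presented_module_eqI[OF rels W.module_axioms family_act_linear
        linear_maps_sum[OF W.module_axioms family_act_linear family_act_linear] _ w])
    (use assms in \<open>simp_all add: families_upd family_act_generator act_add\<close>)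

lemma family_act_smult:
  assumes "v \<in> families M I" "i \<in> I" "r \<in> carrier R" "x \<in> carrier M" and w: "w \<in> carrier WW"
  shows "family_act (v(i := r \<odot>\<^bsub>M\<^esub> x)) w = r \<odot>\<^bsub>WW\<^esub> family_act (v(i := x)) w"
  by (rule R.linear_maps_presented_module_eqI[OF rels W.module_axioms family_act_linear
        linear_maps_scale[OF W.module_axioms family_act_linear] _ w])
    (use assms in \<open>simp_all add: families_upd family_act_generator act_smult\<close>)

lemma family_act_one:
  assumes w: "w \<in> carrier WW"
  shows "family_act (\<lambda>i\<in>I. \<one>\<^bsub>M\<^esub>) w = w"
proof (rule R.linear_maps_presented_module_eqI[OF rels W.module_axioms family_act_linear[OF one_family] _ _ w])
  show "(\<lambda>w. w) \<in> linear_maps R WW WW"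
    by (rule linear_mapsI) simp_all
qed (simp add: family_act_generator[OF one_family] act_one)

lemma family_act_mult:
  assumes u: "u \<in> families M I" and v: "v \<in> families M I" and w: "w \<in> carrier WW"
  shows "family_act (\<lambda>i\<in>I. u i \<otimes>\<^bsub>M\<^esub> v i) w = family_act u (family_act v w)"
  by (rule R.linear_maps_presented_module_eqI[OF rels W.module_axioms family_act_linear[OF mult_families[OF u v]]
        linear_maps_comp[OF family_act_linear[OF v] family_act_linear[OF u]] _ w])
    (simp add: family_act_generator mult_families u v act_closed act_mult)

text \<open>The second extension, over families with \<open>w\<close> fixed. Linearity in
  \<open>t\<close> comes with the construction, linearity in \<open>w\<close> has to be recovered
  separately.\<close>

definition "tensor_act t w = lin_ext R WW (\<lambda>v. family_act v w) t"

context
  fixes w assumes w: "w \<in> carrier WW"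
begin

lemma family_act_Pi: "(\<lambda>v. family_act v w) \<in> families M I \<rightarrow> carrier WW"
  using linear_mapsD(1)[OF family_act_linear w] by simp

lemma family_act_multilinear:
  assumes p: "p \<in> multilinear_rels R M I"
  shows "lin_comb R WW (\<lambda>v. family_act v w) p = \<zero>\<^bsub>WW\<^esub>"
proof -
  let ?F = "free_module R (families M I)" and ?L = "lin_comb R WW (\<lambda>v. family_act v w)"
  note lin = R.lin_comb_linear[OF W.module_axioms family_act_Pi]
  note single = R.lin_comb_single[OF W.module_axioms family_act_Pi]
  note minus = linear_maps_minus[OF R.module_free_module W.module_axioms lin]
  interpret F: module R ?F
    by (rule R.module_free_module)
  have closed: "family_act v w \<in> carrier WW" if "v \<in> families M I" for v
    using family_act_Pi that by blast
  from p consider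
      (add) f i x y where "f \<in> families M I" "i \<in> I" "x \<in> carrier M" "y \<in> carrier M"
        "p = single R (f(i := x \<oplus>\<^bsub>M\<^esub> y)) \<ominus>\<^bsub>?F\<^esub> (single R (f(i := x)) \<oplus>\<^bsub>?F\<^esub> single R (f(i := y)))"
    | (smult) f i r x where "f \<in> families M I" "i \<in> I" "r \<in> carrier R" "x \<in> carrier M"
        "p = single R (f(i := r \<odot>\<^bsub>M\<^esub> x)) \<ominus>\<^bsub>?F\<^esub> r \<odot>\<^bsub>?F\<^esub> single R (f(i := x))"
    by (auto simp: multilinear_rels_def Let_def)
  then show ?thesis
  proof cases
    case add
    then show ?thesis
      using closed w
      by (simp add: minus linear_mapsD[OF lin] single R.single_closed families_upd family_act_add
          W.M.minus_eq_zero_iff)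
  next
    case smult
    then show ?thesis
      using closed w
      by (simp add: minus linear_mapsD[OF lin] single R.single_closed families_upd family_act_smult
          W.M.minus_eq_zero_iff)
  qed
qed

lemma tensor_act_linear_left: "(\<lambda>t. tensor_act t w) \<in> linear_maps R TT WW"
  using R.lin_ext_linear[OF multilinear_rels_subset W.module_axioms family_act_Pi family_act_multilinear]
  by (simp add: tensor_act_def linear_maps_def tensor_power_simps)

lemma tensor_act_pure: "v \<in> families M I \<Longrightarrow> tensor_act (pure_tensor R M I v) w = family_act v w"
  unfolding tensor_act_def pure_tensor_def
  by (rule R.lin_ext_generator[OF multilinear_rels_subset W.module_axioms family_act_Pi family_act_multilinear])

end

text \<open>With the module elements fixed, both sides of each law are linear in \<open>t\<close>.
  It suffices to look at pure tensors, where the operator is \<open>family_act\<close> and known to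
  be linear.\<close>

lemma tensor_act_linear_right:
  assumes t: "t \<in> carrier TT"
  shows "tensor_act t \<in> linear_maps R WW WW"
proof (rule linear_mapsI)
  note left = tensor_act_linear_left
  fix w assume w: "w \<in> carrier WW"
  show "tensor_act t w \<in> carrier WW"
    using linear_mapsD(1)[OF left[OF w] t] .
  show "tensor_act t (w \<oplus>\<^bsub>WW\<^esub> w') = tensor_act t w \<oplus>\<^bsub>WW\<^esub> tensor_act t w'" if w': "w' \<in> carrier WW" for w'
    by (rule tensor_power_linear_eqI[OF W.module_axioms left
          linear_maps_sum[OF W.module_axioms left[OF w] left[OF w']] _ t])
      (use w w' in \<open>simp_all add: tensor_act_pure linear_mapsD(2)[OF family_act_linear]\<close>)
  show "tensor_act t (r \<odot>\<^bsub>WW\<^esub> w) = r \<odot>\<^bsub>WW\<^esub> tensor_act t w" if r: "r \<in> carrier R" for r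
    by (rule tensor_power_linear_eqI[OF W.module_axioms left
          linear_maps_scale[OF W.module_axioms left[OF w] r] _ t])
      (use w r in \<open>simp_all add: tensor_act_pure linear_mapsD(3)[OF family_act_linear]\<close>)
qed

lemma tensor_mult_linear:
  assumes t: "t \<in> carrier TT"
  shows "(\<lambda>s. s \<otimes>\<^bsub>TT\<^esub> t) \<in> linear_maps R TT TT" and "(\<lambda>s. t \<otimes>\<^bsub>TT\<^esub> s) \<in> linear_maps R TT TT"
proof -
  show *: "(\<lambda>s. s \<otimes>\<^bsub>TT\<^esub> t) \<in> linear_maps R TT TT"
    using t by (intro linear_mapsI) (simp_all add: T.l_distr T.smult_assoc2)
  show "(\<lambda>s. t \<otimes>\<^bsub>TT\<^esub> s) \<in> linear_maps R TT TT"
    using t linear_mapsD[OF *] by (intro linear_mapsI) (simp_all add: T.m_comm[OF t])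
qed

lemma tensor_act_mult:
  assumes s: "s \<in> carrier TT" and t: "t \<in> carrier TT" and w: "w \<in> carrier WW"
  shows "tensor_act (s \<otimes>\<^bsub>TT\<^esub> t) w = tensor_act s (tensor_act t w)"
proof -
  note left = tensor_act_linear_left and right = tensor_act_linear_right
    and eqI = tensor_power_linear_eqI[OF W.module_axioms] and comp = linear_maps_comp
    and mult = tensor_mult_linear
  \<comment> \<open>The left factor is made pure first; then both sides are linear in
    \<open>t\<close> and the right factor can be made pure as well.\<close>
  have *: "tensor_act (pure_tensor R M I u \<otimes>\<^bsub>TT\<^esub> t) w = tensor_act (pure_tensor R M I u) (tensor_act t w)"
    if u: "u \<in> families M I" for u
    by (rule eqI[OF comp[OF mult(2) left] comp[OF left right] _ t])
      (use u w in \<open>simp_all add: pure_tensor_closed pure_tensor_mult tensor_act_pure mult_families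
          family_act_mult linear_mapsD(1)[OF family_act_linear] del: restrict_apply\<close>)
  show ?thesis
    by (rule eqI[OF comp[OF mult(1)[OF t] left[OF w]] left _ s])
      (use w t * linear_mapsD(1)[OF left] in simp_all)
qed

text \<open>Uniqueness needs linearity over \<open>R\<close> of an arbitrary competitor in both
  arguments. It is derived from the module laws over the tensor power and the clause on
  \<open>r \<odot> \<one>\<close>; then two competitors are compared first on pure tensors and then
  on generators.\<close>

theorem ex1_tensor_power_action:
  "\<exists>!act. act \<in> (carrier TT \<rightarrow>\<^sub>E (carrier WW \<rightarrow>\<^sub>E carrier WW)) \<and>
    module TT (with_action WW act) \<and>
    (\<forall>r\<in>carrier R. \<forall>w\<in>carrier WW. act (r \<odot>\<^bsub>TT\<^esub> \<one>\<^bsub>TT\<^esub>) w = r \<odot>\<^bsub>WW\<^esub> w) \<and>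
    (\<forall>v\<in>families M I. \<forall>b\<in>B.
       act (pure_tensor R M I v) (generator R B rels b) = generator R B rels (\<sigma> v b))"
  (is "\<exists>!act. ?P act")
proof (rule ex_ex1I)
  \<comment> \<open>Restricting to the carriers fixes the values elsewhere, since uniqueness is
    claimed for functions on the whole type.\<close>
  define act where "act = (\<lambda>t\<in>carrier TT. \<lambda>w\<in>carrier WW. tensor_act t w)"
  have act: "act t w = tensor_act t w" if "t \<in> carrier TT" "w \<in> carrier WW" for t w
    using that by (simp add: act_def)
  note left = linear_mapsD[OF tensor_act_linear_left] and right = linear_mapsD[OF tensor_act_linear_right]
  have one: "tensor_act \<one>\<^bsub>TT\<^esub> w = w" if "w \<in> carrier WW" for w
    using that by (simp add: tensor_power_one tensor_act_pure one_family family_act_one)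
  have "module TT (with_action WW act)"
    by (rule moduleI)
      (simp_all add: T.cring_axioms abelian_group_with_action[OF W.M.abelian_group_axioms] with_action_simps
        act left right tensor_act_mult one)
  moreover have "act (r \<odot>\<^bsub>TT\<^esub> \<one>\<^bsub>TT\<^esub>) w = r \<odot>\<^bsub>WW\<^esub> w" if "r \<in> carrier R" "w \<in> carrier WW" for r w
    using that by (simp add: act left one)
  ultimately have "?P act"
    by (auto simp: act_def right pure_tensor_closed R.generator_closed[OF rels] tensor_act_pure
        family_act_generator)
  then show "\<exists>act. ?P act"
    by (rule exI[of ?P act])
next
  fix act act' assume "?P act" and "?P act'"
  have linear: "act t \<in> linear_maps R WW WW" "(\<lambda>t. act t w) \<in> linear_maps R TT WW"
    if P: "?P act" and t: "t \<in> carrier TT" and w: "w \<in> carrier WW" for act t w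
  proof -
    interpret A: module TT "with_action WW act"
      using P by blast
    note simps = with_action_simps
    have closed: "act t w \<in> carrier WW" if "t \<in> carrier TT" "w \<in> carrier WW" for t w
      using A.smult_closed[of t w] that by (simp add: simps)
    have scalar: "act (r \<odot>\<^bsub>TT\<^esub> \<one>\<^bsub>TT\<^esub>) w = r \<odot>\<^bsub>WW\<^esub> w" if "r \<in> carrier R" "w \<in> carrier WW" for r w
      using P that by blast
    have mult: "act (s \<otimes>\<^bsub>TT\<^esub> t) w = act s (act t w)" if "s \<in> carrier TT" "t \<in> carrier TT" "w \<in> carrier WW" for s t w
      using A.smult_assoc1[of s t w] that by (simp add: simps)
    have smult: "act (r \<odot>\<^bsub>TT\<^esub> t) w = r \<odot>\<^bsub>WW\<^esub> act t w" if "r \<in> carrier R" "t \<in> carrier TT" "w \<in> carrier WW" for r t w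
    proof -
      have "r \<odot>\<^bsub>TT\<^esub> t = (r \<odot>\<^bsub>TT\<^esub> \<one>\<^bsub>TT\<^esub>) \<otimes>\<^bsub>TT\<^esub> t"
        using that by (simp add: T.smult_assoc2)
      then show ?thesis
        using that by (simp add: mult closed scalar)
    qed
    show "act t \<in> linear_maps R WW WW"
    proof (rule linear_mapsI)
      fix r x assume r: "r \<in> carrier R" and x: "x \<in> carrier WW"
      \<comment> \<open>Scaling by \<open>r\<close> is the action of
        \<open>r \<odot> \<one>\<close>, and in the commutative tensor power this element can be
        moved past \<open>t\<close>.\<close>
      have "act t (r \<odot>\<^bsub>WW\<^esub> x) = act (t \<otimes>\<^bsub>TT\<^esub> (r \<odot>\<^bsub>TT\<^esub> \<one>\<^bsub>TT\<^esub>)) x"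
        using r x t by (simp add: mult scalar)
      also have "t \<otimes>\<^bsub>TT\<^esub> (r \<odot>\<^bsub>TT\<^esub> \<one>\<^bsub>TT\<^esub>) = r \<odot>\<^bsub>TT\<^esub> t"
        using r t by (simp add: linear_mapsD(3)[OF tensor_mult_linear(2)])
      finally show "act t (r \<odot>\<^bsub>WW\<^esub> x) = r \<odot>\<^bsub>WW\<^esub> act t x"
        using r x t by (simp add: smult)
    qed (use A.smult_r_distr[of t] t closed in \<open>simp_all add: simps\<close>)
    show "(\<lambda>t. act t w) \<in> linear_maps R TT WW"
      using A.smult_l_distr[of _ _ w] w by (intro linear_mapsI) (simp_all add: simps closed smult)
  qed
  note P = \<open>?P act\<close> and P' = \<open>?P act'\<close>
  note ext = conjunct1[OF P] conjunct1[OF P']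
  note gen = conjunct2[OF conjunct2[OF conjunct2[OF P]]] conjunct2[OF conjunct2[OF conjunct2[OF P']]]
  have eq: "act t w = act' t w" if t: "t \<in> carrier TT" and w: "w \<in> carrier WW" for t w
  proof (rule tensor_power_linear_eqI[OF W.module_axioms linear(2)[OF P t w] linear(2)[OF P' t w] _ t])
    fix v assume v: "v \<in> families M I"
    note pure = pure_tensor_closed[OF v]
    show "act (pure_tensor R M I v) w = act' (pure_tensor R M I v) w"
      by (rule R.linear_maps_presented_module_eqI[OF rels W.module_axioms
            linear(1)[OF P pure w] linear(1)[OF P' pure w] _ w])
        (simp add: gen v)
  qed
  show "act = act'"
  proof (rule PiE_ext[OF ext])
    fix t assume t: "t \<in> carrier TT"
    show "act t = act' t"
      by (rule PiE_ext[OF PiE_mem[OF ext(1) t] PiE_mem[OF ext(2) t]]) (rule eq[OF t])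
  qed
qed

end

end

section \<open>Components of curves and surfaces\<close>

lemma nonempty_component: "C \<in> components_of M S \<Longrightarrow> C \<noteq> {}"
  unfolding components_of_def by (rule nonempty_connected_components_of)

lemma component_subset: "C \<in> components_of M S \<Longrightarrow> C \<subseteq> S"
  unfolding components_of_def using connected_components_of_subset by fastforce

lemma components_disjoint:
  "\<lbrakk>C \<in> components_of M S; D \<in> components_of M S; C \<noteq> D\<rbrakk> \<Longrightarrow> C \<inter> D = {}"
  unfolding components_of_def using connected_components_of_overlap by blast

lemma connectedin_component: "C \<in> components_of M S \<Longrightarrow> connectedin M C"
  unfolding components_of_def
  using connectedin_connected_components_of connectedin_subtopology by blast

lemma component_maximal:
  assumes "C \<in> components_of M S" and "connectedin M E" and "E \<subseteq> S" and "C \<inter> E \<noteq> {}"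
  shows "E \<subseteq> C"
  using assms connected_components_of_maximal[of C "subtopology M S" E]
  by (auto simp: components_of_def connectedin_subtopology disjnt_def)

lemma exists_component_superset:
  assumes E: "connectedin M E" "E \<subseteq> S" and "E \<noteq> {}"
  shows "\<exists>C\<in>components_of M S. E \<subseteq> C"
proof -
  obtain x where x: "x \<in> E"
    using \<open>E \<noteq> {}\<close> by blast
  then have "x \<in> topspace (subtopology M S)"
    using E connectedin_subset_topspace by fastforce
  then obtain C where "C \<in> components_of M S" "x \<in> C"
    using Union_connected_components_of by (metis UnionE components_of_def)
  then show ?thesis
    using component_maximal[OF _ E, of C] x by blast
qed

section \<open>Smooth embeddings are homeomorphisms onto their images\<close>

lemma smooth_manifold_chart: "\<lbrakk>smooth_manifold M A; c \<in> A\<rbrakk> \<Longrightarrow> chart M c"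
  by (simp add: smooth_manifold_def)

lemma smooth_map_onE:
  assumes "smooth_map_on A B S f" and "p \<in> S"
  obtains U \<phi> W \<psi> O' g where "(U, \<phi>) \<in> A" "(W, \<psi>) \<in> B" "p \<in> U" "f p \<in> W"
    "open O'" "\<phi> p \<in> O'" "smooth_on g O'"
    "\<And>q. \<lbrakk>q \<in> S; q \<in> U; \<phi> q \<in> O'\<rbrakk> \<Longrightarrow> f q \<in> W \<and> g (\<phi> q) = \<psi> (f q)"
proof -
  obtain c d where "c \<in> A" "d \<in> B" and cd: "p \<in> fst c" "f p \<in> fst d"
    "\<exists>O' g. open O' \<and> snd c p \<in> O' \<and> smooth_on g O' \<and>
      (\<forall>q\<in>S \<inter> fst c. snd c q \<in> O' \<longrightarrow> f q \<in> fst d \<and> g (snd c q) = snd d (f q))"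
    using bspec[OF assms(1)[unfolded smooth_map_on_def] assms(2)] by (auto simp: case_prod_beta) blast
  then show thesis
    using that[of "fst c" "snd c" "fst d" "snd d"] by auto
qed

text \<open>Near each point of \<open>S\<close> the map is a chart, followed by a continuous
  function \<open>g\<close> of the coordinates, followed by the inverse of a chart. An open set of
  the target is pulled back through these three maps.\<close>

lemma continuous_map_smooth_map_on:
  assumes M: "smooth_manifold M A" and S: "S \<subseteq> topspace M" and f: "smooth_map_on A A S f"
  shows "continuous_map (subtopology M S) M f"
  unfolding continuous_map_eq_topcontinuous_at
proof
  have range: "f p \<in> topspace M" if "p \<in> S" for p
    using smooth_map_onE[OF f that] smooth_manifold_chart[OF M] openin_subset
    by (metis (no_types, lifting) chart_def case_prodD subsetD)
  fix p assume "p \<in> topspace (subtopology M S)"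
  then have p: "p \<in> S"
    by simp
  obtain U \<phi> W \<psi> O' g where "(U, \<phi>) \<in> A" "(W, \<psi>) \<in> A" and pU: "p \<in> U" and fp: "f p \<in> W"
    and O': "open O'" "\<phi> p \<in> O'" and g: "smooth_on g O'"
    and eq: "\<And>q. \<lbrakk>q \<in> S; q \<in> U; \<phi> q \<in> O'\<rbrakk> \<Longrightarrow> f q \<in> W \<and> g (\<phi> q) = \<psi> (f q)"
    by (rule smooth_map_onE[OF f p]) blast
  then have U: "openin M U" "homeomorphic_map (subtopology M U) (top_of_set (\<phi> ` U)) \<phi>"
    and W: "openin M W" "homeomorphic_map (subtopology M W) (top_of_set (\<psi> ` W)) \<psi>"
    using smooth_manifold_chart[OF M] unfolding chart_def by fast+
  have cont_g: "continuous_on O' g"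
    using g by (simp add: smooth_on_def) (metis Ck_on.simps(1))
  have "\<exists>N. openin (subtopology M S) N \<and> p \<in> N \<and> (\<forall>q\<in>N. f q \<in> V)"
    if V: "openin M V" "f p \<in> V" for V
  proof -
    have inj: "inj_on \<psi> W" and "open_map (subtopology M W) (top_of_set (\<psi> ` W)) \<psi>"
      using W openin_subset[OF W(1)] by (auto simp: homeomorphic_eq_everything_map Int_absorb1)
    then have "openin (top_of_set (\<psi> ` W)) (\<psi> ` (V \<inter> W))"
      using V(1) W(1) by (simp add: open_map_def openin_subtopology_Int)
    \<comment> \<open>The chart image of \<open>V \<inter> W\<close> is open only relative to the
      image of \<open>W\<close>. The Euclidean open set \<open>Q\<close> that cuts it out has an
      open preimage under \<open>g\<close>.\<close>
    then obtain Q where Q: "open Q" "\<psi> ` (V \<inter> W) = \<psi> ` W \<inter> Q"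
      by (auto simp: openin_open)
    define O'' where "O'' = {x \<in> O'. g x \<in> Q}"
    have "open O''"
      using continuous_open_preimage[OF cont_g O'(1) Q(1)] by (simp add: O''_def vimage_def Int_def)
    \<comment> \<open>The coordinates are confined to \<open>O'\<close> as well, because
      \<open>g\<close> is tied to \<open>f\<close> only there.\<close>
    define N where "N = S \<inter> {q \<in> U. \<phi> q \<in> O''}"
    have "continuous_map (subtopology M U) euclidean \<phi>"
      using U(2) homeomorphic_imp_continuous_map continuous_map_in_subtopology by blast
    then have "openin (subtopology M U) {q \<in> U. \<phi> q \<in> O''}"
      using \<open>open O''\<close> openin_subset[OF U(1)] openin_continuous_map_preimage[of "subtopology M U" euclidean \<phi> O'']
      by (auto simp: Int_absorb1)
    then have "openin M {q \<in> U. \<phi> q \<in> O''}"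
      using U(1) openin_trans_full by blast
    then have "openin (subtopology M S) N"
      unfolding N_def by (rule openin_subtopology_Int2)
    moreover have "g (\<phi> p) \<in> Q"
      using eq[of p] p pU O'(2) Q(2) V(2) fp by auto
    then have "p \<in> N"
      using p pU O'(2) by (simp add: N_def O''_def)
    moreover have "f q \<in> V" if "q \<in> N" for q
    proof -
      have "f q \<in> W" "\<psi> (f q) \<in> Q"
        using that eq[of q] by (auto simp: N_def O''_def)
      then have "\<psi> (f q) \<in> \<psi> ` (V \<inter> W)"
        using Q(2) by auto
      then show ?thesis
        using inj \<open>f q \<in> W\<close> by (auto simp: inj_on_def)
    qed
    ultimately show ?thesis
      by blast
  qed
  then show "topcontinuous_at (subtopology M S) M f p"
    using p S range by (auto simp: topcontinuous_at_def)
qed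

text \<open>A smooth embedding has a smooth inverse on its image by definition, so the continuity
  lemma applies in both directions.\<close>

lemma homeomorphic_map_smooth_embedding:
  assumes M: "smooth_manifold M A" and S: "S \<subseteq> topspace M" "f ` S \<subseteq> topspace M"
    and f: "smooth_embedding A A S f"
  shows "homeomorphic_map (subtopology M S) (subtopology M (f ` S)) f"
proof -
  have inj: "inj_on f S"
    using f by (simp add: smooth_embedding_def)
  have "continuous_map (subtopology M S) M f" "continuous_map (subtopology M (f ` S)) M (inv_into S f)"
    using f S by (auto simp: smooth_embedding_def intro: continuous_map_smooth_map_on[OF M])
  then have "homeomorphic_maps (subtopology M S) (subtopology M (f ` S)) f (inv_into S f)"
    using inj S
    by (auto simp: homeomorphic_maps_def continuous_map_in_subtopology inv_into_into f_inv_into_f)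
  then show ?thesis
    by (auto simp: homeomorphic_map_maps)
qed

text \<open>A connected subset of \<open>S - C\<close> lies in a component of \<open>S\<close> other
  than \<open>C\<close>, and that component is contained in \<open>S - C\<close>; maximality
  identifies the two notions. This describes the surface left after a sphere is removed.\<close>

lemma components_of_Diff_component:
  assumes C: "C \<in> components_of M S"
  shows "components_of M (S - C) = components_of M S - {C}"
proof -
  note component = connectedin_component component_subset nonempty_component
  note exists = exists_component_superset and maximal = component_maximal
  note disjoint = components_disjoint
  show ?thesis
  proof (intro equalityI subsetI)
    fix D assume D: "D \<in> components_of M (S - C)"
    note D' = component[OF D]
    obtain E where E: "E \<in> components_of M S" "D \<subseteq> E"
      using exists[of M D S] D' by auto
    have "E \<noteq> C"
      using D' E(2) by blast
    then have "E \<subseteq> S - C"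
      using disjoint[OF E(1) C] component(2)[OF E(1)] by blast
    then have "E \<subseteq> D"
      using maximal[OF D] component(1)[OF E(1)] D'(3) E(2) by blast
    then show "D \<in> components_of M S - {C}"
      using E \<open>E \<noteq> C\<close> by auto
  next
    fix D assume D: "D \<in> components_of M S - {C}"
    then have "D \<subseteq> S - C"
      using disjoint[OF _ C] component(2)[of D M S] by blast
    then obtain E where E: "E \<in> components_of M (S - C)" "D \<subseteq> E"
      using exists[of M D "S - C"] component[of D M S] D by auto
    have "E \<subseteq> D"
      using maximal[of D M S E] component[OF E(1)] component(3)[of D M S] E(2) D by blast
    then show "D \<in> components_of M (S - C)"
      using E by auto
  qed
qed

section \<open>Finiteness of the set of boundary circles\<close>

text \<open>Near a point of a closed curve, a chart of the ambient manifold maps the curve onto an open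
  piece of a straight line, so that the components of the curve are open; compactness does the rest.\<close>

lemma openin_components_of_curve:
  assumes curve: "closed_curve_in_boundary M A \<alpha>" and C: "C \<in> components_of M \<alpha>"
  shows "openin (subtopology M \<alpha>) C"
proof (subst openin_subopen, intro ballI)
  fix p assume pC: "p \<in> C"
  then have p: "p \<in> \<alpha>"
    using C connected_components_of_subset by (fastforce simp: components_of_def)
  obtain U \<phi> where "(U, \<phi>) \<in> max_atlas M A" and pU: "p \<in> U"
    and \<alpha>U: "\<alpha> \<inter> U = {q \<in> U. \<phi> q $ 1 = 0 \<and> \<phi> q $ 3 = 0}"
    using curve p unfolding closed_curve_in_boundary_def by blast
  then have U: "openin M U" "openin (top_of_set half_space) (\<phi> ` U)"
    "homeomorphic_map (subtopology M U) (top_of_set (\<phi> ` U)) \<phi>"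
    by (auto simp: max_atlas_def chart_def)
  obtain g where g: "homeomorphic_maps (subtopology M U) (top_of_set (\<phi> ` U)) \<phi> g"
    using U(3) homeomorphic_map_maps by blast
  obtain Q where Q: "open Q" "\<phi> ` U = half_space \<inter> Q"
    using U(2) by (auto simp: openin_open)
  obtain e where e: "0 < e" "ball (\<phi> p) e \<subseteq> Q"
    using Q pU open_contains_ball[of Q] by blast
  \<comment> \<open>The piece of the coordinate line inside a ball around the image of
    \<open>p\<close>; it is convex, hence connected.\<close>
  define K where "K = ball (\<phi> p) e \<inter> {x :: real^3. x $ 1 = 0} \<inter> {x. x $ 3 = 0}"
  have "convex {x :: real^3. x $ i = 0}" for i
    by (auto simp: convex_def)
  then have "connected K"
    unfolding K_def by (intro convex_connected convex_Int convex_ball)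
  \<comment> \<open>The first coordinate vanishes on \<open>K\<close>, so \<open>K\<close> lies in
    the half space, and the ball was chosen inside \<open>Q\<close>.\<close>
  moreover have K: "K \<subseteq> \<phi> ` U"
    using e(2) by (auto simp: K_def Q(2) half_space_def)
  ultimately have "connectedin (top_of_set (\<phi> ` U)) K"
    by (simp add: connectedin_subtopology)
  then have "connectedin (subtopology M U) (g ` K)"
    using g connectedin_continuous_map_image unfolding homeomorphic_maps_def by blast
  then have conn: "connectedin M (g ` K)"
    by (simp add: connectedin_subtopology)
  have UM: "U \<subseteq> topspace M"
    using U(1) by (rule openin_subset)
  have g\<phi>: "g (\<phi> q) = q" if "q \<in> U" for q
    using g that UM by (auto simp: homeomorphic_maps_def)
  \<comment> \<open>The same set is seen in two ways: as the image of \<open>K\<close> it is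
    connected, as the trace on \<alpha> of an open set of \<open>M\<close> it is a neighbourhood of
    \<open>p\<close> in the curve.\<close>
  have gK: "g ` K = \<alpha> \<inter> {q \<in> U. \<phi> q \<in> ball (\<phi> p) e}"
  proof (intro equalityI subsetI)
    fix q assume "q \<in> g ` K"
    then obtain x where x: "x \<in> K" "q = g x"
      by blast
    then obtain q' where q': "q' \<in> U" "x = \<phi> q'"
      using K by blast
    then have "q = q'"
      using x g\<phi> by simp
    then have "q \<in> \<alpha> \<inter> U"
      unfolding \<alpha>U using x(1) q' by (simp add: K_def)
    then show "q \<in> \<alpha> \<inter> {q \<in> U. \<phi> q \<in> ball (\<phi> p) e}"
      using x(1) q' \<open>q = q'\<close> by (simp add: K_def)
  next
    fix q assume q: "q \<in> \<alpha> \<inter> {q \<in> U. \<phi> q \<in> ball (\<phi> p) e}"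
    then have "q \<in> {q \<in> U. \<phi> q $ 1 = 0 \<and> \<phi> q $ 3 = 0}"
      using \<alpha>U by blast
    then have "\<phi> q \<in> K"
      using q by (simp add: K_def)
    then show "q \<in> g ` K"
      using g\<phi>[of q] q by force
  qed
  have "continuous_map (subtopology M U) euclidean \<phi>"
    using g unfolding homeomorphic_maps_def continuous_map_in_subtopology by blast
  then have "openin (subtopology M U) {q \<in> U. \<phi> q \<in> ball (\<phi> p) e}"
    using UM openin_continuous_map_preimage[of "subtopology M U" euclidean \<phi> "ball (\<phi> p) e"]
    by (auto simp: Int_absorb1)
  then have "openin M {q \<in> U. \<phi> q \<in> ball (\<phi> p) e}"
    using U(1) openin_trans_full by blast
  then have "openin (subtopology M \<alpha>) (g ` K)"
    unfolding gK by (rule openin_subtopology_Int2)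
  moreover have pK: "p \<in> g ` K"
    using p pU e(1) by (simp add: gK)
  moreover have "g ` K \<subseteq> C"
    by (rule component_maximal[OF C conn]) (use pC pK in \<open>auto simp: gK\<close>)
  ultimately show "\<exists>T. openin (subtopology M \<alpha>) T \<and> p \<in> T \<and> T \<subseteq> C"
    by blast
qed

text \<open>The components form an open cover by disjoint nonempty sets. None of them can be
  omitted, so a finite subcover contains them all.\<close>

lemma finite_components_of_curve:
  assumes curve: "closed_curve_in_boundary M A \<alpha>"
  shows "finite (components_of M \<alpha>)"
proof -
  let ?X = "subtopology M \<alpha>"
  have compact: "compact_space ?X"
    using curve by (simp add: closed_curve_in_boundary_def compact_space_subtopology)
  have union: "\<Union>(components_of M \<alpha>) = topspace ?X"
    by (simp add: components_of_def Union_connected_components_of)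
  have "(\<forall>C\<in>components_of M \<alpha>. openin ?X C) \<and> topspace ?X \<subseteq> \<Union>(components_of M \<alpha>)"
    using openin_components_of_curve[OF curve] by (simp add: union)
  from mp[OF spec[OF compact[unfolded compact_space_alt], of "components_of M \<alpha>"] this]
  obtain F where F: "finite F" "F \<subseteq> components_of M \<alpha>" "topspace ?X \<subseteq> \<Union>F"
    by (elim exE conjE)
  have "components_of M \<alpha> \<subseteq> F"
  proof
    fix C assume C: "C \<in> components_of M \<alpha>"
    then obtain x where x: "x \<in> C"
      using nonempty_component by blast
    then obtain D where "D \<in> F" "x \<in> D"
      using C F(3) union by blast
    then show "C \<in> F"
      using components_disjoint[of C M \<alpha> D] C F(2) x by auto
  qed
  then show ?thesis
    using F(1) finite_subset by blast
qed

text \<open>Together with the next lemma this assigns to every circle exactly one component of a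
  surface that contains the curve.\<close>

lemma circle_in_component:
  assumes a: "a \<in> components_of M \<alpha>" and S: "\<alpha> \<subseteq> S"
  shows "\<exists>C\<in>components_of M S. a \<subseteq> C"
  using component_subset[OF a] S connectedin_component[OF a] nonempty_component[OF a]
  by (intro exists_component_superset) auto

lemma circle_component_unique:
  assumes "a \<in> components_of M \<alpha>" and "C \<in> components_of M S" "a \<subseteq> C" and "D \<in> components_of M S" "a \<subseteq> D"
  shows "C = D"
  using components_disjoint[OF assms(2,4)] nonempty_component[OF assms(1)] assms(3,5) by blast

section \<open>Multiplication in a Frobenius algebra\<close>

context frobenius_algebra
begin

abbreviation (input) "VV \<equiv> free_module R (carrier V \<times> carrier V)"

lemma tensor_rels_subset: "tensor_rels R V V \<subseteq> carrier VV"
proof -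
  interpret F: module R VV
    by (rule R.module_free_module)
  show ?thesis
    unfolding tensor_rels_def Let_def by (auto simp: R.single_closed)
qed

text \<open>Linearity of \<open>f\<close> and \<open>g\<close> turns a relator into the relator of
  the same kind between the images. This is what makes \<open>tensor_map\<close> well
  defined.\<close>

lemma tensor_rels_map:
  assumes f: "f \<in> linear_maps R V V" and g: "g \<in> linear_maps R V V" and p: "p \<in> tensor_rels R V V"
  shows "lin_comb R VV (\<lambda>(a, b). single R (f a, g b)) p \<in> tensor_rels R V V"
proof -
  let ?h = "\<lambda>(a, b). single R (f a, g b)"
  have h: "?h \<in> carrier V \<times> carrier V \<rightarrow> carrier VV"
    by (auto simp: R.single_closed linear_mapsD(1)[OF f] linear_mapsD(1)[OF g])
  interpret F: module R VV
    by (rule R.module_free_module)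
  note lin = R.lin_comb_linear[OF F.module_axioms h] and single = R.lin_comb_single[OF F.module_axioms h]
  note simps = linear_maps_minus[OF F.module_axioms F.module_axioms lin] linear_mapsD(2,3)[OF lin] single
    R.single_closed linear_mapsD[OF f] linear_mapsD[OF g]
  from p consider
      (add_left) x x' y where "x \<in> carrier V" "x' \<in> carrier V" "y \<in> carrier V"
        "p = single R (x \<oplus>\<^bsub>V\<^esub> x', y) \<ominus>\<^bsub>VV\<^esub> (single R (x, y) \<oplus>\<^bsub>VV\<^esub> single R (x', y))"
    | (add_right) x y y' where "x \<in> carrier V" "y \<in> carrier V" "y' \<in> carrier V"
        "p = single R (x, y \<oplus>\<^bsub>V\<^esub> y') \<ominus>\<^bsub>VV\<^esub> (single R (x, y) \<oplus>\<^bsub>VV\<^esub> single R (x, y'))"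
    | (smult_left) r x y where "r \<in> carrier R" "x \<in> carrier V" "y \<in> carrier V"
        "p = single R (r \<odot>\<^bsub>V\<^esub> x, y) \<ominus>\<^bsub>VV\<^esub> r \<odot>\<^bsub>VV\<^esub> single R (x, y)"
    | (smult_right) r x y where "r \<in> carrier R" "x \<in> carrier V" "y \<in> carrier V"
        "p = single R (x, r \<odot>\<^bsub>V\<^esub> y) \<ominus>\<^bsub>VV\<^esub> r \<odot>\<^bsub>VV\<^esub> single R (x, y)"
    by (auto simp: tensor_rels_def Let_def)
  then show ?thesis
  proof cases
    case add_left
    then have "lin_comb R VV ?h p = single R (f x \<oplus>\<^bsub>V\<^esub> f x', g y) \<ominus>\<^bsub>VV\<^esub>
        (single R (f x, g y) \<oplus>\<^bsub>VV\<^esub> single R (f x', g y))"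
      by (simp add: simps)
    then show ?thesis
      unfolding tensor_rels_def Let_def using add_left linear_mapsD(1)[OF f] linear_mapsD(1)[OF g] by blast
  next
    case add_right
    then have "lin_comb R VV ?h p = single R (f x, g y \<oplus>\<^bsub>V\<^esub> g y') \<ominus>\<^bsub>VV\<^esub>
        (single R (f x, g y) \<oplus>\<^bsub>VV\<^esub> single R (f x, g y'))"
      by (simp add: simps)
    then show ?thesis
      unfolding tensor_rels_def Let_def using add_right linear_mapsD(1)[OF f] linear_mapsD(1)[OF g] by blast
  next
    case smult_left
    then have "lin_comb R VV ?h p = single R (r \<odot>\<^bsub>V\<^esub> f x, g y) \<ominus>\<^bsub>VV\<^esub> r \<odot>\<^bsub>VV\<^esub> single R (f x, g y)"
      by (simp add: simps)
    then show ?thesis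
      unfolding tensor_rels_def Let_def using smult_left linear_mapsD(1)[OF f] linear_mapsD(1)[OF g] by blast
  next
    case smult_right
    then have "lin_comb R VV ?h p = single R (f x, r \<odot>\<^bsub>V\<^esub> g y) \<ominus>\<^bsub>VV\<^esub> r \<odot>\<^bsub>VV\<^esub> single R (f x, g y)"
      by (simp add: simps)
    then show ?thesis
      unfolding tensor_rels_def Let_def using smult_right linear_mapsD(1)[OF f] linear_mapsD(1)[OF g] by blast
  qed
qed

text \<open>Neck-cutting relators refer to a chosen representative of a tensor, so the map has to be
  described on representatives and not only on elements of the tensor product.\<close>

lemma tensor_map_residue:
  assumes f: "f \<in> linear_maps R V V" and g: "g \<in> linear_maps R V V" and p: "p \<in> carrier VV"
  shows "tensor_map R V V f g (residue R (carrier V \<times> carrier V) (tensor_rels R V V) p) =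
    residue R (carrier V \<times> carrier V) (tensor_rels R V V)
      (lin_comb R VV (\<lambda>(a, b). single R (f a, g b)) p)"
proof -
  let ?h = "\<lambda>(a, b). single R (f a, g b)" and ?r = "residue R (carrier V \<times> carrier V) (tensor_rels R V V)"
  have h: "?h \<in> carrier V \<times> carrier V \<rightarrow> carrier VV"
    by (auto simp: R.single_closed linear_mapsD(1)[OF f] linear_mapsD(1)[OF g])
  note T = R.module_presented_module[OF tensor_rels_subset]
  have tens: "(\<lambda>(x, y). tens R V V (f x) (g y)) = (\<lambda>b. ?r (?h b))"
    by (auto simp: tens_def generator_eq_residue)
  have lin: "lin_comb R (tensor R V V) (\<lambda>b. ?r (?h b)) p = ?r (lin_comb R VV ?h p)"
    if "p \<in> carrier VV" for p
    unfolding tensor_def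
    by (rule R.linear_maps_lin_comb[OF R.module_free_module T R.residue_linear[OF tensor_rels_subset] h that, symmetric])
  have "lin_ext R (tensor R V V) (\<lambda>b. ?r (?h b)) (?r p) = lin_comb R (tensor R V V) (\<lambda>b. ?r (?h b)) p"
  proof (rule R.lin_ext_residue[OF tensor_rels_subset _ _ _ p])
    show "module R (tensor R V V)"
      using T by (simp add: tensor_def)
    show "(\<lambda>b. ?r (?h b)) \<in> carrier V \<times> carrier V \<rightarrow> carrier (tensor R V V)"
      using h by (auto simp: tensor_def Pi_iff R.single_closed linear_mapsD(1)[OF f] linear_mapsD(1)[OF g]
          intro!: R.residue_closed[OF tensor_rels_subset])
    show "lin_comb R (tensor R V V) (\<lambda>b. ?r (?h b)) q = \<zero>\<^bsub>tensor R V V\<^esub>" if "q \<in> tensor_rels R V V" for q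
      using that tensor_rels_subset tensor_rels_map[OF f g that] R.residue_rels[OF tensor_rels_subset]
      by (subst lin) (auto simp: tensor_def)
  qed
  then show ?thesis
    by (simp add: tensor_map_def tens lin[OF p])
qed

lemma comult_element:
  assumes x: "x \<in> carrier V" and p: "p \<in> \<Delta> x"
  shows "p \<in> carrier VV" and "\<Delta> x = residue R (carrier V \<times> carrier V) (tensor_rels R V V) p"
  using R.presented_module_element[OF tensor_rels_subset _ p] comult_closed[OF x]
  by (simp_all add: tensor_def)

text \<open>Both sides of the bimodule property are used: \<open>u\<close> acts on the left tensor factor and \<open>w\<close> on
  the right one.\<close>

lemma comult_mult_element:
  assumes u: "u \<in> carrier V" and w: "w \<in> carrier V" and x: "x \<in> carrier V" and p: "p \<in> \<Delta> x"
  shows "lin_comb R VV (\<lambda>(a, b). single R (u \<otimes>\<^bsub>V\<^esub> a, w \<otimes>\<^bsub>V\<^esub> b)) p \<in> \<Delta> ((u \<otimes>\<^bsub>V\<^esub> w) \<otimes>\<^bsub>V\<^esub> x)"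
proof -
  let ?r = "residue R (carrier V \<times> carrier V) (tensor_rels R V V)"
  let ?L = "\<lambda>(a, b). single R (u \<otimes>\<^bsub>V\<^esub> a, b)" and ?R = "\<lambda>(a, b). single R (a, b \<otimes>\<^bsub>V\<^esub> w)"
    and ?h = "\<lambda>(a, b). single R (u \<otimes>\<^bsub>V\<^esub> a, w \<otimes>\<^bsub>V\<^esub> b)"
  have id: "(\<lambda>a. a) \<in> linear_maps R V V"
    by (rule linear_mapsI) simp_all
  have left: "(\<lambda>a. u \<otimes>\<^bsub>V\<^esub> a) \<in> linear_maps R V V"
    using u by (intro linear_mapsI) (simp_all add: r_distr mult_smult)
  have right: "(\<lambda>b. b \<otimes>\<^bsub>V\<^esub> w) \<in> linear_maps R V V"
    using w by (intro linear_mapsI) (simp_all add: l_distr smult_assoc2)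
  have h: "?L \<in> carrier V \<times> carrier V \<rightarrow> carrier VV" "?R \<in> carrier V \<times> carrier V \<rightarrow> carrier VV"
    using u w by (auto simp: R.single_closed)
  note lin = R.lin_comb_linear[OF R.module_free_module h(1)] R.lin_comb_linear[OF R.module_free_module h(2)]
  note pc = comult_element(1)[OF x p]
  have "lin_comb R VV ?L (lin_comb R VV ?R p) = lin_comb R VV (\<lambda>b. lin_comb R VV ?L (?R b)) p"
    by (rule R.linear_maps_lin_comb[OF R.module_free_module R.module_free_module lin(1) h(2) pc])
  \<comment> \<open>On a basis pair \<open>(a, b)\<close> the two steps multiply \<open>a\<close> by
    \<open>u\<close> and \<open>b\<close> by \<open>w\<close>; commutativity puts \<open>w\<close>
    to the left of \<open>b\<close>.\<close>
  also have "\<dots> = lin_comb R VV ?h p"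
    using u w h linear_mapsD(1)[OF lin(1)]
    by (intro R.lin_comb_cong[OF R.module_free_module _ _ pc])
      (auto simp: R.lin_comb_single[OF R.module_free_module h(1)] m_comm R.single_closed)
  finally have "?r (lin_comb R VV ?h p) = tensor_map R V V (\<lambda>a. u \<otimes>\<^bsub>V\<^esub> a) (\<lambda>b. b) (?r (lin_comb R VV ?R p))"
    using linear_mapsD(1)[OF lin(2) pc] by (simp add: tensor_map_residue[OF left id])
  also have "?r (lin_comb R VV ?R p) = \<Delta> (x \<otimes>\<^bsub>V\<^esub> w)"
    using comult_element(2)[OF x p] comult_right[OF x w] by (simp add: tensor_map_residue[OF id right pc])
  also have "tensor_map R V V (\<lambda>a. u \<otimes>\<^bsub>V\<^esub> a) (\<lambda>b. b) (\<Delta> (x \<otimes>\<^bsub>V\<^esub> w)) = \<Delta> (u \<otimes>\<^bsub>V\<^esub> (x \<otimes>\<^bsub>V\<^esub> w))"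
    using comult_left u x w by simp
  also have "u \<otimes>\<^bsub>V\<^esub> (x \<otimes>\<^bsub>V\<^esub> w) = (u \<otimes>\<^bsub>V\<^esub> w) \<otimes>\<^bsub>V\<^esub> x"
    using u x w by (simp add: m_assoc m_comm m_lcomm)
  finally have eq: "?r (lin_comb R VV ?h p) = \<Delta> ((u \<otimes>\<^bsub>V\<^esub> w) \<otimes>\<^bsub>V\<^esub> x)" .
  have "?h \<in> carrier V \<times> carrier V \<rightarrow> carrier VV"
    using u w by (auto simp: R.single_closed)
  then have "lin_comb R VV ?h p \<in> carrier VV"
    using linear_mapsD(1)[OF R.lin_comb_linear[OF R.module_free_module]] pc by blast
  then show ?thesis
    using R.residue_self[OF tensor_rels_subset] eq by blast
qed

text \<open>Whichever representative of \<open>\<Delta> \<one>\<close> is selected by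
  \<open>lin_ext\<close>, it lies in the free module, so the value lies in the algebra.\<close>

lemma handle_one_closed: "lin_ext R V (\<lambda>(a, b). a \<otimes>\<^bsub>V\<^esub> b) (\<Delta> \<one>\<^bsub>V\<^esub>) \<in> carrier V"
proof -
  have h: "(\<lambda>(a, b). a \<otimes>\<^bsub>V\<^esub> b) \<in> carrier V \<times> carrier V \<rightarrow> carrier V"
    by auto
  have "\<exists>p. p \<in> \<Delta> \<one>\<^bsub>V\<^esub>"
    using comult_closed[OF one_closed] R.residue_self[OF tensor_rels_subset]
    by (auto simp: tensor_def R.presented_module_carrier[OF tensor_rels_subset])
  then have "(SOME p. p \<in> \<Delta> \<one>\<^bsub>V\<^esub>) \<in> carrier VV"
    using comult_element(1)[OF one_closed] someI_ex by metis
  then show ?thesis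
    unfolding lin_ext_def by (rule linear_mapsD(1)[OF R.lin_comb_linear[OF module h]])
qed

lemma handle_closed: "x \<in> carrier V \<Longrightarrow> handle R V \<Delta> x \<in> carrier V"
  by (simp add: handle_def handle_one_closed)

lemma handle_mult:
  "\<lbrakk>u \<in> carrier V; x \<in> carrier V\<rbrakk> \<Longrightarrow> handle R V \<Delta> (u \<otimes>\<^bsub>V\<^esub> x) = u \<otimes>\<^bsub>V\<^esub> handle R V \<Delta> x"
  unfolding handle_def using handle_one_closed by (simp add: m_lcomm)

end

section \<open>Multiplying boundary colors\<close>

locale bar_natan = frobenius_algebra R V \<Delta> \<epsilon>
  for R :: "('r, 'k) ring_scheme" (structure) and V :: "('r, 'v, 'l) module_scheme" (structure)
    and \<Delta> :: "'v \<Rightarrow> ('v \<times> 'v \<Rightarrow> 'r) set" and \<epsilon> :: "'v \<Rightarrow> 'r" +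
  fixes M :: "'m topology" and A :: "('m, real^3) coord set" and \<alpha> :: "'m set"
  assumes manifold: "smooth_manifold M A" and curve: "closed_curve_in_boundary M A \<alpha>"
begin

definition boundary_circles :: "'m set \<Rightarrow> 'm set set" where
  "boundary_circles C = {a \<in> components_of M \<alpha>. a \<subseteq> C}"

definition boundary_color :: "('m set \<Rightarrow> 'v) \<Rightarrow> 'm set \<Rightarrow> 'v" where
  "boundary_color v C = (\<Otimes>\<^bsub>V\<^esub>a\<in>boundary_circles C. v a)"

abbreviation (input) "surfaces \<equiv> colored_surfaces M A \<alpha> V"
abbreviation (input) "circle_colors \<equiv> families V (components_of M \<alpha>)"
abbreviation (input) "mc v S c \<equiv> multiply_colors M \<alpha> V v S c"

lemma multiply_colors_eq:
  "mc v S c = (\<lambda>C\<in>components_of M S. boundary_color v C \<otimes>\<^bsub>V\<^esub> c C)"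
  by (simp add: multiply_colors_def boundary_color_def boundary_circles_def)

lemma finite_boundary_circles: "finite (boundary_circles C)"
  unfolding boundary_circles_def using finite_components_of_curve[OF curve] by simp

lemma boundary_color_closed: "v \<in> circle_colors \<Longrightarrow> boundary_color v C \<in> carrier V"
  unfolding boundary_color_def by (rule finprod_closed) (auto simp: boundary_circles_def families_def)

lemma surfacesD:
  assumes "(S, c) \<in> surfaces"
  shows "surface_bounding M A \<alpha> S" "S \<subseteq> topspace M" "\<alpha> \<subseteq> S"
    and "c \<in> extensional (components_of M S)" "C \<in> components_of M S \<Longrightarrow> c C \<in> carrier V"
  using assms by (auto simp: colored_surfaces_def surface_bounding_def PiE_iff dest: compactin_subset_topspace)

lemma surfacesI:
  assumes "surface_bounding M A \<alpha> S" and "c \<in> extensional (components_of M S)"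
    and "\<And>C. C \<in> components_of M S \<Longrightarrow> c C \<in> carrier V"
  shows "(S, c) \<in> surfaces"
  using assms by (auto simp: colored_surfaces_def PiE_iff)

lemma multiply_colors_closed:
  assumes "v \<in> circle_colors" and "(S, c) \<in> surfaces"
  shows "(S, mc v S c) \<in> surfaces"
  using assms surfacesD[OF assms(2)]
  by (intro surfacesI) (auto simp: multiply_colors_eq boundary_color_closed)

lemma multiply_colors_one:
  assumes "(S, c) \<in> surfaces"
  shows "mc (\<lambda>a\<in>components_of M \<alpha>. \<one>\<^bsub>V\<^esub>) S c = c"
proof -
  have "boundary_color (\<lambda>a\<in>components_of M \<alpha>. \<one>\<^bsub>V\<^esub>) C = \<one>\<^bsub>V\<^esub>" for C
    unfolding boundary_color_def by (rule finprod_one_eqI) (simp add: boundary_circles_def)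
  then show ?thesis
    using surfacesD(4,5)[OF assms] by (auto simp: multiply_colors_eq extensional_def fun_eq_iff)
qed

lemma multiply_colors_mult:
  assumes u: "u \<in> circle_colors" and v: "v \<in> circle_colors" and c: "(S, c) \<in> surfaces"
  shows "mc (\<lambda>a\<in>components_of M \<alpha>. u a \<otimes>\<^bsub>V\<^esub> v a) S c = mc u S (mc v S c)"
proof -
  have "boundary_color (\<lambda>a\<in>components_of M \<alpha>. u a \<otimes>\<^bsub>V\<^esub> v a) C = boundary_color u C \<otimes>\<^bsub>V\<^esub> boundary_color v C" for C
  proof -
    have "boundary_color (\<lambda>a\<in>components_of M \<alpha>. u a \<otimes>\<^bsub>V\<^esub> v a) C = (\<Otimes>\<^bsub>V\<^esub>a\<in>boundary_circles C. u a \<otimes>\<^bsub>V\<^esub> v a)"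
      unfolding boundary_color_def using u v
      by (intro finprod_cong') (auto simp: boundary_circles_def families_def)
    also have "\<dots> = boundary_color u C \<otimes>\<^bsub>V\<^esub> boundary_color v C"
      unfolding boundary_color_def using u v
      by (intro finprod_multf) (auto simp: boundary_circles_def families_def)
    finally show ?thesis .
  qed
  then show ?thesis
    using surfacesD(5)[OF c] u v
    by (auto simp: multiply_colors_eq fun_eq_iff boundary_color_closed m_assoc)
qed

lemma multiply_colors_upd_color:
  assumes "C \<in> components_of M S"
  shows "mc v S (c(C := x)) = (mc v S c)(C := boundary_color v C \<otimes>\<^bsub>V\<^esub> x)"
  using assms by (auto simp: multiply_colors_eq fun_eq_iff)

text \<open>A circle lies on exactly one component, so its color only affects the color of that component.\<close>

lemma multiply_colors_upd_circle:
  assumes v: "v \<in> circle_colors" and a: "a \<in> components_of M \<alpha>" and c: "(S, c) \<in> surfaces"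
    and C: "C \<in> components_of M S" "a \<subseteq> C" and x: "x \<in> carrier V"
  shows "mc (v(a := x)) S c =
    (mc (v(a := \<one>\<^bsub>V\<^esub>)) S c)(C := x \<otimes>\<^bsub>V\<^esub> mc (v(a := \<one>\<^bsub>V\<^esub>)) S c C)"
proof -
  have vc: "v b \<in> carrier V" if "b \<in> boundary_circles D" for b D
    using v that by (auto simp: boundary_circles_def families_def)
  have "boundary_color (v(a := x)) D = boundary_color (v(a := \<one>\<^bsub>V\<^esub>)) D"
    if "D \<in> components_of M S" "D \<noteq> C" for D
  proof -
    have "a \<notin> boundary_circles D"
      using circle_component_unique[OF a C] that by (auto simp: boundary_circles_def)
    then show ?thesis
      unfolding boundary_color_def using vc by (intro finprod_cong') (auto simp: Pi_iff)
  qed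
  moreover have "boundary_color (v(a := x)) C = x \<otimes>\<^bsub>V\<^esub> boundary_color (v(a := \<one>\<^bsub>V\<^esub>)) C"
  proof -
    let ?B = "boundary_circles C - {a}"
    have B: "boundary_circles C = insert a ?B"
      using a C(2) by (auto simp: boundary_circles_def)
    have fin: "finite ?B"
      using finite_boundary_circles by simp
    have rest: "(\<Otimes>\<^bsub>V\<^esub>b\<in>?B. (v(a := y)) b) = (\<Otimes>\<^bsub>V\<^esub>b\<in>?B. v b)" for y
      using vc by (intro finprod_cong') auto
    \<comment> \<open>This is used for \<open>y = x\<close> and for \<open>y = \<one>\<close>.
      Resetting the color of \<open>a\<close> to the unit isolates \<open>x\<close> as a factor,
      independently of the old value \<open>v a\<close>.\<close>
    have "boundary_color (v(a := y)) C = y \<otimes>\<^bsub>V\<^esub> (\<Otimes>\<^bsub>V\<^esub>b\<in>?B. v b)" if "y \<in> carrier V" for y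
    proof -
      have "(\<Otimes>\<^bsub>V\<^esub>b\<in>insert a ?B. (v(a := y)) b) = (v(a := y)) a \<otimes>\<^bsub>V\<^esub> (\<Otimes>\<^bsub>V\<^esub>b\<in>?B. (v(a := y)) b)"
        by (rule finprod_insert[OF fin]) (use vc[of _ C] that in auto)
      then show ?thesis
        unfolding boundary_color_def B[symmetric] rest by (simp only: fun_upd_same)
    qed
    moreover have "(\<Otimes>\<^bsub>V\<^esub>b\<in>?B. v b) \<in> carrier V"
      using vc by (intro finprod_closed) auto
    ultimately show ?thesis
      using x by simp
  qed
  ultimately show ?thesis
    using x C(1) surfacesD(5)[OF c] v a
    by (auto simp: multiply_colors_eq fun_eq_iff m_assoc boundary_color_closed families_upd)
qed

text \<open>The final map of the isotopy is a homeomorphism between the surfaces and so matches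
  their components. It fixes \<alpha> pointwise and is injective, so a point of \<alpha> lies in the
  image of \<open>C\<close> only if it already lies in \<open>C\<close>.\<close>

lemma components_image_isotopy:
  assumes S: "surface_bounding M A \<alpha> S" and H: "isotopy_rel M A \<alpha> S S' H"
  shows "components_of M S' = (`) (\<lambda>p. H (1, p)) ` components_of M S"
    and "C \<in> components_of M S \<Longrightarrow> boundary_circles ((\<lambda>p. H (1, p)) ` C) = boundary_circles C"
    and "inj_on (\<lambda>p. H (1, p)) S"
proof -
  let ?f = "\<lambda>p. H (1, p)"
  have f: "smooth_embedding A A S ?f" "?f ` S = S'" "surface_bounding M A \<alpha> S'"
    and fix_\<alpha>: "\<And>p. p \<in> \<alpha> \<Longrightarrow> ?f p = p"
    using H unfolding isotopy_rel_def by force+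
  have sub: "S \<subseteq> topspace M" "?f ` S \<subseteq> topspace M" "\<alpha> \<subseteq> S"
    using S f(2,3) compactin_subset_topspace by (auto simp: surface_bounding_def)
  have "homeomorphic_map (subtopology M S) (subtopology M S') ?f"
    using homeomorphic_map_smooth_embedding[OF manifold sub(1,2) f(1)] f(2) by simp
  then show "components_of M S' = (`) ?f ` components_of M S"
    unfolding components_of_def by (rule homeomorphic_map_connected_components_of)
  show inj: "inj_on ?f S"
    using f(1) by (simp add: smooth_embedding_def)
  show "boundary_circles (?f ` C) = boundary_circles C" if C: "C \<in> components_of M S"
  proof -
    have "a \<subseteq> ?f ` C \<longleftrightarrow> a \<subseteq> C" if a: "a \<in> components_of M \<alpha>" for a
    proof -
      have "x \<in> ?f ` C \<longleftrightarrow> x \<in> C" if "x \<in> a" for x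
      proof -
        have "x \<in> \<alpha>"
          using that component_subset[OF a] by blast
        then have "x \<in> ?f ` C \<longleftrightarrow> ?f x \<in> ?f ` C" and "x \<in> S"
          using fix_\<alpha> sub(3) by auto
        then show ?thesis
          using inj_on_image_mem_iff[OF inj, of x C] component_subset[OF C] by blast
      qed
      then show ?thesis
        by blast
    qed
    then show ?thesis
      by (auto simp: boundary_circles_def)
  qed
qed

section \<open>Passing to isotopy classes\<close>

abbreviation (input) "iso_class x \<equiv> isotopic M A \<alpha> V `` {x}"

text \<open>The isotopy relation need not be known to be an equivalence relation: an isotopy from \<open>S\<close> to
  \<open>S''\<close> carries any coloring of \<open>S\<close> to a coloring of \<open>S''\<close>, which then is an element of the common class.\<close>

lemma multiply_colors_class_subset:
  assumes v: "v \<in> circle_colors" and c: "(S, c) \<in> surfaces"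
    and eq: "iso_class (S, c) = iso_class (S', c')"
  shows "iso_class (S, mc v S c) \<subseteq> iso_class (S', mc v S' c')"
proof (rule subsetI)
  fix z assume z: "z \<in> iso_class (S, mc v S c)"
  obtain S'' d where zd: "z = (S'', d)"
    by (cases z)
  then obtain H where d: "(S'', d) \<in> surfaces" and H: "isotopy_rel M A \<alpha> S S'' H"
    and d_eq: "\<And>C. C \<in> components_of M S \<Longrightarrow> d ((\<lambda>p. H (1, p)) ` C) = mc v S c C"
    using z by (auto simp: isotopic_def)
  let ?f = "\<lambda>p. H (1, p)"
  note f = components_image_isotopy[OF surfacesD(1)[OF c] H]
  \<comment> \<open>The coloring \<open>c\<close> transported to \<open>S''\<close>. Preimages are
    cut down to \<open>S\<close>, since the isotopy is controlled only there.\<close>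
  define e where "e = (\<lambda>D\<in>components_of M S''. c (S \<inter> ?f -` D))"
  have preimage: "S \<inter> ?f -` (?f ` C) = C" if "C \<in> components_of M S" for C
    using f(3) component_subset[OF that] by (auto simp: inj_on_def)
  have e_eq: "e (?f ` C) = c C" if "C \<in> components_of M S" for C
    using that preimage[OF that] by (simp add: e_def f(1))
  have e: "(S'', e) \<in> surfaces"
    using surfacesD(1)[OF d] surfacesD(5)[OF c] e_eq f(1) by (intro surfacesI) (auto simp: e_def)
  then have "(S'', e) \<in> iso_class (S, c)"
    using c H e_eq by (auto simp: isotopic_def)
  then have "(S'', e) \<in> iso_class (S', c')"
    by (simp add: eq)
  then obtain H' where c': "(S', c') \<in> surfaces" and H': "isotopy_rel M A \<alpha> S' S'' H'"
    and e_eq': "\<And>C. C \<in> components_of M S' \<Longrightarrow> e ((\<lambda>p. H' (1, p)) ` C) = c' C"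
    by (auto simp: isotopic_def)
  note f' = components_image_isotopy[OF surfacesD(1)[OF c'] H']
  \<comment> \<open>The factor between \<open>d\<close> and \<open>e\<close> depends only on the
    circles of \<open>D\<close>, a datum of \<open>S''\<close>. The isotopy \<open>H\<close> has
    disappeared from this relation, so it can be read off again along \<open>H'\<close>.\<close>
  have d_e: "d D = boundary_color v D \<otimes>\<^bsub>V\<^esub> e D" if "D \<in> components_of M S''" for D
  proof -
    obtain C where C: "C \<in> components_of M S" "D = ?f ` C"
      using \<open>D \<in> components_of M S''\<close> unfolding f(1) by blast
    then show ?thesis
      using d_eq[OF C(1)] e_eq[OF C(1)] f(2)[OF C(1)] by (simp add: multiply_colors_eq boundary_color_def)
  qed
  have "d ((\<lambda>p. H' (1, p)) ` C) = mc v S' c' C" if C: "C \<in> components_of M S'" for C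
    using d_e[of "(\<lambda>p. H' (1, p)) ` C"] C e_eq'[OF C] f'(2)[OF C]
    by (simp add: f'(1) multiply_colors_eq boundary_color_def)
  then show "z \<in> iso_class (S', mc v S' c')"
    using zd d H' multiply_colors_closed[OF v c'] by (auto simp: isotopic_def)
qed

lemma multiply_colors_class_eq:
  assumes "v \<in> circle_colors" and "(S, c) \<in> surfaces" and "(S', c') \<in> surfaces"
    and "iso_class (S, c) = iso_class (S', c')"
  shows "iso_class (S, mc v S c) = iso_class (S', mc v S' c')"
  using multiply_colors_class_subset assms by (metis subset_antisym)

text \<open>The representative is selected by the class it generates and not as an element of
  \<open>X\<close>; equality of generated classes is what the preceding lemma takes as its
  premise.\<close>

definition class_act :: "('m set \<Rightarrow> 'v) \<Rightarrow> ('m, 'v) csurface set \<Rightarrow> ('m, 'v) csurface set" where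
  "class_act v X = (let x = (SOME x. x \<in> surfaces \<and> iso_class x = X)
     in iso_class (fst x, mc v (fst x) (snd x)))"

lemma class_act_class:
  assumes v: "v \<in> circle_colors" and c: "(S, c) \<in> surfaces"
  shows "class_act v (iso_class (S, c)) = iso_class (S, mc v S c)"
proof -
  define x where "x = (SOME x. x \<in> surfaces \<and> iso_class x = iso_class (S, c))"
  have "x \<in> surfaces \<and> iso_class x = iso_class (S, c)"
    unfolding x_def by (rule someI[of _ "(S, c)"]) (simp add: c)
  then show ?thesis
    using multiply_colors_class_eq[OF v _ c, of "fst x" "snd x"] by (simp add: class_act_def Let_def x_def[symmetric])
qed

end

section \<open>The action respects the Bar-Natan relations\<close>

context bar_natan
begin

abbreviation (input) "iso_classes \<equiv> isotopy_classes M A \<alpha> V"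
abbreviation (input) "FB \<equiv> free_module R iso_classes"
abbreviation (input) "surf x \<equiv> single R (iso_class x)"
abbreviation (input) "BN \<equiv> bar_natan_rels M A \<alpha> R V \<Delta> \<epsilon>"
abbreviation (input) "comps \<equiv> components_of M"

lemma class_closed: "x \<in> surfaces \<Longrightarrow> iso_class x \<in> iso_classes"
  by (simp add: isotopy_classes_def quotientI)

lemma classE:
  assumes "X \<in> iso_classes"
  obtains S c where "(S, c) \<in> surfaces" and "X = iso_class (S, c)"
  using assms unfolding isotopy_classes_def by (elim quotientE) auto

lemma surf_closed: "x \<in> surfaces \<Longrightarrow> surf x \<in> carrier FB"
  by (simp add: R.single_closed class_closed)

section \<open>Elimination and introduction rules for the relators\<close>

lemma bar_natan_rels_cases [consumes 1]:
  assumes "p \<in> BN"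
  obtains (add) S c C x y where "(S, c) \<in> surfaces" "C \<in> comps S" "x \<in> carrier V" "y \<in> carrier V"
      "p = surf (S, c(C := x \<oplus>\<^bsub>V\<^esub> y)) \<ominus>\<^bsub>FB\<^esub> (surf (S, c(C := x)) \<oplus>\<^bsub>FB\<^esub> surf (S, c(C := y)))"
  | (smult) S c C r x where "(S, c) \<in> surfaces" "C \<in> comps S" "r \<in> carrier R" "x \<in> carrier V"
      "p = surf (S, c(C := r \<odot>\<^bsub>V\<^esub> x)) \<ominus>\<^bsub>FB\<^esub> r \<odot>\<^bsub>FB\<^esub> surf (S, c(C := x))"
  | (sphere) S c C where "(S, c) \<in> surfaces" "C \<in> comps S" "bounds_ball A S C" "surface_bounding M A \<alpha> (S - C)"
      "p = surf (S, c) \<ominus>\<^bsub>FB\<^esub> \<epsilon> (c C) \<odot>\<^bsub>FB\<^esub> surf (S - C, restrict c (comps S - {C}))"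
  | (separating) S c C S' C1 C2 q where "(S, c) \<in> surfaces" "neck_cut M A S C S'" "surface_bounding M A \<alpha> S'"
      "C1 \<noteq> C2" "C1 \<notin> comps S" "C2 \<notin> comps S" "comps S' = (comps S - {C}) \<union> {C1, C2}" "q \<in> \<Delta> (c C)"
      "p = surf (S, c) \<ominus>\<^bsub>FB\<^esub>
        lin_comb R FB (\<lambda>(a, b). surf (S', restrict (c(C1 := a, C2 := b)) (comps S'))) q"
  | (nonseparating) S c C S' C' where "(S, c) \<in> surfaces" "neck_cut M A S C S'" "surface_bounding M A \<alpha> S'"
      "C' \<notin> comps S" "comps S' = (comps S - {C}) \<union> {C'}"
      "p = surf (S, c) \<ominus>\<^bsub>FB\<^esub> surf (S', restrict (c(C' := handle R V \<Delta> (c C))) (comps S'))"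
  using assms unfolding bar_natan_rels_def Let_def
  by (elim UnE CollectE exE conjE) (rule add smult sphere separating nonseparating; assumption)+

lemma bar_natan_rels_add:
  assumes "(S, c) \<in> surfaces" "C \<in> comps S" "x \<in> carrier V" "y \<in> carrier V"
  shows "surf (S, c(C := x \<oplus>\<^bsub>V\<^esub> y)) \<ominus>\<^bsub>FB\<^esub> (surf (S, c(C := x)) \<oplus>\<^bsub>FB\<^esub> surf (S, c(C := y))) \<in> BN"
  unfolding bar_natan_rels_def Let_def
  by (rule UnI1, rule UnI1, rule UnI1, rule UnI1, rule CollectI, intro exI conjI, rule refl) (rule assms)+

lemma bar_natan_rels_smult:
  assumes "(S, c) \<in> surfaces" "C \<in> comps S" "r \<in> carrier R" "x \<in> carrier V"
  shows "surf (S, c(C := r \<odot>\<^bsub>V\<^esub> x)) \<ominus>\<^bsub>FB\<^esub> r \<odot>\<^bsub>FB\<^esub> surf (S, c(C := x)) \<in> BN"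
  unfolding bar_natan_rels_def Let_def
  by (rule UnI1, rule UnI1, rule UnI1, rule UnI2, rule CollectI, intro exI conjI, rule refl) (rule assms)+

lemma bar_natan_rels_sphere:
  assumes "(S, c) \<in> surfaces" "C \<in> comps S" "bounds_ball A S C" "surface_bounding M A \<alpha> (S - C)"
  shows "surf (S, c) \<ominus>\<^bsub>FB\<^esub> \<epsilon> (c C) \<odot>\<^bsub>FB\<^esub> surf (S - C, restrict c (comps S - {C})) \<in> BN"
  unfolding bar_natan_rels_def Let_def
  by (rule UnI1, rule UnI1, rule UnI2, rule CollectI, intro exI conjI, rule refl) (rule assms)+

lemma bar_natan_rels_separating:
  assumes "(S, c) \<in> surfaces" "neck_cut M A S C S'" "surface_bounding M A \<alpha> S'"
    "C1 \<noteq> C2" "C1 \<notin> comps S" "C2 \<notin> comps S" "comps S' = (comps S - {C}) \<union> {C1, C2}" "q \<in> \<Delta> (c C)"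
  shows "surf (S, c) \<ominus>\<^bsub>FB\<^esub>
    lin_comb R FB (\<lambda>(a, b). surf (S', restrict (c(C1 := a, C2 := b)) (comps S'))) q \<in> BN"
  unfolding bar_natan_rels_def Let_def
  by (rule UnI1, rule UnI2, rule CollectI, intro exI conjI, rule refl) (rule assms)+

lemma bar_natan_rels_nonseparating:
  assumes "(S, c) \<in> surfaces" "neck_cut M A S C S'" "surface_bounding M A \<alpha> S'"
    "C' \<notin> comps S" "comps S' = (comps S - {C}) \<union> {C'}"
  shows "surf (S, c) \<ominus>\<^bsub>FB\<^esub> surf (S', restrict (c(C' := handle R V \<Delta> (c C))) (comps S')) \<in> BN"
  unfolding bar_natan_rels_def Let_def
  by (rule UnI2, rule CollectI, intro exI conjI, rule refl) (rule assms)+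

lemma surfaces_upd:
  assumes "(S, c) \<in> surfaces" and "C \<in> comps S" and "x \<in> carrier V"
  shows "(S, c(C := x)) \<in> surfaces"
  using surfacesD[OF assms(1)] assms(2,3) by (intro surfacesI) (auto simp: extensional_def)

lemma surfaces_remove_component:
  assumes "(S, c) \<in> surfaces" and "C \<in> comps S" and "surface_bounding M A \<alpha> (S - C)"
  shows "(S - C, restrict c (comps S - {C})) \<in> surfaces"
  using surfacesD(5)[OF assms(1)] assms(3)
  by (intro surfacesI) (auto simp: components_of_Diff_component[OF assms(2)])

lemma surfaces_separating:
  assumes "(S, c) \<in> surfaces" and "surface_bounding M A \<alpha> S'"
    and "comps S' = (comps S - {C}) \<union> {C1, C2}" and "a \<in> carrier V" and "b \<in> carrier V"
  shows "(S', restrict (c(C1 := a, C2 := b)) (comps S')) \<in> surfaces"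
  using surfacesD(5)[OF assms(1)] assms(2-) by (intro surfacesI) auto

lemma surfaces_nonseparating:
  assumes "(S, c) \<in> surfaces" and "surface_bounding M A \<alpha> S'"
    and "comps S' = (comps S - {C}) \<union> {C'}" and "a \<in> carrier V"
  shows "(S', restrict (c(C' := a)) (comps S')) \<in> surfaces"
  using surfacesD(5)[OF assms(1)] assms(2-) by (intro surfacesI) auto

lemma neck_cut_component: "neck_cut M A S C S' \<Longrightarrow> C \<in> comps S"
  by (auto simp: neck_cut_def)

lemma bar_natan_rels_subset: "BN \<subseteq> carrier FB"
proof
  interpret F: module R FB
    by (rule R.module_free_module)
  fix p assume "p \<in> BN"
  then show "p \<in> carrier FB"
  proof (cases rule: bar_natan_rels_cases)
    case (add S c C x y)
    then show ?thesis
      by (simp add: surf_closed surfaces_upd)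
  next
    case (smult S c C r x)
    then show ?thesis
      by (simp add: surf_closed surfaces_upd)
  next
    case (sphere S c C)
    then show ?thesis
      by (simp add: surf_closed surfaces_remove_component counit_closed surfacesD(5))
  next
    case (separating S c C S' C1 C2 q)
    have "(\<lambda>(a, b). surf (S', restrict (c(C1 := a, C2 := b)) (comps S'))) \<in> carrier V \<times> carrier V \<rightarrow> carrier FB"
      by (auto intro!: surf_closed surfaces_separating[OF separating(1,3,7)])
    moreover have "q \<in> carrier VV"
      using comult_element(1)[OF _ separating(8)] surfacesD(5)[OF separating(1)] neck_cut_component[OF separating(2)]
      by simp
    ultimately have "lin_comb R FB (\<lambda>(a, b). surf (S', restrict (c(C1 := a, C2 := b)) (comps S'))) q \<in> carrier FB"
      by (rule linear_mapsD(1)[OF R.lin_comb_linear[OF F.module_axioms]])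
    then show ?thesis
      using separating(1,9) by (simp add: surf_closed)
  next
    case (nonseparating S c C S' C')
    have "c C \<in> carrier V"
      using surfacesD(5)[OF nonseparating(1)] neck_cut_component[OF nonseparating(2)] by simp
    then show ?thesis
      using nonseparating(1,6) surfaces_nonseparating[OF nonseparating(1,3,5) handle_closed]
      by (simp add: surf_closed)
  qed
qed

text \<open>Since \<open>S\<close> and \<open>S'\<close> have the same boundary \<open>\<alpha>\<close>, the circles of a removed component are those of the
  components that replace it.\<close>

lemma boundary_circles_replace:
  assumes S: "\<alpha> \<subseteq> S" and S': "\<alpha> \<subseteq> S'" and C: "C \<in> comps S"
    and N: "N \<inter> comps S = {}" and eq: "comps S' = (comps S - {C}) \<union> N"
  shows "boundary_circles C = (\<Union>D\<in>N. boundary_circles D)"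
proof -
  have "a \<subseteq> C \<longleftrightarrow> (\<exists>D\<in>N. a \<subseteq> D)" if a: "a \<in> comps \<alpha>" for a
  proof
    assume aC: "a \<subseteq> C"
    obtain D where D: "D \<in> comps S'" "a \<subseteq> D"
      using circle_in_component[OF a S'] by blast
    \<comment> \<open>Otherwise the circle would lie on two different components of
      \<open>S\<close>, namely \<open>C\<close> and \<open>D\<close>.\<close>
    have "D \<notin> comps S - {C}"
      using circle_component_unique[OF a C aC _ D(2)] by blast
    then show "\<exists>D\<in>N. a \<subseteq> D"
      using D eq by auto
  next
    assume "\<exists>D\<in>N. a \<subseteq> D"
    then obtain D where D: "D \<in> N" "a \<subseteq> D"
      by blast
    obtain E where E: "E \<in> comps S" "a \<subseteq> E"
      using circle_in_component[OF a S] by blast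
    have "E = C"
    proof (rule ccontr)
      assume "E \<noteq> C"
      then have "E = D"
        using circle_component_unique[OF a _ E(2) _ D(2), of S'] E(1) D(1) eq by auto
      then show False
        using E(1) D(1) N by blast
    qed
    then show "a \<subseteq> C"
      using E(2) by simp
  qed
  then show ?thesis
    by (auto simp: boundary_circles_def)
qed

text \<open>No circle lies on both new components, so the finite product over the circles of
  \<open>C\<close> splits into two.\<close>

lemma boundary_color_separating:
  assumes v: "v \<in> circle_colors" and S: "\<alpha> \<subseteq> S" and S': "\<alpha> \<subseteq> S'" and C: "C \<in> comps S"
    and "C1 \<noteq> C2" "C1 \<notin> comps S" "C2 \<notin> comps S" and eq: "comps S' = (comps S - {C}) \<union> {C1, C2}"
  shows "boundary_color v C = boundary_color v C1 \<otimes>\<^bsub>V\<^esub> boundary_color v C2"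
proof -
  have "boundary_circles C = boundary_circles C1 \<union> boundary_circles C2"
    using boundary_circles_replace[OF S S' C _ eq] assms(6,7) by simp
  moreover have "boundary_circles C1 \<inter> boundary_circles C2 = {}"
    using circle_component_unique[of _ M \<alpha> C1 S' C2] assms(5) eq by (auto simp: boundary_circles_def)
  ultimately show ?thesis
    unfolding boundary_color_def using v
    by (simp, intro finprod_Un_disjoint finite_boundary_circles) (auto simp: boundary_circles_def families_def)
qed

text \<open>The ball avoids the boundary of \<open>M\<close>, which contains \<alpha>, so the sphere
  carries no circle and the product is empty.\<close>

lemma boundary_color_sphere:
  assumes "bounds_ball A S C"
  shows "boundary_color v C = \<one>\<^bsub>V\<^esub>"
proof -
  have "C \<inter> manifold_boundary A = {}"
    using assms unfolding bounds_ball_def by (metis (no_types, lifting) Int_iff disjoint_iff image_mono sphere_cball subsetD)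
  then have "C \<inter> \<alpha> = {}"
    using curve by (auto simp: closed_curve_in_boundary_def)
  then have "boundary_circles C = {}"
    using component_subset nonempty_component unfolding boundary_circles_def by blast
  then show ?thesis
    by (simp add: boundary_color_def)
qed

text \<open>The operator before passing to the quotient: here the image of a relator is a formal
  combination that can be compared with other relators.\<close>

definition free_act :: "('m set \<Rightarrow> 'v) \<Rightarrow> (('m, 'v) csurface set \<Rightarrow> 'r) \<Rightarrow> ('m, 'v) csurface set \<Rightarrow> 'r" where
  "free_act v = lin_comb R FB (\<lambda>X. single R (class_act v X))"

context
  fixes v assumes v: "v \<in> circle_colors"
begin

lemma class_act_closed: "X \<in> iso_classes \<Longrightarrow> class_act v X \<in> iso_classes"
  by (auto elim!: classE simp: class_act_class[OF v] class_closed multiply_colors_closed[OF v])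

lemma class_act_Pi: "(\<lambda>X. single R (class_act v X)) \<in> iso_classes \<rightarrow> carrier FB"
  by (auto simp: R.single_closed class_act_closed)

lemma free_act_linear: "free_act v \<in> linear_maps R FB FB"
  unfolding free_act_def by (rule R.lin_comb_linear[OF R.module_free_module class_act_Pi])

lemma free_act_surf: "(S, c) \<in> surfaces \<Longrightarrow> free_act v (surf (S, c)) = surf (S, mc v S c)"
  unfolding free_act_def
  by (simp add: R.lin_comb_single[OF R.module_free_module class_act_Pi] class_closed class_act_class[OF v])

text \<open>Each relator becomes a relator of the same kind for the multiplied coloring, so no
  manipulation inside the span is required.\<close>

lemma free_act_rels:
  assumes p: "p \<in> BN"
  shows "free_act v p \<in> BN"
proof -
  interpret F: module R FB
    by (rule R.module_free_module)
  note minus = linear_maps_minus[OF F.module_axioms F.module_axioms free_act_linear]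
    and lin = linear_mapsD(2,3)[OF free_act_linear]
  note closed = multiply_colors_closed[OF v] and bc = boundary_color_closed[OF v]
  show ?thesis
    using p
  proof (cases rule: bar_natan_rels_cases)
    case (add S c C x y)
    let ?d = "mc v S c" and ?x = "boundary_color v C \<otimes>\<^bsub>V\<^esub> x" and ?y = "boundary_color v C \<otimes>\<^bsub>V\<^esub> y"
    have "free_act v p = surf (S, ?d(C := ?x \<oplus>\<^bsub>V\<^esub> ?y)) \<ominus>\<^bsub>FB\<^esub> (surf (S, ?d(C := ?x)) \<oplus>\<^bsub>FB\<^esub> surf (S, ?d(C := ?y)))"
      using add by (simp add: minus lin surf_closed surfaces_upd free_act_surf multiply_colors_upd_color r_distr bc)
    also have "\<dots> \<in> BN"
      using add closed bc by (intro bar_natan_rels_add) auto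
    finally show ?thesis .
  next
    case (smult S c C r x)
    let ?d = "mc v S c" and ?x = "boundary_color v C \<otimes>\<^bsub>V\<^esub> x"
    have "free_act v p = surf (S, ?d(C := r \<odot>\<^bsub>V\<^esub> ?x)) \<ominus>\<^bsub>FB\<^esub> r \<odot>\<^bsub>FB\<^esub> surf (S, ?d(C := ?x))"
      using smult by (simp add: minus lin surf_closed surfaces_upd free_act_surf multiply_colors_upd_color bc
          mult_smult)
    also have "\<dots> \<in> BN"
      using smult closed bc by (intro bar_natan_rels_smult) auto
    finally show ?thesis .
  next
    case (sphere S c C)
    let ?d = "mc v S c"
    have color: "?d C = c C"
      using sphere surfacesD(5)[OF sphere(1,2)] by (simp add: multiply_colors_eq boundary_color_sphere)
    have rest: "mc v (S - C) (restrict c (comps S - {C})) = restrict ?d (comps S - {C})"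
      by (auto simp: multiply_colors_eq components_of_Diff_component[OF sphere(2)] fun_eq_iff)
    have "free_act v p = surf (S, ?d) \<ominus>\<^bsub>FB\<^esub> \<epsilon> (?d C) \<odot>\<^bsub>FB\<^esub> surf (S - C, restrict ?d (comps S - {C}))"
      using sphere surfaces_remove_component[OF sphere(1,2,4)] surfacesD(5)[OF sphere(1,2)]
      by (simp add: minus lin surf_closed free_act_surf color rest counit_closed)
    also have "\<dots> \<in> BN"
      using closed sphere by (intro bar_natan_rels_sphere)
    finally show ?thesis .
  next
    case (separating S c C S' C1 C2 q)
    let ?d = "mc v S c" and ?u = "boundary_color v C1" and ?w = "boundary_color v C2"
    let ?h = "\<lambda>(a, b). single R (?u \<otimes>\<^bsub>V\<^esub> a, ?w \<otimes>\<^bsub>V\<^esub> b)"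
    let ?k = "\<lambda>(a, b). surf (S', restrict (c(C1 := a, C2 := b)) (comps S'))"
      and ?k' = "\<lambda>(a, b). surf (S', restrict (?d(C1 := a, C2 := b)) (comps S'))"
    note C = neck_cut_component[OF separating(2)]
    note cC = surfacesD(5)[OF separating(1) C]
    note d = closed[OF separating(1)]
    have \<alpha>: "\<alpha> \<subseteq> S" "\<alpha> \<subseteq> S'"
      using surfacesD(3)[OF separating(1)] separating(3) by (auto simp: surface_bounding_def)
    have k: "?k \<in> carrier V \<times> carrier V \<rightarrow> carrier FB"
      by (auto intro!: surf_closed surfaces_separating[OF separating(1,3,7)])
    have k': "?k' \<in> carrier V \<times> carrier V \<rightarrow> carrier FB"
      by (auto intro!: surf_closed surfaces_separating[OF d separating(3,7)])
    have h: "?h \<in> carrier V \<times> carrier V \<rightarrow> carrier VV"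
      using bc by (auto simp: R.single_closed)
    note q = comult_element(1)[OF cC separating(8)]
    note lin_k = R.lin_comb_linear[OF F.module_axioms k]
      and lin_k' = R.lin_comb_linear[OF F.module_axioms k']
    \<comment> \<open>A component of \<open>S'\<close> other than \<open>C1\<close> and
      \<open>C2\<close> is also a component of \<open>S\<close>, with the same circles; only the two
      new colors are treated separately.\<close>
    have colors: "mc v S' (restrict (c(C1 := a, C2 := b)) (comps S')) =
        restrict (?d(C1 := ?u \<otimes>\<^bsub>V\<^esub> a, C2 := ?w \<otimes>\<^bsub>V\<^esub> b)) (comps S')" for a b
      using separating(4,7) by (auto simp: multiply_colors_eq fun_eq_iff)
    have "free_act v (lin_comb R FB ?k q) = lin_comb R FB (\<lambda>b. free_act v (?k b)) q"
      by (rule R.linear_maps_lin_comb[OF F.module_axioms F.module_axioms free_act_linear k q])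
    \<comment> \<open>The factors of the new components are moved from the surfaces into the tensor:
      the acted combination over \<open>q\<close> becomes the neck-cutting combination over a
      transformed representative.\<close>
    also have "\<dots> = lin_comb R FB (\<lambda>b. lin_comb R FB ?k' (?h b)) q"
    proof (rule R.lin_comb_cong[OF F.module_axioms _ _ q])
      show "free_act v (?k b) = lin_comb R FB ?k' (?h b)" if "b \<in> carrier V \<times> carrier V" for b
        using that bc surfaces_separating[OF separating(1,3,7)]
        by (auto simp: free_act_surf colors R.lin_comb_single[OF F.module_axioms k'])
      show "(\<lambda>b. free_act v (?k b)) \<in> carrier V \<times> carrier V \<rightarrow> carrier FB"
        using k linear_mapsD(1)[OF free_act_linear] by blast
    qed
    also have "\<dots> = lin_comb R FB ?k' (lin_comb R VV ?h q)"
      by (rule R.linear_maps_lin_comb[OF R.module_free_module F.module_axioms lin_k' h q, symmetric])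
    finally have "free_act v p = surf (S, ?d) \<ominus>\<^bsub>FB\<^esub> lin_comb R FB ?k' (lin_comb R VV ?h q)"
      using separating(1,9) linear_mapsD(1)[OF lin_k q] by (simp add: minus surf_closed free_act_surf)
    \<comment> \<open>The relators allow every representative of the comultiplied color, so
      membership of the transformed one is all that must be checked; this is the bimodule
      property.\<close>
    also have "lin_comb R VV ?h q \<in> \<Delta> (?d C)"
      using comult_mult_element[OF bc bc cC separating(8), of C1 C2] C
        boundary_color_separating[OF v \<alpha> C separating(4-7)]
      by (simp add: multiply_colors_eq)
    then have "surf (S, ?d) \<ominus>\<^bsub>FB\<^esub> lin_comb R FB ?k' (lin_comb R VV ?h q) \<in> BN"
      by (rule bar_natan_rels_separating[OF d separating(2-7)])
    finally show ?thesis .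
  next
    case (nonseparating S c C S' C')
    let ?d = "mc v S c"
    note C = neck_cut_component[OF nonseparating(2)]
    note cC = surfacesD(5)[OF nonseparating(1) C]
    have \<alpha>: "\<alpha> \<subseteq> S" "\<alpha> \<subseteq> S'"
      using surfacesD(3)[OF nonseparating(1)] nonseparating(3) by (auto simp: surface_bounding_def)
    have "boundary_circles C = boundary_circles C'"
      using boundary_circles_replace[OF \<alpha> C _ nonseparating(5)] nonseparating(4) by simp
    then have "?d C = boundary_color v C' \<otimes>\<^bsub>V\<^esub> c C"
      using C by (simp add: multiply_colors_eq boundary_color_def)
    then have "mc v S' (restrict (c(C' := handle R V \<Delta> (c C))) (comps S')) =
        restrict (?d(C' := handle R V \<Delta> (?d C))) (comps S')"
      using nonseparating(5) handle_mult[OF bc cC, of C'] by (auto simp: multiply_colors_eq fun_eq_iff)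
    then have "free_act v p = surf (S, ?d) \<ominus>\<^bsub>FB\<^esub> surf (S', restrict (?d(C' := handle R V \<Delta> (?d C))) (comps S'))"
      using nonseparating(1,6) surfaces_nonseparating[OF nonseparating(1,3,5) handle_closed[OF cC]]
      by (simp add: minus surf_closed free_act_surf)
    also have "\<dots> \<in> BN"
      by (rule bar_natan_rels_nonseparating[OF closed[OF nonseparating(1)] nonseparating(2-5)])
    finally show ?thesis .
  qed
qed

lemma lin_comb_class_act_rels:
  assumes p: "p \<in> BN"
  shows "lin_comb R (presented_module R iso_classes BN) (\<lambda>X. generator R iso_classes BN (class_act v X)) p =
    \<zero>\<^bsub>presented_module R iso_classes BN\<^esub>"
proof -
  note BN = bar_natan_rels_subset
  have pc: "p \<in> carrier FB"
    using p BN by blast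
  have "lin_comb R (presented_module R iso_classes BN) (\<lambda>X. residue R iso_classes BN (single R (class_act v X))) p =
      residue R iso_classes BN (free_act v p)"
    unfolding free_act_def
    by (rule R.linear_maps_lin_comb[OF R.module_free_module R.module_presented_module[OF BN]
          R.residue_linear[OF BN] class_act_Pi pc, symmetric])
  also have "\<dots> = \<zero>\<^bsub>presented_module R iso_classes BN\<^esub>"
    by (rule R.residue_rels[OF BN free_act_rels[OF p]])
  finally show ?thesis
    by (simp add: generator_eq_residue)
qed

end

section \<open>Multilinearity in the colors of the circles\<close>

lemma residue_diff_rel:
  assumes "p \<ominus>\<^bsub>FB\<^esub> q \<in> BN" and p: "p \<in> carrier FB" and q: "q \<in> carrier FB"
  shows "residue R iso_classes BN p = residue R iso_classes BN q"
proof -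
  note BN = bar_natan_rels_subset
  interpret W: module R "presented_module R iso_classes BN"
    by (rule R.module_presented_module[OF BN])
  have "residue R iso_classes BN p \<ominus>\<^bsub>presented_module R iso_classes BN\<^esub> residue R iso_classes BN q =
      \<zero>\<^bsub>presented_module R iso_classes BN\<^esub>"
    using R.residue_rels[OF BN assms(1)]
      linear_maps_minus[OF R.module_free_module W.module_axioms R.residue_linear[OF BN] p q] by simp
  then show ?thesis
    using W.M.minus_eq_zero_iff R.residue_closed[OF BN] p q by simp
qed

text \<open>\<open>S\<close>, \<open>d\<close> and \<open>C\<close> are obtained before
  \<open>x\<close>: varying the color of one circle is varying the color of one component of a fixed
  colored surface. Multilinearity in \<open>v\<close> thereby reduces to multilinearity in component
  colors.\<close>

lemma class_act_upd:
  assumes v: "v \<in> circle_colors" and i: "i \<in> comps \<alpha>" and X: "X \<in> iso_classes"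
  obtains S d C where "(S, d) \<in> surfaces" "C \<in> comps S"
    "\<forall>x\<in>carrier V. class_act (v(i := x)) X = iso_class (S, d(C := x \<otimes>\<^bsub>V\<^esub> d C))"
proof -
  obtain S c where c: "(S, c) \<in> surfaces" "X = iso_class (S, c)"
    using classE[OF X] .
  obtain C where C: "C \<in> comps S" "i \<subseteq> C"
    using circle_in_component[OF i surfacesD(3)[OF c(1)]] by blast
  show thesis
  proof (rule that)
    show "(S, mc (v(i := \<one>\<^bsub>V\<^esub>)) S c) \<in> surfaces"
      using v i by (intro multiply_colors_closed[OF _ c(1)] families_upd) auto
    show "\<forall>x\<in>carrier V. class_act (v(i := x)) X = iso_class (S, (mc (v(i := \<one>\<^bsub>V\<^esub>)) S c)
        (C := x \<otimes>\<^bsub>V\<^esub> mc (v(i := \<one>\<^bsub>V\<^esub>)) S c C))"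
    proof
      fix x assume x: "x \<in> carrier V"
      show "class_act (v(i := x)) X = iso_class (S, (mc (v(i := \<one>\<^bsub>V\<^esub>)) S c)
          (C := x \<otimes>\<^bsub>V\<^esub> mc (v(i := \<one>\<^bsub>V\<^esub>)) S c C))"
        using class_act_class[OF families_upd[OF v i x] c(1)]
        unfolding multiply_colors_upd_circle[OF v i c(1) C x] c(2) .
    qed
  qed (rule C)
qed

lemma generator_class_act_add:
  assumes v: "v \<in> circle_colors" and i: "i \<in> comps \<alpha>" and x: "x \<in> carrier V" and y: "y \<in> carrier V"
    and X: "X \<in> iso_classes"
  shows "generator R iso_classes BN (class_act (v(i := x \<oplus>\<^bsub>V\<^esub> y)) X) =
    generator R iso_classes BN (class_act (v(i := x)) X) \<oplus>\<^bsub>presented_module R iso_classes BN\<^esub>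
    generator R iso_classes BN (class_act (v(i := y)) X)"
proof -
  note BN = bar_natan_rels_subset
  obtain S d C where d: "(S, d) \<in> surfaces" and C: "C \<in> comps S"
    and eq: "\<forall>x\<in>carrier V. class_act (v(i := x)) X = iso_class (S, d(C := x \<otimes>\<^bsub>V\<^esub> d C))"
    by (rule class_act_upd[OF v i X])
  note dC = surfacesD(5)[OF d C]
  have closed: "surf (S, d(C := x \<otimes>\<^bsub>V\<^esub> d C)) \<in> carrier FB" if "x \<in> carrier V" for x
    using that dC by (intro surf_closed surfaces_upd[OF d C]) simp
  have "surf (S, d(C := (x \<oplus>\<^bsub>V\<^esub> y) \<otimes>\<^bsub>V\<^esub> d C)) \<ominus>\<^bsub>FB\<^esub>
      (surf (S, d(C := x \<otimes>\<^bsub>V\<^esub> d C)) \<oplus>\<^bsub>FB\<^esub> surf (S, d(C := y \<otimes>\<^bsub>V\<^esub> d C))) \<in> BN"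
    using bar_natan_rels_add[OF d C, of "x \<otimes>\<^bsub>V\<^esub> d C" "y \<otimes>\<^bsub>V\<^esub> d C"] x y dC by (simp add: l_distr)
  from residue_diff_rel[OF this] show ?thesis
    using x y closed linear_mapsD(2)[OF R.residue_linear[OF BN]]
    by (simp add: eq generator_eq_residue R.free_module_add_closed)
qed

lemma generator_class_act_smult:
  assumes v: "v \<in> circle_colors" and i: "i \<in> comps \<alpha>" and r: "r \<in> carrier R" and x: "x \<in> carrier V"
    and X: "X \<in> iso_classes"
  shows "generator R iso_classes BN (class_act (v(i := r \<odot>\<^bsub>V\<^esub> x)) X) =
    r \<odot>\<^bsub>presented_module R iso_classes BN\<^esub> generator R iso_classes BN (class_act (v(i := x)) X)"
proof -
  note BN = bar_natan_rels_subset
  obtain S d C where d: "(S, d) \<in> surfaces" and C: "C \<in> comps S"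
    and eq: "\<forall>x\<in>carrier V. class_act (v(i := x)) X = iso_class (S, d(C := x \<otimes>\<^bsub>V\<^esub> d C))"
    by (rule class_act_upd[OF v i X])
  note dC = surfacesD(5)[OF d C]
  have closed: "surf (S, d(C := x \<otimes>\<^bsub>V\<^esub> d C)) \<in> carrier FB" if "x \<in> carrier V" for x
    using that dC by (intro surf_closed surfaces_upd[OF d C]) simp
  have "surf (S, d(C := (r \<odot>\<^bsub>V\<^esub> x) \<otimes>\<^bsub>V\<^esub> d C)) \<ominus>\<^bsub>FB\<^esub> r \<odot>\<^bsub>FB\<^esub> surf (S, d(C := x \<otimes>\<^bsub>V\<^esub> d C)) \<in> BN"
    using bar_natan_rels_smult[OF d C r, of "x \<otimes>\<^bsub>V\<^esub> d C"] x dC by (simp add: smult_assoc2 r)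
  from residue_diff_rel[OF this] show ?thesis
    using x r closed linear_mapsD(3)[OF R.residue_linear[OF BN]]
    by (simp add: eq generator_eq_residue R.free_module_smult_closed)
qed

theorem ex1_bar_natan_action:
  "\<exists>!act. act \<in> (carrier (tensor_power R V (comps \<alpha>)) \<rightarrow>\<^sub>E
      (carrier (presented_module R iso_classes BN) \<rightarrow>\<^sub>E carrier (presented_module R iso_classes BN))) \<and>
    module (tensor_power R V (comps \<alpha>)) (with_action (presented_module R iso_classes BN) act) \<and>
    (\<forall>r\<in>carrier R. \<forall>w\<in>carrier (presented_module R iso_classes BN).
      act (r \<odot>\<^bsub>tensor_power R V (comps \<alpha>)\<^esub> \<one>\<^bsub>tensor_power R V (comps \<alpha>)\<^esub>) w =
        r \<odot>\<^bsub>presented_module R iso_classes BN\<^esub> w) \<and>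
    (\<forall>v\<in>circle_colors. \<forall>X\<in>iso_classes.
       act (pure_tensor R V (comps \<alpha>) v) (generator R iso_classes BN X) = generator R iso_classes BN (class_act v X))"
proof (rule ex1_tensor_power_action[OF bar_natan_rels_subset])
  show "class_act (\<lambda>i\<in>comps \<alpha>. \<one>\<^bsub>V\<^esub>) X = X" if "X \<in> iso_classes" for X
    using that by (auto elim!: classE simp: class_act_class[OF one_family] multiply_colors_one)
  show "class_act (\<lambda>i\<in>comps \<alpha>. u i \<otimes>\<^bsub>V\<^esub> v i) X = class_act u (class_act v X)"
    if "u \<in> circle_colors" "v \<in> circle_colors" "X \<in> iso_classes" for u v X
    using that by (auto elim!: classE simp: class_act_class mult_families multiply_colors_mult multiply_colors_closed)
qed (use class_act_closed generator_class_act_add generator_class_act_smult lin_comb_class_act_rels in auto)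

end

theorem proposition1p1:
  fixes R :: "('r, 'k) ring_scheme" and V :: "('r, 'v, 'l) module_scheme"
    and \<Delta> :: "'v \<Rightarrow> ('v \<times> 'v \<Rightarrow> 'r) set" and \<epsilon> :: "'v \<Rightarrow> 'r"
    and M :: "'m topology" and A :: "('m, real^3) coord set" and \<alpha> :: "'m set"
  defines "T \<equiv> tensor_power R V (components_of M \<alpha>)"
    and "W \<equiv> bar_natan_module M A \<alpha> R V \<Delta> \<epsilon>"
  assumes "cring R" and "frobenius_algebra R V \<Delta> \<epsilon>"
    and "smooth_manifold M A" and "compact_space M" and "connected_space M" and "orientable M A"
    and "closed_curve_in_boundary M A \<alpha>"
  shows "\<exists>!act. act \<in> (carrier T \<rightarrow>\<^sub>E (carrier W \<rightarrow>\<^sub>E carrier W)) \<and>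
    module T (with_action W act) \<and>
    (\<forall>r\<in>carrier R. \<forall>w\<in>carrier W. act (r \<odot>\<^bsub>T\<^esub> \<one>\<^bsub>T\<^esub>) w = r \<odot>\<^bsub>W\<^esub> w) \<and>
    (\<forall>v\<in>components_of M \<alpha> \<rightarrow>\<^sub>E carrier V. \<forall>(S, c)\<in>colored_surfaces M A \<alpha> V.
       act (pure_tensor R V (components_of M \<alpha>) v) (bar_natan_class M A \<alpha> R V \<Delta> \<epsilon> (S, c))
         = bar_natan_class M A \<alpha> R V \<Delta> \<epsilon> (S, multiply_colors M \<alpha> V v S c))"
proof -
  interpret bar_natan R V \<Delta> \<epsilon> M A \<alpha>
    using assms by (simp add: bar_natan_def bar_natan_axioms_def)
  let ?C = "isotopy_classes M A \<alpha> V" and ?rels = "bar_natan_rels M A \<alpha> R V \<Delta> \<epsilon>"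
  \<comment> \<open>Every class comes from a colored surface, and \<open>class_act\<close> is
    computed on it by multiplying colors, so prescribing the action on classes or on colored
    surfaces is the same condition.\<close>
  have "(\<forall>v\<in>families V (components_of M \<alpha>). \<forall>X\<in>?C.
        act (pure_tensor R V (components_of M \<alpha>) v) (generator R ?C ?rels X) = generator R ?C ?rels (class_act v X))
    \<longleftrightarrow> (\<forall>v\<in>components_of M \<alpha> \<rightarrow>\<^sub>E carrier V. \<forall>(S, c)\<in>colored_surfaces M A \<alpha> V.
       act (pure_tensor R V (components_of M \<alpha>) v) (bar_natan_class M A \<alpha> R V \<Delta> \<epsilon> (S, c))
         = bar_natan_class M A \<alpha> R V \<Delta> \<epsilon> (S, multiply_colors M \<alpha> V v S c))" (is "?l \<longleftrightarrow> ?r") for act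
  proof
    assume ?l
    then show ?r
      using class_closed class_act_class by (fastforce simp: bar_natan_class_def families_def)
  next
    assume ?r
    then show ?l
      by (fastforce elim!: classE simp: bar_natan_class_def class_act_class families_def)
  qed
  then show ?thesis
    using ex1_bar_natan_action unfolding T_def W_def bar_natan_module_def by simp
qed

end
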